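(* Let $1\le N\le 3$, $a,b>0$, $1\le q<2$ and $2<p<2+\frac{4}{N}$. Let $h:\mathbb{R}^N\to\mathbb{R}$ satisfy $h(x)\ge 0$, $h\in L^{\frac{2}{2-q}}(\mathbb{R}^N)$, and $h>0$ on a set of positive measure. Then for every $c>0$ the infimum $$l_c:=\inf_{u\in S_c} I(u)$$ is attained, and hence the problem $$-\Big(a+b\int_{\mathbb{R}^N}|\nabla u|^2dx\Big)\Delta u+\lambda u=|u|^{p-2}u+h(x)|u|^{q-2}u \ \text{ in } \mathbb{R}^N,\qquad \int_{\mathbb{R}^N}|u|^2dx=c,$$ has a normalized ground state solution $(u,\lambda)\in H^1(\mathbb{R}^N)\times\mathbb{R}$ (i.e. $u\in S_c$ is a global minimizer of $I$ on $S_c$ and $\lambda$ is the associated Lagrange multiplier).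
   Context: $S_c:=\{u\in H^1(\mathbb{R}^N):\|u\|_2^2=c\}$. The energy functional is $I(u)=\frac a2\int|\nabla u|^2dx+\frac b4\big(\int|\nabla u|^2dx\big)^2-\frac1p\int|u|^pdx-\frac1q\int h(x)|u|^qdx$ (integrals over $\mathbb{R}^N$). *)

theory Defs
  imports "HOL-Analysis.Analysis"
begin

definition test_fun :: "('a::euclidean_space \<Rightarrow> real) \<Rightarrow> ('a \<Rightarrow> 'a \<Rightarrow> real) \<Rightarrow> bool" where
  "test_fun \<phi> D \<longleftrightarrow>
     (\<forall>x. (\<phi> has_derivative D x) (at x)) \<and>
     (\<forall>i\<in>Basis. continuous_on UNIV (\<lambda>x. D x i)) \<and>
     compact (closure {x. \<phi> x \<noteq> 0})"

definition is_weak_grad :: "('a::euclidean_space \<Rightarrow> real) \<Rightarrow> ('a \<Rightarrow> 'a) \<Rightarrow> bool" where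
  "is_weak_grad u g \<longleftrightarrow>
     (\<forall>\<phi> D. test_fun \<phi> D \<longrightarrow>
        (\<forall>i\<in>Basis. (LINT x|lborel. u x * D x i) = - (LINT x|lborel. (g x \<bullet> i) * \<phi> x)))"

definition H1 :: "('a::euclidean_space \<Rightarrow> real) set" where
  "H1 = {u. u \<in> borel_measurable lborel \<and> integrable lborel (\<lambda>x. (u x)\<^sup>2) \<and>
            (\<exists>g. g \<in> borel_measurable lborel \<and> integrable lborel (\<lambda>x. (norm (g x))\<^sup>2) \<and>
                 is_weak_grad u g)}"

text \<open>The (a.e. unique) weak gradient in L^2.\<close>
definition wgrad :: "('a::euclidean_space \<Rightarrow> real) \<Rightarrow> 'a \<Rightarrow> 'a" where
  "wgrad u = (SOME g. g \<in> borel_measurable lborel \<and> integrable lborel (\<lambda>x. (norm (g x))\<^sup>2) \<and>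
                      is_weak_grad u g)"

definition dirichlet :: "('a::euclidean_space \<Rightarrow> real) \<Rightarrow> real" where
  "dirichlet u = (LINT x|lborel. (norm (wgrad u x))\<^sup>2)"

definition S :: "real \<Rightarrow> ('a::euclidean_space \<Rightarrow> real) set" where
  "S c = {u \<in> H1. (LINT x|lborel. (u x)\<^sup>2) = c}"

definition energy :: "real \<Rightarrow> real \<Rightarrow> real \<Rightarrow> real \<Rightarrow> ('a::euclidean_space \<Rightarrow> real)
                      \<Rightarrow> ('a \<Rightarrow> real) \<Rightarrow> real" where
  "energy a b p q h u =
     a / 2 * dirichlet u + b / 4 * (dirichlet u)\<^sup>2
     - 1 / p * (LINT x|lborel. \<bar>u x\<bar> powr p)
     - 1 / q * (LINT x|lborel. h x * \<bar>u x\<bar> powr q)"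

text \<open>Weak form of
  -(a + b int|grad u|^2) Laplace u + lambda u = |u|^(p-2) u + h |u|^(q-2) u,
  tested against every v in H^1. |u|^(s-2) u is written sgn u * |u|^(s-1).\<close>
definition weak_solution :: "real \<Rightarrow> real \<Rightarrow> real \<Rightarrow> real \<Rightarrow> ('a::euclidean_space \<Rightarrow> real)
                              \<Rightarrow> ('a \<Rightarrow> real) \<Rightarrow> real \<Rightarrow> bool" where
  "weak_solution a b p q h u lam \<longleftrightarrow>
     (\<forall>v\<in>H1.
        (a + b * dirichlet u) * (LINT x|lborel. wgrad u x \<bullet> wgrad v x)
        + lam * (LINT x|lborel. u x * v x)
        = (LINT x|lborel. sgn (u x) * \<bar>u x\<bar> powr (p - 1) * v x)
        + (LINT x|lborel. h x * sgn (u x) * \<bar>u x\<bar> powr (q - 1) * v x))"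

end

(*
  Take a minimizing sequence u_n with a weak limit w and put v_n = u_n - w. The Dirichlet integral, the mass
  and the L^p term split asymptotically into the parts of w and of v_n, and the h-term only sees w.
  If mass is lost, it is recovered with the competitors sqrt (w^2 + v^2), which add the masses, do not
  increase the sum of the Dirichlet integrals (hence the Kirchhoff cross term causes no loss), and can only
  increase the two power terms. Either v_n vanishes in L^p; then a widely spread profile v lowers the energy of w,
  since p < 2 + 4/N. Or v_n does not vanish; then a translate of v_n overlaps {h > 0}, and the
  h-term gains a fixed amount over the splitting. Both contradict minimality.

  Sobolev theory is replaced by the bound ||u (. + y) - u|| <= |y| ||grad u|| in L^2: it controls the distance
  of u to its ball averages, which yields local compactness, the subcritical L^p bound (by summing over
  dyadic levels) and the nonvanishing alternative; conversely, bounded difference quotients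
  characterise H^1, which gives the competitors without a chain rule.

  For the Euler-Lagrange equation the power terms, being convex with a negative sign, are replaced by their
  tangents; the resulting upper bound is differentiable along the normalised line u + t v also for q = 1.
*)
theory Submission
  imports Defs "HOL-Library.Diagonal_Subsequence"
begin

section \<open>Square integrable functions and weak limits\<close>

text \<open>Only one-sided asymptotics are used. Splitting off \<open>w\<close> needs a lower bound
  for the Dirichlet integral of \<open>u n\<close> and upper bounds for its two power terms. So
  \<open>weak_limit\<close> may give the lower semicontinuity of the gradient as an eventual
  inequality against the limit itself, without passing to a subsequence, and half of a Brezis-Lieb
  lemma suffices for the L^p term. The obstacle is mass: a weak limit may weigh less than
  \<open>c\<close>, and the problem is translation invariant up to the \<open>h\<close>-term. The
  contradiction needs a gain that does not shrink along the sequence. It comes from fixed data: a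
  bounded set of positive measure on which \<open>h\<close> is bounded below and \<open>w\<close> is
  bounded above, and a lower bound on averages that depends only on the bounds for mass, gradient
  and L^p term. The mass of the remainder only tends to the missing mass, so the remainder is first
  multiplied by factors tending to 1. The \<open>h\<close>-term passes to the a.e. limit because
  \<open>h |u|^q\<close> is at most \<open>e u^2\<close> plus a fixed integrable function, for every
  \<open>e > 0\<close>.\<close>

definition sqint :: "'m measure \<Rightarrow> ('m \<Rightarrow> 'b::euclidean_space) \<Rightarrow> bool" where
  "sqint M f \<longleftrightarrow> f \<in> borel_measurable M \<and> integrable M (\<lambda>x. (norm (f x))\<^sup>2)"

definition ip :: "'m measure \<Rightarrow> ('m \<Rightarrow> 'b::euclidean_space) \<Rightarrow> ('m \<Rightarrow> 'b) \<Rightarrow> real" where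
  "ip M f g = (LINT x|M. f x \<bullet> g x)"

definition nsq :: "'m measure \<Rightarrow> ('m \<Rightarrow> 'b::euclidean_space) \<Rightarrow> real" where
  "nsq M f = (LINT x|M. (norm (f x))\<^sup>2)"

lemma sqint_integrable: "sqint M f \<Longrightarrow> integrable M (\<lambda>x. (norm (f x))\<^sup>2)"
  by (simp add: sqint_def)

lemma nsq_nonneg: "nsq M f \<ge> 0"
  unfolding nsq_def by simp

lemma ip_self: "ip M f f = nsq M f"
  unfolding ip_def nsq_def by (simp add: power2_norm_eq_inner)

lemma ip_commute: "ip M f g = ip M g f"
  unfolding ip_def by (simp add: inner_commute)

lemma norm_add_sq_le: "(norm (x + y))\<^sup>2 \<le> 2 * (norm x)\<^sup>2 + 2 * (norm (y::'b::real_inner))\<^sup>2"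
proof -
  have "0 \<le> (norm (x - y))\<^sup>2" by simp
  then show ?thesis
    by (simp add: power2_norm_eq_inner inner_simps inner_commute)
qed

lemma abs_inner_le_sq: "\<bar>x \<bullet> y\<bar> \<le> (norm x)\<^sup>2 + (norm (y::'b::real_inner))\<^sup>2"
proof -
  have "\<bar>x \<bullet> y\<bar> \<le> norm x * norm y" by (rule Cauchy_Schwarz_ineq2)
  also have "\<dots> \<le> (norm x)\<^sup>2 + (norm y)\<^sup>2"
    using sum_squares_bound[of "norm x" "norm y"] mult_nonneg_nonneg[OF norm_ge_zero[of x]
        norm_ge_zero[of y]]
    by linarith
  finally show ?thesis .
qed

lemma sqint_scaleR: assumes "sqint M f" shows "sqint M (\<lambda>x. c *\<^sub>R f x)"
  using assms unfolding sqint_def by (auto simp: power_mult_distrib)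

lemma sqint_add: assumes "sqint M f" "sqint M g" shows "sqint M (\<lambda>x. f x + g x)"
proof -
  have [measurable]: "f \<in> borel_measurable M" "g \<in> borel_measurable M"
    using assms by (auto simp: sqint_def)
  have "integrable M (\<lambda>x. 2 * (norm (f x))\<^sup>2 + 2 * (norm (g x))\<^sup>2)"
    using assms by (auto simp: sqint_def)
  then have "integrable M (\<lambda>x. (norm (f x + g x))\<^sup>2)"
    by (rule Bochner_Integration.integrable_bound) (auto intro!: order_trans[OF norm_add_sq_le])
  then show ?thesis by (simp add: sqint_def)
qed

lemma sqint_diff: assumes "sqint M f" "sqint M g" shows "sqint M (\<lambda>x. f x - g x)"
  using sqint_add[OF assms(1) sqint_scaleR[OF assms(2), of "-1"]] by simp

lemma sqint_zero: "sqint M (\<lambda>x. 0)"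
  by (simp add: sqint_def)

lemma integrable_inner: assumes "sqint M f" "sqint M g" shows "integrable M (\<lambda>x. f x \<bullet> g x)"
proof -
  have [measurable]: "f \<in> borel_measurable M" "g \<in> borel_measurable M"
    using assms by (auto simp: sqint_def)
  have "integrable M (\<lambda>x. (norm (f x))\<^sup>2 + (norm (g x))\<^sup>2)"
    using assms by (auto simp: sqint_def)
  then show ?thesis
    by (rule Bochner_Integration.integrable_bound) (auto intro!: AE_I2 abs_inner_le_sq
        order_trans[OF abs_inner_le_sq])
qed

lemma ip_add: assumes "sqint M f" "sqint M g" "sqint M h"
  shows "ip M (\<lambda>x. f x + g x) h = ip M f h + ip M g h"
  unfolding ip_def using assms by (simp add: inner_add_left integrable_inner)

lemma ip_diff: assumes "sqint M f" "sqint M g" "sqint M h"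
  shows "ip M (\<lambda>x. f x - g x) h = ip M f h - ip M g h"
  unfolding ip_def using assms by (simp add: inner_diff_left integrable_inner)

lemma ip_scaleR: "ip M (\<lambda>x. c *\<^sub>R f x) h = c * ip M f h"
  unfolding ip_def by simp

lemma nsq_add: assumes "sqint M f" "sqint M g"
  shows "nsq M (\<lambda>x. f x + g x) = nsq M f + 2 * ip M f g + nsq M g"
proof -
  have "nsq M (\<lambda>x. f x + g x) = (LINT x|M. (norm (f x))\<^sup>2 + 2 * (f x \<bullet> g x) + (norm (g x))\<^sup>2)"
    unfolding nsq_def
    by (intro Bochner_Integration.integral_cong)
      (auto simp: power2_norm_eq_inner inner_simps inner_commute)
  also have "\<dots> = nsq M f + 2 * ip M f g + nsq M g"
    using assms by (simp add: nsq_def ip_def integrable_inner sqint_integrable)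
  finally show ?thesis .
qed

lemma nsq_scaleR: "nsq M (\<lambda>x. c *\<^sub>R f x) = c\<^sup>2 * nsq M f"
  unfolding nsq_def by (simp add: power_mult_distrib)

lemma nsq_diff: assumes "sqint M f" "sqint M g"
  shows "nsq M (\<lambda>x. f x - g x) = nsq M f - 2 * ip M f g + nsq M g"
  using nsq_add[OF assms(1) sqint_scaleR[OF assms(2), of "-1"]]
    ip_scaleR[of M "-1" g f] nsq_scaleR[of M "-1" g] by (simp add: ip_commute)

lemma nsq_diff_le: assumes "sqint M f" "sqint M g"
  shows "nsq M (\<lambda>x. f x - g x) \<le> 2 * nsq M f + 2 * nsq M g"
  using nsq_add[OF assms] nsq_diff[OF assms] nsq_nonneg[of M "\<lambda>x. f x + g x"] by linarith

lemma ip_sq_le: assumes f: "sqint M f" and g: "sqint M g"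
  shows "(ip M f g)\<^sup>2 \<le> nsq M f * nsq M g"
proof -
  have *: "0 \<le> nsq M f + 2 * t * ip M f g + t\<^sup>2 * nsq M g" for t
    using nsq_add[OF f sqint_scaleR[OF g, of t]] nsq_nonneg[of M "\<lambda>x. f x + t *\<^sub>R g x"]
      ip_scaleR[of M t g f] nsq_scaleR[of M t g] by (simp add: ip_commute)
  show ?thesis
  proof (cases "nsq M g = 0")
    case True
    have "ip M f g = 0"
    proof (rule ccontr)
      assume "ip M f g \<noteq> 0"
      \<comment> \<open>With \<open>nsq M g = 0\<close> the quadratic in \<open>t\<close> is affine,
        and this \<open>t\<close> gives it the value -1.\<close>
      with *[of "- (nsq M f + 1) / (2 * ip M f g)"] True show False
        by (simp add: field_simps)
    qed
    then show ?thesis using True by simp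
  next
    case False
    with nsq_nonneg[of M g] have "nsq M g > 0" by simp
    \<comment> \<open>The minimum point of the quadratic.\<close>
    with *[of "- ip M f g / nsq M g"] show ?thesis
      by (simp add: field_simps power2_eq_square)
  qed
qed

lemma abs_ip_le: assumes "sqint M f" "sqint M g"
  shows "\<bar>ip M f g\<bar> \<le> sqrt (nsq M f) * sqrt (nsq M g)"
  using real_sqrt_le_mono[OF ip_sq_le[OF assms]] by (simp add: real_sqrt_mult)

lemma tendsto_ip:
  assumes F: "\<And>n. sqint M (F n)" and f: "sqint M f" and g: "sqint M g"
    and lim: "(\<lambda>n. nsq M (\<lambda>x. F n x - f x)) \<longlonglongrightarrow> 0"
  shows "(\<lambda>n. ip M (F n) g) \<longlonglongrightarrow> ip M f g"
proof -
  have "(\<lambda>n. sqrt (nsq M (\<lambda>x. F n x - f x)) * sqrt (nsq M g)) \<longlonglongrightarrow> sqrt 0 * sqrt (nsq M g)"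
    by (intro tendsto_intros lim)
  then have 0: "(\<lambda>n. sqrt (nsq M (\<lambda>x. F n x - f x)) * sqrt (nsq M g)) \<longlonglongrightarrow> 0" by simp
  have "(\<lambda>n. ip M (F n) g - ip M f g) \<longlonglongrightarrow> 0"
    by (rule Lim_null_comparison[OF always_eventually 0])
      (use abs_ip_le[OF sqint_diff[OF F f] g] in \<open>simp add: ip_diff F f g\<close>)
  then show ?thesis by (simp add: LIM_zero_iff)
qed

lemma tendsto_nsq:
  assumes F: "\<And>n. sqint M (F n)" and f: "sqint M f"
    and lim: "(\<lambda>n. nsq M (\<lambda>x. F n x - f x)) \<longlonglongrightarrow> 0"
  shows "(\<lambda>n. nsq M (F n)) \<longlonglongrightarrow> nsq M f"
proof -
  have "(\<lambda>n. nsq M (\<lambda>x. F n x - f x) + 2 * ip M (F n) f - nsq M f) \<longlonglongrightarrow> 0 + 2 * ip M f f - nsq M f"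
    by (intro tendsto_intros lim tendsto_ip F f)
  then show ?thesis by (simp add: nsq_diff[OF F f] ip_self)
qed

lemma ennreal_nsq: assumes "sqint M f"
  shows "ennreal (nsq M f) = (\<integral>\<^sup>+x. ennreal ((norm (f x))\<^sup>2) \<partial>M)"
  unfolding nsq_def using assms by (intro nn_integral_eq_integral[symmetric]) (auto simp: sqint_def)

lemma sqintI_nn:
  assumes [measurable]: "f \<in> borel_measurable M"
    and "(\<integral>\<^sup>+x. ennreal ((norm (f x))\<^sup>2) \<partial>M) \<le> ennreal B" "0 \<le> B"
  shows "sqint M f" "nsq M f \<le> B"
proof -
  have "integrable M (\<lambda>x. (norm (f x))\<^sup>2)"
    using assms by (intro integrableI_bounded) (auto simp: order_le_less_trans[OF _
        ennreal_less_top])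
  then show *: "sqint M f" by (simp add: sqint_def)
  show "nsq M f \<le> B" using assms ennreal_nsq[OF *] by (metis ennreal_le_iff)
qed

text \<open>Riesz-Fischer: a fast subsequence converges almost everywhere, and Fatou's lemma along
  it turns the Cauchy bound into convergence of the whole sequence.\<close>

lemma L2_complete:
  fixes F :: "nat \<Rightarrow> 'm \<Rightarrow> 'b::euclidean_space"
  assumes F: "\<And>n. sqint M (F n)"
    and cauchy: "\<And>e. e > 0 \<Longrightarrow> \<exists>N. \<forall>m\<ge>N. \<forall>n\<ge>N. nsq M (\<lambda>x. F m x - F n x) < e"
  obtains f where "sqint M f" "(\<lambda>n. nsq M (\<lambda>x. F n x - f x)) \<longlonglongrightarrow> 0"
proof -
  have [measurable]: "F n \<in> borel_measurable M" for n using F by (auto simp: sqint_def)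
  define N where "N k = (SOME N. \<forall>m\<ge>N. \<forall>n\<ge>N. nsq M (\<lambda>x. F m x - F n x) < (1/4)^k)" for k :: nat
  have N: "nsq M (\<lambda>x. F m x - F n x) < (1/4)^k" if "m \<ge> N k" "n \<ge> N k" for m n k
    using someI_ex[OF cauchy[of "(1/4)^k"]] that unfolding N_def by auto
  \<comment> \<open>The cumulative sum makes \<open>r\<close> nondecreasing while dominating both
    \<open>N k\<close> and \<open>k\<close>.\<close>
  define r where "r k = k + (\<Sum>j\<le>k. N j)" for k
  have rN: "r k \<ge> N k" for k
    unfolding r_def using member_le_sum[of k "{..k}" N] by auto
  have rk: "r k \<ge> k" for k by (simp add: r_def)
  have rSuc: "r (Suc k) \<ge> r k" for k by (simp add: r_def)
  have rNS: "r (Suc k) \<ge> N k" for k using rSuc rN le_trans by blast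
  define d where "d k x = F (r (Suc k)) x - F (r k) x" for k x
  have [measurable]: "d k \<in> borel_measurable M" for k unfolding d_def by measurable
  have d: "sqint M (d k)" for k unfolding d_def by (intro sqint_diff F)
  have dn: "nsq M (d k) < (1/4)^k" for k unfolding d_def by (intro N rNS rN)
  \<comment> \<open>The weight \<open>2^k\<close> splits the decay \<open>(1/4)^k\<close>: half of
    it keeps the integrals summable, the other half is left as pointwise geometric decay of
    \<open>d k x\<close>.\<close>
  have "(\<integral>\<^sup>+x. (\<Sum>k. ennreal (2^k * (norm (d k x))\<^sup>2)) \<partial>M) = (\<Sum>k. \<integral>\<^sup>+x. ennreal (2^k * (norm (d k
      x))\<^sup>2) \<partial>M)"
    by (intro nn_integral_suminf) measurable
  also have "\<dots> = (\<Sum>k. ennreal (2^k * nsq M (d k)))"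
    by (simp add: ennreal_mult nn_integral_cmult ennreal_nsq[OF d] nsq_nonneg)
  also have "\<dots> \<le> (\<Sum>k. ennreal ((1/2)^k))"
  proof (intro suminf_le ennreal_leI)
    fix k
    have "2^k * nsq M (d k) \<le> 2^k * (1/4)^k" using dn[of k] by simp
    also have "\<dots> = (1/2::real)^k" by (simp add: power_mult_distrib[symmetric])
    finally show "2^k * nsq M (d k) \<le> (1/2)^k" .
  qed auto
  also have "\<dots> = ennreal (\<Sum>k. (1/2)^k)"
    by (intro suminf_ennreal2) (auto intro!: summable_geometric)
  also have "\<dots> < \<infinity>" by simp
  finally have "AE x in M. (\<Sum>k. ennreal (2^k * (norm (d k x))\<^sup>2)) \<noteq> \<infinity>"
    by (intro nn_integral_PInf_AE) auto
  then have conv: "AE x in M. convergent (\<lambda>k. F (r k) x)"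
  proof (eventually_elim)
    case (elim x)
    have sm: "summable (\<lambda>k. 2^k * (norm (d k x))\<^sup>2)"
      using elim by (intro summable_suminf_not_top) auto
    then have "(\<lambda>k. 2^k * (norm (d k x))\<^sup>2) \<longlonglongrightarrow> 0" by (rule summable_LIMSEQ_zero)
    then have "Bseq (\<lambda>k. 2^k * (norm (d k x))\<^sup>2)" by (intro convergent_imp_Bseq convergentI)
    then obtain C where C: "C > 0" "\<And>k. norm (2^k * (norm (d k x))\<^sup>2) \<le> C" by (auto elim: BseqE)
    have "norm (d k x) \<le> sqrt C * (sqrt (1/2))^k" for k
    proof -
      have "(norm (d k x))\<^sup>2 \<le> C * (1/2)^k"
        using C(2)[of k] by (simp add: field_simps)
      then have "sqrt ((norm (d k x))\<^sup>2) \<le> sqrt (C * (1/2)^k)" by (rule real_sqrt_le_mono)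
      then show ?thesis by (simp add: real_sqrt_mult real_sqrt_power)
    qed
    then have "summable (\<lambda>k. d k x)"
      by (rule summable_comparison_test'[where N=0, rotated])
        (intro summable_mult summable_geometric, simp add: real_sqrt_divide)
    then have "convergent (\<lambda>n. \<Sum>k<n. d k x)" by (simp add: summable_iff_convergent)
    moreover have "(\<Sum>k<n. d k x) = F (r n) x - F (r 0) x" for n
      unfolding d_def by (rule sum_lessThan_telescope)
    ultimately have "convergent (\<lambda>n. F (r n) x - F (r 0) x)" by simp
    then have "convergent (\<lambda>n. (F (r n) x - F (r 0) x) + F (r 0) x)"
      by (intro convergent_add convergent_const)
    then show ?case by simp
  qed
  define f where "f x = lim (\<lambda>k. F (r k) x)" for x
  have [measurable]: "f \<in> borel_measurable M" unfolding f_def by measurable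
  have AEf: "AE x in M. (\<lambda>k. F (r k) x) \<longlonglongrightarrow> f x"
    using conv by eventually_elim (simp add: f_def convergent_LIMSEQ_iff)
  \<comment> \<open>Stated with the nonnegative integral, since square integrability of
    \<open>f\<close> is only deduced from this bound.\<close>
  have main: "\<exists>n0. \<forall>n\<ge>n0. (\<integral>\<^sup>+x. ennreal ((norm (F n x - f x))\<^sup>2) \<partial>M) \<le> ennreal e" if "e > 0" for e
  proof -
    obtain n0 where n0: "\<And>m n. m \<ge> n0 \<Longrightarrow> n \<ge> n0 \<Longrightarrow> nsq M (\<lambda>x. F m x - F n x) < e"
      using cauchy[OF \<open>e > 0\<close>] by blast
    have "(\<integral>\<^sup>+x. ennreal ((norm (F n x - f x))\<^sup>2) \<partial>M) \<le> ennreal e" if n: "n \<ge> n0" for n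
    proof -
      have "(\<integral>\<^sup>+x. ennreal ((norm (F n x - f x))\<^sup>2) \<partial>M)
          = (\<integral>\<^sup>+x. liminf (\<lambda>k. ennreal ((norm (F n x - F (r k) x))\<^sup>2)) \<partial>M)"
        using AEf
        by (intro nn_integral_cong_AE, eventually_elim)
          (intro lim_imp_Liminf[symmetric] tendsto_intros, auto intro!: tendsto_intros)
      also have "\<dots> \<le> liminf (\<lambda>k. \<integral>\<^sup>+x. ennreal ((norm (F n x - F (r k) x))\<^sup>2) \<partial>M)"
        by (intro nn_integral_liminf) measurable
      also have "\<dots> = liminf (\<lambda>k. ennreal (nsq M (\<lambda>x. F n x - F (r k) x)))"
        by (simp add: ennreal_nsq sqint_diff F)
      also have "\<dots> \<le> limsup (\<lambda>k. ennreal (nsq M (\<lambda>x. F n x - F (r k) x)))"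
        by (intro Liminf_le_Limsup) auto
      also have "\<dots> \<le> ennreal e"
      proof (rule Limsup_bounded, rule eventually_sequentiallyI[of n0])
        fix k assume "n0 \<le> k"
        then have "n0 \<le> r k" using rk[of k] by linarith
        then show "ennreal (nsq M (\<lambda>x. F n x - F (r k) x)) \<le> ennreal e"
          using n0[OF n, of "r k"] by (intro ennreal_leI) simp
      qed
      finally show ?thesis .
    qed
    then show ?thesis by blast
  qed
  have sqd: "sqint M (\<lambda>x. F n x - f x)" if "(\<integral>\<^sup>+x. ennreal ((norm (F n x - f x))\<^sup>2) \<partial>M) \<le> ennreal e"
      "e > 0" for n e
    using that by (intro sqintI_nn(1)) auto
  have f: "sqint M f"
  proof -
    obtain n where "(\<integral>\<^sup>+x. ennreal ((norm (F n x - f x))\<^sup>2) \<partial>M) \<le> ennreal 1"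
      using main[of 1] by auto
    from sqint_diff[OF F[of n] sqd[OF this]] show ?thesis by simp
  qed
  have "(\<lambda>n. nsq M (\<lambda>x. F n x - f x)) \<longlonglongrightarrow> 0"
  proof (rule LIMSEQ_I)
    fix e :: real assume "e > 0"
    then obtain n0 where "\<And>n. n \<ge> n0 \<Longrightarrow> (\<integral>\<^sup>+x. ennreal ((norm (F n x - f x))\<^sup>2) \<partial>M) \<le> ennreal (e/2)"
      using main[of "e/2"] by auto
    then have "nsq M (\<lambda>x. F n x - f x) \<le> e/2" if "n \<ge> n0" for n
      using that \<open>e > 0\<close> by (intro sqintI_nn(2)) auto
    then have "norm (nsq M (\<lambda>x. F n x - f x) - 0) < e" if "n \<ge> n0" for n
      using that \<open>e > 0\<close> nsq_nonneg[of M "\<lambda>x. F n x - f x"] by fastforce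
    then show "\<exists>n0. \<forall>n\<ge>n0. norm (nsq M (\<lambda>x. F n x - f x) - 0) < e" by blast
  qed
  with f that show ?thesis by blast
qed

text \<open>The convex hull of a tail of the sequence, generated by binary combinations so that
  every convex bound on the \<open>F k\<close> passes to it by induction.\<close>

inductive_set tail_hull :: "(nat \<Rightarrow> 'm \<Rightarrow> 'b::real_vector) \<Rightarrow> nat \<Rightarrow> ('m \<Rightarrow> 'b) set"
  for F :: "nat \<Rightarrow> 'm \<Rightarrow> 'b" and m :: nat where
  base: "k \<ge> m \<Longrightarrow> F k \<in> tail_hull F m"
| step: "f \<in> tail_hull F m \<Longrightarrow> g \<in> tail_hull F m \<Longrightarrow> 0 \<le> t \<Longrightarrow> t \<le> 1 \<Longrightarrow>
          (\<lambda>x. (1 - t) *\<^sub>R f x + t *\<^sub>R g x) \<in> tail_hull F m"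

lemma tail_hull_antimono: "f \<in> tail_hull F n \<Longrightarrow> m \<le> n \<Longrightarrow> f \<in> tail_hull F m"
  by (induction rule: tail_hull.induct) (auto intro: tail_hull.intros)

lemma tail_hull_sqint: "f \<in> tail_hull F m \<Longrightarrow> (\<And>n. sqint M (F n)) \<Longrightarrow> sqint M f"
  by (induction rule: tail_hull.induct) (auto intro!: sqint_add sqint_scaleR)

text \<open>Pairings that converge along \<open>F\<close> have the same limit along any choice of
  hull elements of later and later tails. This identifies the strong limit of such elements as a
  weak limit of \<open>F\<close>.\<close>

lemma tail_hull_ip_near:
  assumes "f \<in> tail_hull F m" "\<And>n. sqint M (F n)" "sqint M W"
    and "\<And>k. k \<ge> m \<Longrightarrow> \<bar>ip M (F k) W - L\<bar> \<le> e"
  shows "\<bar>ip M f W - L\<bar> \<le> e"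
  using assms(1)
proof (induction rule: tail_hull.induct)
  case (base k) then show ?case using assms by auto
next
  case (step f g t)
  have "sqint M f" "sqint M g" using step assms tail_hull_sqint by blast+
  then have "ip M (\<lambda>x. (1 - t) *\<^sub>R f x + t *\<^sub>R g x) W - L = (1 - t) * (ip M f W - L) + t * (ip M g W
      - L)"
    by (simp add: ip_add[OF sqint_scaleR sqint_scaleR] ip_scaleR assms left_diff_distrib
        right_diff_distrib)
  also have "\<bar>\<dots>\<bar> \<le> (1 - t) * \<bar>ip M f W - L\<bar> + t * \<bar>ip M g W - L\<bar>"
    using step by (intro order_trans[OF abs_triangle_ineq]) (simp add: abs_mult)
  also have "\<dots> \<le> (1 - t) * e + t * e"
    using step by (intro add_mono mult_left_mono) auto
  finally show ?case by (simp add: algebra_simps)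
qed

text \<open>Weak sequential compactness without a dual space: the limit is the strong limit of almost
  norm-minimal elements in the convex hulls of the tails.\<close>

theorem weak_limit:
  fixes F :: "nat \<Rightarrow> 'm \<Rightarrow> 'b::euclidean_space"
  assumes F: "\<And>n. sqint M (F n)" and B: "\<And>n. nsq M (F n) \<le> B"
  obtains G where "sqint M G" "nsq M G \<le> B"
    "\<And>W L. sqint M W \<Longrightarrow> (\<lambda>n. ip M (F n) W) \<longlonglongrightarrow> L \<Longrightarrow> ip M G W = L"
    "\<And>e. e > 0 \<Longrightarrow> \<forall>\<^sub>F n in sequentially. ip M (F n) G \<ge> nsq M G - e"
proof -
  define d where "d m = (INF f\<in>tail_hull F m. nsq M f)" for m
  have bdd: "bdd_below (nsq M ` tail_hull F m)" for m
    by (intro bdd_belowI[of _ 0]) (auto simp: nsq_nonneg)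
  have ne: "tail_hull F m \<noteq> {}" for m by (auto intro: tail_hull.base[of m m])
  have d_le: "d m \<le> nsq M f" if "f \<in> tail_hull F m" for m f
    unfolding d_def using bdd that by (rule cINF_lower)
  have B0: "0 \<le> B" using B[of 0] nsq_nonneg[of M "F 0"] by linarith
  have dB: "d m \<le> B" for m using d_le[OF tail_hull.base[of m m]] B[of m] by auto
  have "incseq d"
    unfolding incseq_def d_def using ne bdd
    by (intro allI impI cINF_superset_mono) (auto intro: tail_hull_antimono)
  then obtain D where D: "d \<longlonglongrightarrow> D"
    using incseq_convergent[of d B] dB by metis
  have dD: "d m \<le> D" for m using incseq_le[OF \<open>incseq d\<close> D] .
  have "\<exists>f\<in>tail_hull F m. nsq M f < d m + 1 / (real m + 1)" for m
  proof -
    have "d m < d m + 1 / (real m + 1)" by simp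
    then show ?thesis unfolding d_def by (subst (asm) (1) cINF_less_iff[OF ne bdd]) auto
  qed
  then obtain g where g: "\<And>m. g m \<in> tail_hull F m" "\<And>m. nsq M (g m) < d m + 1 / (real m + 1)"
    by metis
  have gs: "sqint M (g m)" for m using tail_hull_sqint[OF g(1) F] .
  have to0: "(\<lambda>n. 1 / (real n + 1)) \<longlonglongrightarrow> 0"
    using LIMSEQ_inverse_real_of_nat by (simp add: inverse_eq_divide add.commute)
  \<comment> \<open>Parallelogram law: the midpoint of \<open>g m\<close> and \<open>g n\<close>
    lies in the hull of the tail \<open>k\<close>, so its square norm is at least
    \<open>d k\<close>, while both ends are nearly minimal. Hence \<open>g\<close> is
    Cauchy.\<close>
  have par: "nsq M (\<lambda>x. g m x - g n x) \<le> 2 * (D - d k) + 2 * (D - d k) + 4 / (real k + 1)"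
    if "k \<le> m" "k \<le> n" for k m n
  proof -
    have "(\<lambda>x. (1 - 1/2) *\<^sub>R g m x + (1/2) *\<^sub>R g n x) \<in> tail_hull F k"
      by (intro tail_hull.step tail_hull_antimono[OF g(1)] that) simp_all
    then have "d k \<le> nsq M (\<lambda>x. (1/2) *\<^sub>R (g m x + g n x))" using d_le
      by (fastforce simp: scaleR_add_right)
    then have 1: "4 * d k \<le> nsq M (\<lambda>x. g m x + g n x)"
      by (simp only: nsq_scaleR) (simp add: power2_eq_square)
    have 2: "nsq M (g m) \<le> D + 1 / (real k + 1)" "nsq M (g n) \<le> D + 1 / (real k + 1)"
      using g(2)[of m] g(2)[of n] dD[of m] dD[of n] that
        frac_le[of 1 1 "real k + 1" "real m + 1"] frac_le[of 1 1 "real k + 1" "real n + 1"] by auto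
    have 3: "4 / (real k + 1) = 4 * (1 / (real k + 1))" by simp
    show ?thesis using 1 2 nsq_add[OF gs gs, of m n] nsq_diff[OF gs gs, of m n]
      unfolding 3 by (simp only: right_diff_distrib)
  qed
  have par0: "(\<lambda>k. 2 * (D - d k) + 2 * (D - d k) + 4 * (1 / (real k + 1))) \<longlonglongrightarrow> 2 * (D - D) + 2 * (D
      - D) + 4 * 0"
    by (intro tendsto_intros D to0)
  obtain G where G: "sqint M G" "(\<lambda>n. nsq M (\<lambda>x. g n x - G x)) \<longlonglongrightarrow> 0"
  proof (rule L2_complete[OF gs])
    fix e :: real assume "e > 0"
    with order_tendstoD(2)[OF par0, of e] have "\<forall>\<^sub>F k in sequentially. 2 * (D - d k) + 2 * (D - d k)
        + 4 * (1 / (real k + 1)) < e" by simp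
    then obtain k where "2 * (D - d k) + 2 * (D - d k) + 4 * (1 / (real k + 1)) < e"
      by (auto simp: eventually_sequentially)
    then show "\<exists>N. \<forall>m\<ge>N. \<forall>n\<ge>N. nsq M (\<lambda>x. g m x - g n x) < e"
      using par by (intro exI[of _ k]) (force intro: le_less_trans)
  qed
  have gn: "(\<lambda>n. nsq M (g n)) \<longlonglongrightarrow> nsq M G" by (rule tendsto_nsq[OF gs G])
  have "nsq M G \<le> B"
  proof (rule LIMSEQ_le[OF gn])
    show "(\<lambda>n. B + 1 / (real n + 1)) \<longlonglongrightarrow> B" using tendsto_add[OF tendsto_const to0] by simp
    show "\<exists>N. \<forall>n\<ge>N. nsq M (g n) \<le> B + 1 / (real n + 1)"
      using g(2) dB by (meson add_right_mono less_imp_le order_trans)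
  qed
  moreover have "ip M G W = L" if W: "sqint M W" and L: "(\<lambda>n. ip M (F n) W) \<longlonglongrightarrow> L" for W L
  proof -
    have "(\<lambda>n. ip M (g n) W) \<longlonglongrightarrow> L"
    proof (rule LIMSEQ_I)
      fix e :: real assume "e > 0"
      then obtain N where N: "\<And>k. k \<ge> N \<Longrightarrow> norm (ip M (F k) W - L) < e / 2"
        using LIMSEQ_D[OF L, of "e/2"] by auto
      have "\<bar>ip M (g n) W - L\<bar> \<le> e / 2" if "n \<ge> N" for n
      proof (rule tail_hull_ip_near[OF g(1) F W])
        fix k assume "n \<le> k"
        then show "\<bar>ip M (F k) W - L\<bar> \<le> e / 2" using N[of k] that by auto
      qed
      then show "\<exists>N. \<forall>n\<ge>N. norm (ip M (g n) W - L) < e"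
        using \<open>e > 0\<close> by (intro exI[of _ N]) fastforce
    qed
    moreover have "(\<lambda>n. ip M (g n) W) \<longlonglongrightarrow> ip M G W" by (rule tendsto_ip[OF gs G(1) W G(2)])
    ultimately show ?thesis using LIMSEQ_unique by blast
  qed
  moreover have "\<forall>\<^sub>F n in sequentially. ip M (F n) G \<ge> nsq M G - e" if "e > 0" for e
  proof -
    text \<open>The variational inequality of the almost minimal element \<open>g m\<close>.\<close>
    have var: "ip M (F n) (g m) \<ge> nsq M (g m) - (1 / (real m + 1)) / (2 * t) - 3 * B * t - t"
      if "n \<ge> m" "0 < t" "t \<le> 1" for n m t
    proof -
      have "(\<lambda>x. (1 - t) *\<^sub>R g m x + t *\<^sub>R F n x) \<in> tail_hull F m"
        using that by (intro tail_hull.intros g) auto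
      then have "d m \<le> nsq M (\<lambda>x. (1 - t) *\<^sub>R g m x + t *\<^sub>R F n x)" by (rule d_le)
      also have "\<dots> = (1 - t)\<^sup>2 * nsq M (g m) + 2 * (1 - t) * t * ip M (g m) (F n) + t\<^sup>2 * nsq M (F
          n)"
        using nsq_add[OF sqint_scaleR[OF gs] sqint_scaleR[OF F], of "1-t" m t n]
          ip_scaleR[of M "1-t" "g m" "\<lambda>x. t *\<^sub>R F n x"] ip_scaleR[of M t "F n" "g m"]
        by (simp add: nsq_scaleR ip_commute)
      also have "\<dots> = nsq M (g m) + 2 * t * (ip M (g m) (F n) - nsq M (g m))
          + t\<^sup>2 * (nsq M (g m) - 2 * ip M (g m) (F n) + nsq M (F n))"
        by (simp add: algebra_simps power2_eq_square)
      also have "\<dots> \<le> nsq M (g m) + 2 * t * (ip M (g m) (F n) - nsq M (g m)) + t\<^sup>2 * (4 * B + 2)"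
      proof -
        have "1 / (real m + 1) \<le> 1" by simp
        then have "nsq M (g m) \<le> B + 1" using g(2)[of m] dB[of m] by linarith
        then have "nsq M (\<lambda>x. g m x - F n x) \<le> 4 * B + 2"
          using nsq_diff_le[OF gs F, of m n] B[of n] by linarith
        then show ?thesis using nsq_diff[OF gs F, of m n]
          by (intro add_left_mono mult_left_mono) auto
      qed
      finally have "0 \<le> 1 / (real m + 1) + 2 * t * (ip M (g m) (F n) - nsq M (g m)) + t\<^sup>2 * (4 * B
          + 2)"
        using g(2)[of m] by linarith
      then have "0 \<le> (1 / (real m + 1) + 2 * t * (ip M (g m) (F n) - nsq M (g m)) + t\<^sup>2 * (4 * B
          + 2)) / (2 * t)"
        using that by auto
      also have "\<dots> = (1 / (real m + 1)) / (2 * t) + (ip M (g m) (F n) - nsq M (g m)) + t * (2 * B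
          + 1)"
        using that by (simp add: add_divide_distrib power2_eq_square)
      finally have *: "0 \<le> (1 / (real m + 1)) / (2 * t) + (ip M (g m) (F n) - nsq M (g m))
          + t * (2 * B + 1)" .
      have "t * (2 * B + 1) \<le> 3 * B * t + t" using mult_nonneg_nonneg[of B t] B0 that
        by (simp add: algebra_simps)
      then show ?thesis using * by (simp only: ip_commute[of M "F n" "g m"])
    qed
    \<comment> \<open>For this \<open>t\<close> the errors linear in \<open>t\<close> cost at most
      \<open>e / 8\<close>. With \<open>t\<close> fixed, the quotient by \<open>2 * t\<close> and
      the distance from \<open>g m\<close> to \<open>G\<close> vanish as \<open>m\<close> grows; one
      such \<open>m\<close> then serves all \<open>n \<ge> m\<close>.\<close>
    define t where "t = min 1 (e / (8 * (3 * B + 1)))"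
    have t: "0 < t" "t \<le> 1" using that B0 by (auto simp: t_def)
    have "(3 * B + 1) * t \<le> (3 * B + 1) * (e / (8 * (3 * B + 1)))"
      using B0 by (intro mult_left_mono) (auto simp: t_def)
    also have "\<dots> = e / 8" using B0 by (simp add: field_simps)
    finally have t3: "(3 * B + 1) * t \<le> e / 8" .
    have lim: "(\<lambda>m. nsq M (g m) - (1 / (real m + 1)) / (2 * t) - 3 * B * t - t
         - sqrt B * sqrt (nsq M (\<lambda>x. g m x - G x)))
       \<longlonglongrightarrow> nsq M G - 0 / (2 * t) - 3 * B * t - t - sqrt B * sqrt 0"
      by (intro tendsto_intros gn to0 G(2)) (use t in auto)
    have "nsq M G - e < nsq M G - 0 / (2 * t) - 3 * B * t - t - sqrt B * sqrt 0"
      using t t3 that by (simp add: algebra_simps)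
    from order_tendstoD(1)[OF lim this] obtain m where
      m: "nsq M G - e < nsq M (g m) - (1 / (real m + 1)) / (2 * t) - 3 * B * t - t
         - sqrt B * sqrt (nsq M (\<lambda>x. g m x - G x))" by (auto simp: eventually_sequentially)
    have "ip M (F n) G \<ge> nsq M G - e" if "n \<ge> m" for n
    proof -
      have "\<bar>ip M (\<lambda>x. g m x - G x) (F n)\<bar> \<le> sqrt (nsq M (\<lambda>x. g m x - G x)) * sqrt (nsq M (F n))"
        by (intro abs_ip_le sqint_diff gs G F)
      also have "\<dots> \<le> sqrt (nsq M (\<lambda>x. g m x - G x)) * sqrt B"
        by (intro mult_left_mono) (auto simp: B nsq_nonneg)
      finally show ?thesis using var[OF that t(1,2)] m ip_diff[OF gs G(1) F, of m n]
        by (simp add: ip_commute mult.commute)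
    qed
    then show ?thesis by (auto simp: eventually_sequentially)
  qed
  ultimately show ?thesis using that G by blast
qed

section \<open>Test functions\<close>

lemma bounded_of_compact_support:
  fixes f :: "'a::euclidean_space \<Rightarrow> 'b::real_normed_vector"
  assumes "continuous_on UNIV f" "compact K" "\<And>x. x \<notin> K \<Longrightarrow> f x = 0"
  obtains B where "B \<ge> 0" "\<And>x. norm (f x) \<le> B"
proof -
  have "bounded (f ` K)"
    using assms by (intro compact_imp_bounded compact_continuous_image) (auto intro:
        continuous_on_subset)
  then obtain B where B: "\<And>x. x \<in> K \<Longrightarrow> norm (f x) \<le> B" by (auto simp: bounded_iff)
  have "norm (f x) \<le> max B 0" for x using B[of x] assms(3)[of x] by (cases "x \<in> K") auto
  then show ?thesis using that[of "max B 0"] by auto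
qed

lemma integrable_of_compact_support:
  fixes f :: "'a::euclidean_space \<Rightarrow> 'b::euclidean_space"
  assumes "continuous_on UNIV f" "compact K" "\<And>x. x \<notin> K \<Longrightarrow> f x = 0"
  shows "integrable lborel f"
proof -
  have "integrable lborel (\<lambda>x. indicator K x *\<^sub>R f x)"
    using assms by (intro borel_integrable_compact) (auto intro: continuous_on_subset)
  moreover have "(\<lambda>x. indicator K x *\<^sub>R f x) = f"
    using assms(3) by (auto simp: fun_eq_iff split: split_indicator)
  ultimately show ?thesis by simp
qed

lemma sqint_of_compact_support:
  fixes f :: "'a::euclidean_space \<Rightarrow> 'b::euclidean_space"
  assumes "continuous_on UNIV f" "compact K" "\<And>x. x \<notin> K \<Longrightarrow> f x = 0"
  shows "sqint lborel f"
  unfolding sqint_def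
proof
  show "f \<in> borel_measurable lborel" using assms(1) by (simp add: borel_measurable_continuous_onI)
  show "integrable lborel (\<lambda>x. (norm (f x))\<^sup>2)"
    using assms by (intro integrable_of_compact_support[where K=K] continuous_intros) auto
qed

context
  fixes \<phi> :: "'a::euclidean_space \<Rightarrow> real" and D
  assumes tf: "test_fun \<phi> D"
begin

lemma test_fun_linear: "linear (D x)"
  using tf by (auto simp: test_fun_def intro: has_derivative_linear)

lemma test_fun_deriv_sum: "D x e = (\<Sum>i\<in>Basis. (e \<bullet> i) * D x i)"
proof -
  have "D x e = D x (\<Sum>i\<in>Basis. (e \<bullet> i) *\<^sub>R i)" by (simp add: euclidean_representation)
  also have "\<dots> = (\<Sum>i\<in>Basis. (e \<bullet> i) * D x i)"
    by (simp add: linear_sum[OF test_fun_linear] linear_scale[OF test_fun_linear])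
  finally show ?thesis .
qed

lemma test_fun_continuous: "continuous_on UNIV \<phi>"
  using tf by (auto simp: test_fun_def intro!: has_derivative_continuous_on)

lemma test_fun_deriv_continuous: "continuous_on UNIV (\<lambda>x. D x e)"
  unfolding test_fun_deriv_sum[of _ e] using tf
    by (auto simp: test_fun_def intro!: continuous_intros)

lemma test_fun_support:
  "compact (closure {x. \<phi> x \<noteq> 0})" "x \<notin> closure {x. \<phi> x \<noteq> 0} \<Longrightarrow> \<phi> x = 0"
  using tf closure_subset[of "{x. \<phi> x \<noteq> 0}"] by (auto simp: test_fun_def)

lemma test_fun_deriv_support:
  assumes "x \<notin> closure {x. \<phi> x \<noteq> 0}" shows "D x e = 0"
proof -
  have "((\<lambda>_. 0) has_derivative D x) (at x)"
  proof (rule has_derivative_transform_within_open)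
    show "(\<phi> has_derivative D x) (at x)" using tf by (simp add: test_fun_def)
    show "open (- closure {x. \<phi> x \<noteq> 0})" by (intro open_Compl closed_closure)
    show "x \<in> - closure {x. \<phi> x \<noteq> 0}" using assms by (simp only: Compl_iff not_False_eq_True)
    show "\<phi> x = 0" if "x \<in> - closure {x. \<phi> x \<noteq> 0}" for x
      using test_fun_support(2) that by (simp only: Compl_iff)
  qed
  then have "D x = (\<lambda>_. 0)" using has_derivative_unique has_derivative_const by blast
  then show ?thesis by simp
qed

lemma test_fun_sqint: "sqint lborel \<phi>"
  using sqint_of_compact_support[OF test_fun_continuous test_fun_support(1)] test_fun_support(2)
    by blast

lemma test_fun_deriv_sqint: "sqint lborel (\<lambda>x. D x e)"
  using sqint_of_compact_support[OF test_fun_deriv_continuous test_fun_support(1)]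
      test_fun_deriv_support by blast

lemma test_fun_shift: "test_fun (\<lambda>x. \<phi> (x + z)) (\<lambda>x. D (x + z))"
  unfolding test_fun_def
proof (intro conjI allI ballI)
  fix x
  have "(\<phi> has_derivative D (x + z)) (at (x + z))" using tf by (simp add: test_fun_def)
  then have "((\<phi> \<circ> (\<lambda>x. x + z)) has_derivative (D (x + z) \<circ> (\<lambda>x. x))) (at x)"
    by (intro diff_chain_at) (auto intro!: derivative_eq_intros)
  then show "((\<lambda>x. \<phi> (x + z)) has_derivative D (x + z)) (at x)" by (simp add: o_def)
next
  fix i :: 'a
  show "continuous_on UNIV (\<lambda>x. D (x + z) i)"
    by (rule continuous_on_compose2[OF test_fun_deriv_continuous]) (auto intro!: continuous_intros)
next
  have "bounded (closure {x. \<phi> x \<noteq> 0})" using test_fun_support(1) compact_imp_bounded by blast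
  then have "bounded {x. \<phi> x \<noteq> 0}" using bounded_subset closure_subset by blast
  then have "bounded ((\<lambda>x. x - z) ` {x. \<phi> x \<noteq> 0})"
    using bounded_translation_minus by blast
  then have "bounded {x. \<phi> (x + z) \<noteq> 0}"
    by (rule bounded_subset) (auto intro!: image_eqI[of _ _ "_ + z"])
  then show "compact (closure {x. \<phi> (x + z) \<noteq> 0})" by (simp add: compact_closure)
qed

lemma test_fun_line_deriv: "((\<lambda>s. \<phi> (x + s *\<^sub>R y)) has_real_derivative D (x + s *\<^sub>R y) y) (at s)"
proof -
  have "(\<phi> has_derivative D (x + s *\<^sub>R y)) (at (x + s *\<^sub>R y))" using tf by (simp add: test_fun_def)
  then have "((\<phi> \<circ> (\<lambda>s. x + s *\<^sub>R y)) has_derivative (D (x + s *\<^sub>R y) \<circ> (\<lambda>t. t *\<^sub>R y))) (at s)"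
    by (intro diff_chain_at) (auto intro!: derivative_eq_intros)
  then show ?thesis
    unfolding has_field_derivative_def o_def linear_scale[OF test_fun_linear] real_scaleR_def
    by (simp only: mult_commute_abs)
qed

end

section \<open>Smooth approximation of box indicators and the fundamental lemma\<close>

lemma pos_part_sq_deriv: "((\<lambda>s. (max 0 s)\<^sup>2) has_real_derivative 2 * max 0 s) (at (s::real))"
proof -
  consider "s > 0" | "s < 0" | "s = 0" by linarith
  then show ?thesis
  proof cases
    case 1
    have "((\<lambda>s. s\<^sup>2) has_real_derivative 2 * s) (at s)" by (auto intro!: derivative_eq_intros)
    then have "((\<lambda>s. (max 0 s)\<^sup>2) has_real_derivative 2 * s) (at s)"
      by (rule has_field_derivative_transform_within_open[where S="{0<..}"]) (use 1 in auto)
    then show ?thesis using 1 by simp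
  next
    case 2
    have "((\<lambda>s. 0) has_real_derivative 0) (at s)" by simp
    then have "((\<lambda>s. (max 0 s)\<^sup>2) has_real_derivative 0) (at s)"
      by (rule has_field_derivative_transform_within_open[where S="{..<0}"]) (use 2 in auto)
    then show ?thesis using 2 by simp
  next
    case 3
    have "(\<lambda>h. (max 0 h)\<^sup>2 / h) \<midarrow>0\<rightarrow> (0::real)"
    proof (rule Lim_null_comparison)
      show "\<forall>\<^sub>F h in at 0. norm ((max 0 h)\<^sup>2 / h) \<le> \<bar>h\<bar>" for h :: real
        by (intro always_eventually) (auto simp: max_def power2_eq_square)
      show "(\<lambda>h. \<bar>h\<bar>) \<midarrow>0\<rightarrow> (0::real)" by (auto intro!: tendsto_eq_intros)
    qed
    then show ?thesis using 3 by (simp add: DERIV_def)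
  qed
qed

text \<open>A product over the coordinates of squared positive parts of parabolas vanishing at the
  two opposite faces. Squaring removes the kink of the positive part, so the product is of class
  C^1.\<close>

lemma box_bump:
  fixes l u :: "'a::euclidean_space"
  assumes lu: "\<And>i. i \<in> Basis \<Longrightarrow> l \<bullet> i \<le> u \<bullet> i"
  obtains \<eta> D where "\<And>x. (\<eta> has_derivative D x) (at x)" "\<And>e. continuous_on UNIV (\<lambda>x. D x e)"
    "\<And>x. \<eta> x \<ge> (0::real)" "\<And>x. \<eta> x > 0 \<longleftrightarrow> x \<in> box l u"
proof -
  define q where "q i x = (x \<bullet> i - l \<bullet> i) * (u \<bullet> i - x \<bullet> i)" for i x :: 'a
  define \<eta> where "\<eta> x = (\<Prod>i\<in>Basis. (max 0 (q i x))\<^sup>2)" for x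
  define D where "D x y = (\<Sum>i\<in>Basis. (2 * max 0 (q i x) * ((y \<bullet> i) * (u \<bullet> i - x \<bullet> i) - (x \<bullet> i
      - l \<bullet> i) * (y \<bullet> i)))
      * (\<Prod>j\<in>Basis - {i}. (max 0 (q j x))\<^sup>2))" for x y
  have q: "(q i has_derivative (\<lambda>y. (y \<bullet> i) * (u \<bullet> i - x \<bullet> i) - (x \<bullet> i - l \<bullet> i) * (y \<bullet> i))) (at x)"
      for i x
    unfolding q_def by (auto intro!: derivative_eq_intros)
  have "((\<lambda>x. (max 0 (q i x))\<^sup>2) has_derivative
     (\<lambda>y. 2 * max 0 (q i x) * ((y \<bullet> i) * (u \<bullet> i - x \<bullet> i) - (x \<bullet> i - l \<bullet> i) * (y \<bullet> i)))) (at x)" for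
         i x
    using diff_chain_at[OF q[of i x] pos_part_sq_deriv[of
        "q i x", unfolded has_field_derivative_def]]
    by (simp add: o_def)
  then have "(\<eta> has_derivative D x) (at x)" for x
    unfolding \<eta>_def D_def by (intro has_derivative_prod)
  moreover have "continuous_on UNIV (\<lambda>x. D x e)" for e
    unfolding D_def q_def by (intro continuous_intros)
  moreover have "\<eta> x \<ge> 0" for x unfolding \<eta>_def by (intro prod_nonneg) auto
  moreover have "\<eta> x > 0 \<longleftrightarrow> x \<in> box l u" for x
  proof -
    have "\<eta> x > 0 \<longleftrightarrow> (\<forall>i\<in>Basis. q i x > 0)"
    proof
      assume "\<eta> x > 0"
      then have "\<forall>i\<in>Basis. (max 0 (q i x))\<^sup>2 \<noteq> 0" unfolding \<eta>_def
        by (metis finite_Basis less_irrefl prod_zero_iff)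
      then show "\<forall>i\<in>Basis. q i x > 0" by (force simp: max_def split: if_splits)
    qed (auto simp: \<eta>_def intro!: prod_pos)
    also have "\<dots> \<longleftrightarrow> x \<in> box l u"
    proof -
      \<comment> \<open>\<open>lu\<close> excludes that both factors are negative, which would force
        \<open>u \<bullet> i < l \<bullet> i\<close>.\<close>
      have "q i x > 0 \<longleftrightarrow> l \<bullet> i < x \<bullet> i \<and> x \<bullet> i < u \<bullet> i" if "i \<in> Basis" for i
        using lu[OF that] by (auto simp: q_def zero_less_mult_iff)
      then show ?thesis by (auto simp: box_def)
    qed
    finally show ?thesis .
  qed
  ultimately show ?thesis using that by blast
qed

text \<open>The maps \<open>s \<mapsto> k s / (1 + k s)\<close> fix 0, stay below 1 for nonnegative
  \<open>s\<close> and tend to 1 for positive \<open>s\<close>. Composed with the bump they give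
  test functions whose supports stay in the closed box.\<close>

lemma box_indicator_approx:
  fixes l u :: "'a::euclidean_space"
  assumes lu: "\<And>i. i \<in> Basis \<Longrightarrow> l \<bullet> i \<le> u \<bullet> i"
  obtains \<psi> D where "\<And>k. test_fun (\<psi> k) (D k)" "\<And>k x. \<bar>\<psi> k x\<bar> \<le> indicator (box l u) x"
    "\<And>x. (\<lambda>k::nat. \<psi> k x) \<longlonglongrightarrow> indicator (box l u) x"
proof -
  obtain \<eta> D where \<eta>: "\<And>x. (\<eta> has_derivative D x) (at x)" "\<And>e. continuous_on UNIV (\<lambda>x. D x e)"
    "\<And>x. \<eta> x \<ge> (0::real)" "\<And>x. \<eta> x > 0 \<longleftrightarrow> x \<in> box l u"
    using box_bump[OF lu] by metis
  have pos: "1 + real k * \<eta> x > 0" for k x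
    using mult_nonneg_nonneg[OF of_nat_0_le_iff[of k] \<eta>(3)[of x]] by linarith
  have cont: "continuous_on UNIV \<eta>"
    using \<eta>(1) by (auto intro!: has_derivative_continuous_on)
  have zero: "\<eta> x = 0" if "x \<notin> box l u" for x using that \<eta>(3,4)[of x] by auto
  define \<psi> where "\<psi> k x = real k * \<eta> x / (1 + real k * \<eta> x)" for k x
  have 1: "test_fun (\<psi> k) (\<lambda>x e. real k / (1 + real k * \<eta> x)\<^sup>2 * D x e)" for k
    unfolding test_fun_def
  proof (intro conjI allI ballI)
    fix x
    have "((\<lambda>s. real k * s / (1 + real k * s)) has_real_derivative real k / (1 + real k * \<eta> x)\<^sup>2)
        (at (\<eta> x))"
      using pos[of k x] by (auto intro!: derivative_eq_intros simp: power2_eq_square field_simps)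
    from diff_chain_at[OF \<eta>(1)[of x] this[unfolded has_field_derivative_def]]
    show "(\<psi> k has_derivative (\<lambda>e. real k / (1 + real k * \<eta> x)\<^sup>2 * D x e)) (at x)"
      unfolding \<psi>_def by (simp add: o_def)
  next
    fix i
    show "continuous_on UNIV (\<lambda>x. real k / (1 + real k * \<eta> x)\<^sup>2 * D x i)"
      using pos[of k] by (intro continuous_intros cont \<eta>) (auto simp: less_le)
  next
    have "{x. \<psi> k x \<noteq> 0} \<subseteq> box l u" using zero by (auto simp: \<psi>_def)
    then have "bounded {x. \<psi> k x \<noteq> 0}" using bounded_box bounded_subset by blast
    then show "compact (closure {x. \<psi> k x \<noteq> 0})" by (simp add: compact_closure)
  qed
  have 2: "\<bar>\<psi> k x\<bar> \<le> indicator (box l u) x" for k x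
    using pos[of k x] \<eta>(3)[of x] zero[of x] by (auto simp: \<psi>_def abs_mult split: split_indicator)
  have 3: "(\<lambda>k. \<psi> k x) \<longlonglongrightarrow> indicator (box l u) x" for x
  proof (cases "x \<in> box l u")
    case True
    then have p: "\<eta> x > 0" using \<eta>(4) by simp
    have "(\<lambda>k. 1 - 1 / (1 + real k * \<eta> x)) \<longlonglongrightarrow> 1 - 0"
      by (intro tendsto_intros tendsto_divide_0[OF tendsto_const] filterlim_at_top_imp_at_infinity
           filterlim_tendsto_add_at_top[OF tendsto_const] filterlim_at_top_mult_tendsto_pos[OF
               tendsto_const p]
           filterlim_real_sequentially)
    moreover have "1 - 1 / (1 + real k * \<eta> x) = \<psi> k x" for k
      using pos[of k x] by (simp add: \<psi>_def field_simps)
    ultimately show ?thesis using True by simp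
  qed (simp add: \<psi>_def zero)
  show ?thesis by (rule that[OF 1 2 3])
qed

lemma sqint_indicator:
  assumes "A \<in> sets lborel" "emeasure lborel A < \<infinity>"
  shows "sqint lborel (indicator A :: _ \<Rightarrow> real)"
proof -
  have *: "(\<lambda>x. (norm (indicator A x :: real))\<^sup>2) = indicator A"
    by (auto simp: fun_eq_iff split: split_indicator)
  show ?thesis
    using assms unfolding sqint_def * by (auto simp: less_top)
qed

text \<open>Dominated convergence extends the hypothesis from test functions to indicators of boxes.
  So the measures with densities the positive and the negative part of \<open>f\<close> agree on an
  intersection-stable generator, hence everywhere, and their densities agree almost
  everywhere.\<close>

lemma fundamental_lemma:
  fixes f :: "'a::euclidean_space \<Rightarrow> real"
  assumes f: "sqint lborel f"
    and test: "\<And>\<phi> D. test_fun \<phi> D \<Longrightarrow> (LINT x|lborel. f x * \<phi> x) = 0"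
  shows "AE x in lborel. f x = 0"
proof -
  have [measurable]: "f \<in> borel_measurable borel" using f by (simp add: sqint_def)
  have ibox: "integrable lborel (\<lambda>x. f x * indicator (box l u) x)" for l u :: 'a
    using integrable_inner[OF f sqint_indicator[OF _ emeasure_bounded_finite[OF bounded_box]], of l
        u] by simp
  have zero: "(LINT x|lborel. f x * indicator (box l u) x) = 0" for l u :: 'a
  proof (cases "\<forall>i\<in>Basis. l \<bullet> i \<le> u \<bullet> i")
    case True
    then obtain \<psi> D where \<psi>: "\<And>k. test_fun (\<psi> k) (D k)" "\<And>k x. \<bar>\<psi> k x\<bar> \<le> indicator (box l u) x"
      "\<And>x. (\<lambda>k::nat. \<psi> k x) \<longlonglongrightarrow> indicator (box l u) x" using box_indicator_approx[of l u] by metis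
    have [measurable]: "\<psi> k \<in> borel_measurable borel" for k
      using test_fun_continuous[OF \<psi>(1)] by (rule borel_measurable_continuous_onI)
    have "(\<lambda>k. LINT x|lborel. f x * \<psi> k x) \<longlonglongrightarrow> (LINT x|lborel. f x * indicator (box l u) x)"
    proof (rule integral_dominated_convergence[where w="\<lambda>x. \<bar>f x * indicator (box l u) x\<bar>"])
      show "integrable lborel (\<lambda>x. \<bar>f x * indicator (box l u) x\<bar>)" using ibox by auto
      show "AE x in lborel. (\<lambda>k. f x * \<psi> k x) \<longlonglongrightarrow> f x * indicator (box l u) x"
        by (intro AE_I2 tendsto_intros \<psi>)
      show "AE x in lborel. norm (f x * \<psi> k x) \<le> \<bar>f x * indicator (box l u) x\<bar>" for k
        using \<psi>(2) by (intro AE_I2) (auto simp: abs_mult intro!: mult_left_mono)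
    qed measurable
    then show ?thesis using test[OF \<psi>(1)] LIMSEQ_unique[OF tendsto_const] by force
  next
    case False
    then have "box l u = {}" by (force simp: box_eq_empty)
    then show ?thesis by simp
  qed
  let ?M = "density lborel (\<lambda>x. ennreal (max 0 (f x)))"
  let ?N = "density lborel (\<lambda>x. ennreal (max 0 (- f x)))"
  have em: "emeasure (density lborel (\<lambda>x. ennreal (max 0 (g x)))) (box l u)
      = ennreal (LINT x|lborel. max 0 (g x * indicator (box l u) x))"
    if [measurable]: "g \<in> borel_measurable borel"
        and "integrable lborel (\<lambda>x. g x * indicator (box l u) x)" for g and l u :: 'a
  proof -
    have "emeasure (density lborel (\<lambda>x. ennreal (max 0 (g x)))) (box l u)
       = (\<integral>\<^sup>+x. ennreal (max 0 (g x * indicator (box l u) x)) \<partial>lborel)"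
      by (subst emeasure_density) (auto intro!: nn_integral_cong split: split_indicator)
    also have "\<dots> = ennreal (LINT x|lborel. max 0 (g x * indicator (box l u) x))"
      using that by (intro nn_integral_eq_integral) auto
    finally show ?thesis .
  qed
  have "?M = ?N"
  proof (rule measure_eqI_generator_eq)
    let ?E = "range (\<lambda>(a, b). box a b::'a set)"
    let ?A = "\<lambda>n::nat. box (- (real n *\<^sub>R One)) (real n *\<^sub>R One) :: 'a set"
    show "Int_stable ?E" by (auto simp: Int_stable_def box_Int_box)
    show "?E \<subseteq> Pow UNIV" by simp
    show "sets ?M = sigma_sets UNIV ?E" "sets ?N = sigma_sets UNIV ?E"
      by (simp_all add: borel_eq_box)
    show "range ?A \<subseteq> ?E" "(\<Union>i. ?A i) = UNIV" unfolding UN_box_eq_UNIV by auto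
    show "emeasure ?M (?A i) \<noteq> \<infinity>" for i using em[of f] ibox by simp
    show "emeasure ?M X = emeasure ?N X" if "X \<in> ?E" for X
    proof -
      from that obtain p :: "'a \<times> 'a" where "X = (case p of (a, b) \<Rightarrow> box a b)" by (rule rangeE)
      then obtain l u :: 'a where X: "X = box l u" by (cases p) simp
      let ?g = "\<lambda>x. f x * indicator (box l u) x"
      have "(LINT x|lborel. max 0 (?g x)) - (LINT x|lborel. max 0 (- ?g x))
          = (LINT x|lborel. max 0 (?g x) - max 0 (- ?g x))"
        using ibox[of l u] by (intro Bochner_Integration.integral_diff[symmetric]) auto
      also have "\<dots> = (LINT x|lborel. ?g x)"
        by (intro Bochner_Integration.integral_cong) auto
      finally show ?thesis
        using em[of f l u] em[of "\<lambda>x. - f x" l u] ibox[of l u] zero[of l u] X by simp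
    qed
  qed
  then have "AE x in lborel. ennreal (max 0 (f x)) = ennreal (max 0 (- f x))"
    by (subst (asm) sigma_finite_measure.density_unique_iff[OF sigma_finite_lborel]) auto
  then show ?thesis
    by eventually_elim (auto simp: max_def split: if_splits)
qed

section \<open>Translations and weak gradients\<close>

lemma nn_integral_lborel_shift:
  fixes f :: "'a::euclidean_space \<Rightarrow> ennreal"
  assumes [measurable]: "f \<in> borel_measurable borel"
  shows "(\<integral>\<^sup>+x. f (x + z) \<partial>lborel) = (\<integral>\<^sup>+x. f x \<partial>lborel)"
proof -
  have "(\<integral>\<^sup>+x. f x \<partial>lborel) = (\<integral>\<^sup>+x. f x \<partial>distr lborel borel ((+) z))"
    by (simp add: lborel_distr_plus)
  also have "\<dots> = (\<integral>\<^sup>+x. f (x + z) \<partial>lborel)" by (subst nn_integral_distr) (auto simp: add.commute)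
  finally show ?thesis by simp
qed

lemma integral_lborel_shift:
  fixes f :: "'a::euclidean_space \<Rightarrow> 'b::{banach, second_countable_topology}"
  assumes [measurable]: "f \<in> borel_measurable borel"
  shows "(LINT x|lborel. f (x + z)) = (LINT x|lborel. f x)"
proof -
  have "(LINT x|lborel. f x) = (LINT x|distr lborel borel ((+) z). f x)"
    by (simp add: lborel_distr_plus)
  also have "\<dots> = (LINT x|lborel. f (x + z))" by (subst integral_distr) (auto simp: add.commute)
  finally show ?thesis by simp
qed

lemma integrable_lborel_shift:
  fixes f :: "'a::euclidean_space \<Rightarrow> 'b::{banach, second_countable_topology}"
  assumes "integrable lborel f"
  shows "integrable lborel (\<lambda>x. f (x + z))"
proof -
  have "integrable (distr lborel borel ((+) z)) f" using assms by (simp add: lborel_distr_plus)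
  then show ?thesis by (subst (asm) integrable_distr_eq) (use assms in \<open>auto simp: add.commute\<close>)
qed

lemma sqint_shift: "sqint lborel f \<Longrightarrow> sqint lborel (\<lambda>x. f (x + z))"
  using integrable_lborel_shift[of "\<lambda>x. (norm (f x))\<^sup>2" z] by (auto simp: sqint_def)

lemma nsq_shift: "sqint lborel f \<Longrightarrow> nsq lborel (\<lambda>x. f (x + z)) = nsq lborel f"
  unfolding nsq_def by (rule integral_lborel_shift[of "\<lambda>x. (norm (f x))\<^sup>2"]) (auto simp: sqint_def)

lemma integrable_mult_sqint:
  fixes f g :: "'m \<Rightarrow> real"
  shows "sqint M f \<Longrightarrow> sqint M g \<Longrightarrow> integrable M (\<lambda>x. f x * g x)"
  using integrable_inner[of M f g] by simp

lemma sqint_inner_const: assumes "sqint M f" shows "sqint M (\<lambda>x. f x \<bullet> c)"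
proof -
  have [measurable]: "f \<in> borel_measurable M" using assms by (simp add: sqint_def)
  have "integrable M (\<lambda>x. (norm c)\<^sup>2 * (norm (f x))\<^sup>2)" using assms by (simp add: sqint_def)
  then have "integrable M (\<lambda>x. (norm (f x \<bullet> c))\<^sup>2)"
  proof (rule Bochner_Integration.integrable_bound)
    have "(norm (f x \<bullet> c))\<^sup>2 \<le> (norm c)\<^sup>2 * (norm (f x))\<^sup>2" for x
      using power_mono[OF Cauchy_Schwarz_ineq2[of "f x" c] abs_ge_zero, of 2]
      by (simp add: power_mult_distrib mult.commute)
    then show "AE x in M. norm ((norm (f x \<bullet> c))\<^sup>2) \<le> norm ((norm c)\<^sup>2 * (norm (f x))\<^sup>2)"
      by (intro AE_I2) simp
  qed measurable
  then show ?thesis by (simp add: sqint_def)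
qed

text \<open>Cauchy-Schwarz for \<open>sqrt k\<close> and \<open>sqrt k * f\<close>. With a
  nonnegative integral on the right, measurability of \<open>f\<close> is enough: the infinite case
  is trivial.\<close>

lemma jensen_sq:
  fixes k f :: "'m \<Rightarrow> real"
  assumes k: "integrable M k" "\<And>z. k z \<ge> 0" "(LINT z|M. k z) = 1"
      and [measurable]: "f \<in> borel_measurable M"
  shows "ennreal ((LINT z|M. k z * f z)\<^sup>2) \<le> (\<integral>\<^sup>+z. ennreal (k z * (f z)\<^sup>2) \<partial>M)"
proof (cases "(\<integral>\<^sup>+z. ennreal (k z * (f z)\<^sup>2) \<partial>M) = \<infinity>")
  case False
  have [measurable]: "k \<in> borel_measurable M" using k by auto
  have i: "integrable M (\<lambda>z. k z * (f z)\<^sup>2)"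
    using False k(2) by (intro integrableI_bounded) (auto simp: less_top)
  have s: "sqint M (\<lambda>z. sqrt (k z))" "sqint M (\<lambda>z. sqrt (k z) * f z)"
    using i k by (auto simp: sqint_def power_mult_distrib abs_mult)
  have "(LINT z|M. k z * f z) = ip M (\<lambda>z. sqrt (k z)) (\<lambda>z. sqrt (k z) * f z)"
    unfolding ip_def using k(2)
      by (intro Bochner_Integration.integral_cong) (auto simp: mult.assoc[symmetric])
  then have "(LINT z|M. k z * f z)\<^sup>2 \<le> nsq M (\<lambda>z. sqrt (k z)) * nsq M (\<lambda>z. sqrt (k z) * f z)"
    using ip_sq_le[OF s] by simp
  also have "\<dots> = (LINT z|M. k z * (f z)\<^sup>2)"
    using k by (simp add: nsq_def power_mult_distrib abs_mult)
  finally have "ennreal ((LINT z|M. k z * f z)\<^sup>2) \<le> ennreal (LINT z|M. k z * (f z)\<^sup>2)"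
    by (rule ennreal_leI)
  then show ?thesis using nn_integral_eq_integral[OF i] k(2) by simp
qed simp

text \<open>Supplies the integrability for exchanging a pairing in \<open>x\<close> with an average
  over translations. For each \<open>s\<close> the product is bounded by a sum of squares, whose
  integral does not depend on the translation.\<close>

lemma integrable_shift_pair:
  fixes k :: "'z::euclidean_space \<Rightarrow> real" and A B :: "'a::euclidean_space \<Rightarrow> real" and z :: "'z \<Rightarrow> 'a"
  assumes k: "integrable lborel k" "\<And>s. k s \<ge> 0" and A: "sqint lborel A" and B: "sqint lborel B"
    and [measurable]: "z \<in> borel_measurable borel"
  shows "integrable (lborel \<Otimes>\<^sub>M lborel) (\<lambda>(s, x). k s * (A x * B (x + z s)))"
proof (rule integrableI_bounded)
  have [measurable]: "k \<in> borel_measurable borel" "A \<in> borel_measurable borel"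
      "B \<in> borel_measurable borel"
    using assms by (auto simp: sqint_def)
  show "(\<lambda>(s, x). k s * (A x * B (x + z s))) \<in> borel_measurable (lborel \<Otimes>\<^sub>M lborel)" by measurable
  have "(\<integral>\<^sup>+p. ennreal (norm (case p of (s, x) \<Rightarrow> k s * (A x * B (x + z s)))) \<partial>(lborel \<Otimes>\<^sub>M lborel))
    = (\<integral>\<^sup>+s. \<integral>\<^sup>+x. ennreal (norm (k s * (A x * B (x + z s)))) \<partial>lborel \<partial>lborel)"
    by (subst lborel.nn_integral_fst[symmetric]) auto
  also have "\<dots> \<le> (\<integral>\<^sup>+s. ennreal (k s * (nsq lborel A + nsq lborel B)) \<partial>lborel)"
  proof (rule nn_integral_mono)
    fix s
    note Bs = sqint_shift[OF B, of "z s"]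
    have "(\<integral>\<^sup>+x. ennreal (norm (k s * (A x * B (x + z s)))) \<partial>lborel)
      \<le> (\<integral>\<^sup>+x. ennreal (k s * ((norm (A x))\<^sup>2 + (norm (B (x + z s)))\<^sup>2)) \<partial>lborel)"
      using k(2)[of s] abs_inner_le_sq[of "A _" "B _"]
      by (intro nn_integral_mono ennreal_leI) (auto simp: abs_mult intro!: mult_left_mono)
    also have "\<dots> = ennreal (LINT x|lborel. k s * ((norm (A x))\<^sup>2 + (norm (B (x + z s)))\<^sup>2))"
      using k(2)[of s] sqint_integrable[OF A] sqint_integrable[OF Bs]
        by (intro nn_integral_eq_integral) auto
    also have "(LINT x|lborel. k s * ((norm (A x))\<^sup>2 + (norm (B (x + z s)))\<^sup>2))
        = k s * (nsq lborel A + nsq lborel B)"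
      using sqint_integrable[OF A] sqint_integrable[OF Bs] nsq_shift[OF B, of "z s"]
        by (simp add: nsq_def)
    finally show "(\<integral>\<^sup>+x. ennreal (norm (k s * (A x * B (x + z s)))) \<partial>lborel)
        \<le> ennreal (k s * (nsq lborel A + nsq lborel B))" .
  qed
  also have "\<dots> = ennreal (LINT s|lborel. k s * (nsq lborel A + nsq lborel B))"
    using k by (intro nn_integral_eq_integral) (auto simp: nsq_nonneg)
  also have "\<dots> < \<infinity>" by simp
  finally show "(\<integral>\<^sup>+p. ennreal (norm (case p of (s, x) \<Rightarrow> k s * (A x * B (x + z s)))) \<partial>(lborel \<Otimes>\<^sub>M
      lborel)) < \<infinity>" .
qed

text \<open>A probability average of functions with square integral at most \<open>C\<close> again
  satisfies this bound, by Jensen and Tonelli. It serves averages along a segment and averages over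
  a ball; in the latter case the bound is available only where the kernel is nonzero.\<close>

lemma nn_integral_average_sq:
  fixes k :: "'z::euclidean_space \<Rightarrow> real" and f :: "'z \<Rightarrow> 'a::euclidean_space \<Rightarrow> real"
  assumes k: "integrable lborel k" "\<And>s. k s \<ge> 0" "(LINT s|lborel. k s) = 1"
    and [measurable]: "(\<lambda>(s, x). f s x) \<in> borel_measurable (lborel \<Otimes>\<^sub>M lborel)"
    and sq: "\<And>s. k s \<noteq> 0 \<Longrightarrow> (\<integral>\<^sup>+x. ennreal ((f s x)\<^sup>2) \<partial>lborel) \<le> ennreal C" and "C \<ge> 0"
  shows "(\<integral>\<^sup>+x. ennreal ((LINT s|lborel. k s * f s x)\<^sup>2) \<partial>lborel) \<le> ennreal C"
proof -
  have [measurable]: "k \<in> borel_measurable borel" using k by auto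
  have meas: "f s \<in> borel_measurable lborel" for s using measurable_Pair2[OF assms(4), of s] by simp
  have meas': "(\<lambda>s. f s x) \<in> borel_measurable lborel" for x
    using measurable_Pair1[OF assms(4), of x] by simp
  have "(\<integral>\<^sup>+x. ennreal ((LINT s|lborel. k s * f s x)\<^sup>2) \<partial>lborel)
      \<le> (\<integral>\<^sup>+x. \<integral>\<^sup>+s. ennreal (k s * (f s x)\<^sup>2) \<partial>lborel \<partial>lborel)"
    by (intro nn_integral_mono jensen_sq k meas')
  also have "\<dots> = (\<integral>\<^sup>+s. \<integral>\<^sup>+x. ennreal (k s * (f s x)\<^sup>2) \<partial>lborel \<partial>lborel)"
    by (rule lborel_pair.Fubini') measurable
  also have "\<dots> \<le> (\<integral>\<^sup>+s. ennreal (k s * C) \<partial>lborel)"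
  proof (rule nn_integral_mono)
    fix s
    have "(\<integral>\<^sup>+x. ennreal (k s * (f s x)\<^sup>2) \<partial>lborel) = ennreal (k s) * (\<integral>\<^sup>+x. ennreal ((f s x)\<^sup>2)
        \<partial>lborel)"
      using k(2)[of s] meas[of s] by (subst nn_integral_cmult[symmetric]) (auto simp: ennreal_mult)
    also have "\<dots> \<le> ennreal (k s * C)"
      using sq[of s] k(2)[of s] \<open>C \<ge> 0\<close>
        by (cases "k s = 0") (auto simp: ennreal_mult intro!: mult_left_mono)
    finally show "(\<integral>\<^sup>+x. ennreal (k s * (f s x)\<^sup>2) \<partial>lborel) \<le> ennreal (k s * C)" .
  qed
  also have "\<dots> = ennreal (LINT s|lborel. k s * C)"
    using k \<open>C \<ge> 0\<close> by (intro nn_integral_eq_integral) auto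
  also have "\<dots> = ennreal C" using k by simp
  finally show ?thesis .
qed

lemma is_weak_grad_direction:
  fixes u :: "'a::euclidean_space \<Rightarrow> real"
  assumes u: "sqint lborel u" and g: "sqint lborel g" and w: "is_weak_grad u g"
      and t: "test_fun \<phi> D"
  shows "(LINT x|lborel. u x * D x e) = - (LINT x|lborel. (g x \<bullet> e) * \<phi> x)"
proof -
  have "(LINT x|lborel. u x * D x e) = (LINT x|lborel. (\<Sum>i\<in>Basis. (e \<bullet> i) * (u x * D x i)))"
    by (subst test_fun_deriv_sum[OF t]) (simp add: sum_distrib_left mult_ac)
  also have "\<dots> = (\<Sum>i\<in>Basis. (e \<bullet> i) * (LINT x|lborel. u x * D x i))"
    using integrable_mult_sqint[OF u test_fun_deriv_sqint[OF t]]
    by (subst Bochner_Integration.integral_sum) auto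
  also have "\<dots> = (\<Sum>i\<in>Basis. (e \<bullet> i) * - (LINT x|lborel. (g x \<bullet> i) * \<phi> x))"
    using w t by (simp add: is_weak_grad_def)
  also have "\<dots> = - (LINT x|lborel. (\<Sum>i\<in>Basis. (e \<bullet> i) * ((g x \<bullet> i) * \<phi> x)))"
    using integrable_mult_sqint[OF sqint_inner_const[OF g] test_fun_sqint[OF t]]
    by (subst Bochner_Integration.integral_sum) (auto simp: sum_negf)
  also have "(\<lambda>x. \<Sum>i\<in>Basis. (e \<bullet> i) * ((g x \<bullet> i) * \<phi> x)) = (\<lambda>x. (g x \<bullet> e) * \<phi> x)"
    by (simp add: fun_eq_iff euclidean_inner[of "g _" e] sum_distrib_right sum_distrib_left mult_ac)
  finally show ?thesis .
qed

text \<open>Along a vector \<open>y\<close>, a function in \<open>H\<^sup>1\<close> is the integral of its weak gradient; both sides agree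
  against test functions by Fubini.\<close>
lemma weak_grad_translation:
  fixes u :: "'a::euclidean_space \<Rightarrow> real"
  assumes u: "sqint lborel u" and g: "sqint lborel g" and w: "is_weak_grad u g"
  shows "nsq lborel (\<lambda>x. u (x + y) - u x) \<le> nsq lborel (\<lambda>x. g x \<bullet> y)"
proof -
  define k where "k = (indicator {0..1} :: real \<Rightarrow> real)"
  have k: "integrable lborel k" "\<And>s. k s \<ge> 0" "(LINT s|lborel. k s) = 1" by (auto simp: k_def)
  define gy where "gy x = g x \<bullet> y" for x
  have gy: "sqint lborel gy" unfolding gy_def using g by (rule sqint_inner_const)
  have [measurable]: "u \<in> borel_measurable borel" "gy \<in> borel_measurable borel"
      "k \<in> borel_measurable borel"
    using u gy k by (auto simp: sqint_def)
  define G where "G x = (LINT s|lborel. k s * gy (x + s *\<^sub>R y))" for x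
  have Gm[measurable]: "G \<in> borel_measurable borel" unfolding G_def by measurable
  have "(\<integral>\<^sup>+x. ennreal ((G x)\<^sup>2) \<partial>lborel) \<le> ennreal (nsq lborel gy)"
    unfolding G_def
  proof (rule nn_integral_average_sq[OF k])
    show "(\<integral>\<^sup>+x. ennreal ((gy (x + s *\<^sub>R y))\<^sup>2) \<partial>lborel) \<le> ennreal (nsq lborel gy)" for s
      using ennreal_nsq[OF sqint_shift[OF gy], of "s *\<^sub>R y"] nsq_shift[OF gy] by simp
  qed (auto simp: nsq_nonneg)
  then have "(\<integral>\<^sup>+x. ennreal ((norm (G x))\<^sup>2) \<partial>lborel) \<le> ennreal (nsq lborel gy)" by simp
  from sqintI_nn[OF _ this nsq_nonneg] have G: "sqint lborel G" "nsq lborel G \<le> nsq lborel gy"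
    by simp_all
  have "AE x in lborel. (u (x + y) - u x) - G x = 0"
  proof (rule fundamental_lemma)
    show "sqint lborel (\<lambda>x. u (x + y) - u x - G x)" by (intro sqint_diff sqint_shift u G)
    fix \<phi> :: "'a \<Rightarrow> real" and D assume t: "test_fun \<phi> D"
    note \<phi> = test_fun_sqint[OF t]
    have [measurable]: "\<phi> \<in> borel_measurable borel" using \<phi> by (simp add: sqint_def)
    note Dy = test_fun_deriv_sqint[OF t, of "-y"]
    have [measurable]: "(\<lambda>x. D x (-y)) \<in> borel_measurable borel" using Dy by (simp add: sqint_def)
    have pull: "c * (LINT s|lborel. k s * F s) = (LINT s|lborel. k s * (c * F s))" for c
        and F :: "real \<Rightarrow> real"
      by (subst integral_mult_right_zero[symmetric]) (simp only: mult.left_commute)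
    have line: "\<phi> (x - y) - \<phi> x = (LINT s|lborel. k s * D (x + s *\<^sub>R (-y)) (-y))" for x
    proof -
      have "(LINT s|lborel. D (x + s *\<^sub>R (-y)) (-y) * indicator {0..1} s) = \<phi> (x + 1 *\<^sub>R (-y))
          - \<phi> (x + 0 *\<^sub>R (-y))"
      proof (rule integral_FTC_Icc_real)
        show "isCont (\<lambda>s. D (x + s *\<^sub>R (-y)) (-y)) s" for s
          using continuous_on_compose2[OF test_fun_deriv_continuous[OF t, of "-y"], of UNIV
              "\<lambda>s. x + s *\<^sub>R (-y)"]
          by (auto simp: continuous_on_eq_continuous_at intro!: continuous_intros)
        show "((\<lambda>s. \<phi> (x + s *\<^sub>R (-y))) has_real_derivative D (x + s *\<^sub>R (-y)) (-y)) (at s)" for s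
          by (rule test_fun_line_deriv[OF t])
      qed simp
      then show ?thesis by (simp add: k_def mult.commute)
    qed
    have 1: "(LINT x|lborel. (u (x + y) - u x) * \<phi> x) = (LINT x|lborel. u x * (\<phi> (x - y) - \<phi> x))"
    proof -
      have "(LINT x|lborel. u (x + y) * \<phi> (x + y - y)) = (LINT x|lborel. u x * \<phi> (x - y))"
        by (rule integral_lborel_shift[of "\<lambda>x. u x * \<phi> (x - y)" y]) measurable
      moreover have "integrable lborel (\<lambda>x. u (x + y) * \<phi> x)" "integrable lborel (\<lambda>x. u x * \<phi> x)"
          "integrable lborel (\<lambda>x. u x * \<phi> (x - y))"
        using integrable_mult_sqint[OF sqint_shift[OF u] \<phi>] integrable_mult_sqint[OF u \<phi>]
          integrable_mult_sqint[OF u sqint_shift[OF \<phi>], of "-y"] by auto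
      ultimately show ?thesis by (simp add: left_diff_distrib right_diff_distrib)
    qed
    also have "\<dots> = (LINT x|lborel. LINT s|lborel. k s * (u x * D (x + s *\<^sub>R (-y)) (-y)))"
      unfolding line pull ..
    also have "\<dots> = (LINT s|lborel. LINT x|lborel. k s * (u x * D (x + s *\<^sub>R (-y)) (-y)))"
      by (rule lborel_pair.Fubini_integral)
        (use integrable_shift_pair[OF k(1,2) u Dy, of "\<lambda>s. s *\<^sub>R (-y)"] in simp)
    \<comment> \<open>For fixed \<open>s\<close> the translate of the test function is again a test
      function, so the weak derivative in direction \<open>-y\<close> applies. The two signs cancel,
      and translating back moves the shift to \<open>gy\<close>.\<close>
    also have "\<dots> = (LINT s|lborel. LINT x|lborel. k s * (\<phi> x * gy (x + s *\<^sub>R y)))"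
    proof (rule Bochner_Integration.integral_cong[OF refl])
      fix s :: real
      have "(LINT x|lborel. u x * D (x + s *\<^sub>R (-y)) (-y)) = - (LINT x|lborel. (g x \<bullet> (-y)) * \<phi> (x
          + s *\<^sub>R (-y)))"
        by (rule is_weak_grad_direction[OF u g w test_fun_shift[OF t]])
      also have "\<dots> = (LINT x|lborel. gy x * \<phi> (x + s *\<^sub>R (-y)))" by (simp add: gy_def)
      also have "\<dots> = (LINT x|lborel. gy (x + s *\<^sub>R y) * \<phi> (x + s *\<^sub>R y + s *\<^sub>R (-y)))"
        by (rule integral_lborel_shift[symmetric, of "\<lambda>x. gy x * \<phi> (x + s *\<^sub>R (-y))"]) measurable
      finally show "(LINT x|lborel. k s * (u x * D (x + s *\<^sub>R (-y)) (-y)))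
          = (LINT x|lborel. k s * (\<phi> x * gy (x + s *\<^sub>R y)))"
        by (simp add: mult.commute)
    qed
    also have "\<dots> = (LINT x|lborel. LINT s|lborel. k s * (\<phi> x * gy (x + s *\<^sub>R y)))"
      by (rule lborel_pair.Fubini_integral[symmetric])
        (use integrable_shift_pair[OF k(1,2) \<phi> gy, of "\<lambda>s. s *\<^sub>R y"] in simp)
    also have "\<dots> = (LINT x|lborel. G x * \<phi> x)"
      unfolding G_def pull[symmetric] by (simp only: mult.commute)
    finally have "(LINT x|lborel. (u (x + y) - u x) * \<phi> x) = (LINT x|lborel. G x * \<phi> x)" .
    moreover have "integrable lborel (\<lambda>x. (u (x + y) - u x) * \<phi> x)" "integrable lborel (\<lambda>x. G x * \<phi>
        x)"
      by (rule integrable_mult_sqint[OF sqint_diff[OF sqint_shift[OF u] u] \<phi>])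
        (rule integrable_mult_sqint[OF G(1) \<phi>])
    ultimately show "(LINT x|lborel. (u (x + y) - u x - G x) * \<phi> x) = 0"
      by (simp add: left_diff_distrib[of "_ - _"])
  qed
  then have "nsq lborel (\<lambda>x. u (x + y) - u x) = nsq lborel G"
    unfolding nsq_def by (intro integral_cong_AE) (measurable, elim eventually_mono, simp)
  then show ?thesis using G(2) unfolding gy_def by simp
qed

section \<open>The Sobolev space and difference quotients\<close>

lemma is_weak_grad_unique:
  fixes u :: "'a::euclidean_space \<Rightarrow> real"
  assumes "is_weak_grad u g" "is_weak_grad u g'" and g: "sqint lborel g" and g': "sqint lborel g'"
  shows "AE x in lborel. g x = g' x"
proof -
  have "AE x in lborel. \<forall>i\<in>Basis. (g x - g' x) \<bullet> i = 0"
  proof (intro AE_finite_allI finite_Basis fundamental_lemma)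
    fix i :: 'a assume i: "i \<in> Basis"
    show "sqint lborel (\<lambda>x. (g x - g' x) \<bullet> i)" by (intro sqint_inner_const sqint_diff g g')
    fix \<phi> :: "'a \<Rightarrow> real" and D assume t: "test_fun \<phi> D"
    have "integrable lborel (\<lambda>x. (g x \<bullet> i) * \<phi> x)" "integrable lborel (\<lambda>x. (g' x \<bullet> i) * \<phi> x)"
      by (intro integrable_mult_sqint sqint_inner_const g g' test_fun_sqint[OF t])+
    then have "(LINT x|lborel. (g x - g' x) \<bullet> i * \<phi> x) = (LINT x|lborel. (g x \<bullet> i) * \<phi> x)
        - (LINT x|lborel. (g' x \<bullet> i) * \<phi> x)"
      by (simp add: inner_diff_left left_diff_distrib)
    also have "\<dots> = 0"
    proof -
      have "(LINT x|lborel. u x * D x i) = - (LINT x|lborel. (g x \<bullet> i) * \<phi> x)"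
        using assms(1) t i unfolding is_weak_grad_def by blast
      moreover have "(LINT x|lborel. u x * D x i) = - (LINT x|lborel. (g' x \<bullet> i) * \<phi> x)"
        using assms(2) t i unfolding is_weak_grad_def by blast
      ultimately show ?thesis by simp
    qed
    finally show "(LINT x|lborel. (g x - g' x) \<bullet> i * \<phi> x) = 0" .
  qed
  then show ?thesis
    by eventually_elim (metis euclidean_eq_iff inner_diff_left right_minus_eq)
qed

lemma H1_sqint: "u \<in> H1 \<Longrightarrow> sqint lborel u"
  by (simp add: H1_def sqint_def)

lemma H1_wgrad:
  assumes "u \<in> H1"
  shows "sqint lborel (wgrad u)" "is_weak_grad u (wgrad u)"
proof -
  have "\<exists>g. g \<in> borel_measurable lborel \<and> integrable lborel (\<lambda>x. (norm (g x))\<^sup>2) \<and> is_weak_grad u g"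
    using assms by (simp add: H1_def)
  from someI_ex[OF this] show "sqint lborel (wgrad u)" "is_weak_grad u (wgrad u)"
    unfolding wgrad_def[symmetric] by (auto simp: sqint_def)
qed

lemma dirichlet_eq: "dirichlet u = nsq lborel (wgrad u)"
  by (simp add: dirichlet_def nsq_def)

lemma H1_I:
  assumes u: "sqint lborel u" and g: "sqint lborel g" and w: "is_weak_grad u g"
  shows "u \<in> H1" "AE x in lborel. wgrad u x = g x" "dirichlet u = nsq lborel g"
proof -
  show 1: "u \<in> H1" using u g w by (auto simp: H1_def sqint_def)
  show 2: "AE x in lborel. wgrad u x = g x"
    by (rule is_weak_grad_unique[OF H1_wgrad(2)[OF 1] w H1_wgrad(1)[OF 1] g])
  have "g \<in> borel_measurable lborel" "wgrad u \<in> borel_measurable lborel"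
    using g H1_wgrad[OF 1] by (auto simp: sqint_def)
  then show "dirichlet u = nsq lborel g" unfolding dirichlet_eq nsq_def
    using 2 by (intro integral_cong_AE) (auto elim: eventually_mono)
qed

lemma is_weak_grad_lin:
  fixes u v :: "'a::euclidean_space \<Rightarrow> real"
  assumes u: "u \<in> H1" and v: "v \<in> H1"
  shows "is_weak_grad (\<lambda>x. u x + c * v x) (\<lambda>x. wgrad u x + c *\<^sub>R wgrad v x)"
  unfolding is_weak_grad_def
proof (intro allI impI ballI)
  fix \<phi> :: "'a \<Rightarrow> real" and D and i :: 'a assume t: "test_fun \<phi> D" and i: "i \<in> Basis"
  note int = integrable_mult_sqint[OF H1_sqint[OF u] test_fun_deriv_sqint[OF t]]
    integrable_mult_sqint[OF H1_sqint[OF v] test_fun_deriv_sqint[OF t]]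
    integrable_mult_sqint[OF sqint_inner_const[OF H1_wgrad(1)[OF u]] test_fun_sqint[OF t]]
    integrable_mult_sqint[OF sqint_inner_const[OF H1_wgrad(1)[OF v]] test_fun_sqint[OF t]]
  have eq: "(LINT x|lborel. u x * D x i) = - (LINT x|lborel. (wgrad u x \<bullet> i) * \<phi> x)"
    "(LINT x|lborel. v x * D x i) = - (LINT x|lborel. (wgrad v x \<bullet> i) * \<phi> x)"
    using H1_wgrad(2)[OF u] H1_wgrad(2)[OF v] t i by (auto simp: is_weak_grad_def)
  have "(LINT x|lborel. (u x + c * v x) * D x i) = (LINT x|lborel. u x * D x i + c * (v x * D x i))"
    by (simp add: algebra_simps)
  also have "\<dots> = - (LINT x|lborel. (wgrad u x \<bullet> i) * \<phi> x + c * ((wgrad v x \<bullet> i) * \<phi> x))"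
    using int by (simp add: eq)
  also have "\<dots> = - (LINT x|lborel. ((wgrad u x + c *\<^sub>R wgrad v x) \<bullet> i) * \<phi> x)"
    by (simp add: inner_add_left algebra_simps)
  finally show "(LINT x|lborel. (u x + c * v x) * D x i) = - (LINT x|lborel. ((wgrad u x
      + c *\<^sub>R wgrad v x) \<bullet> i) * \<phi> x)" .
qed

lemma H1_lin:
  assumes u: "u \<in> H1" and v: "v \<in> H1"
  shows "(\<lambda>x. u x + c * v x) \<in> H1"
    "AE x in lborel. wgrad (\<lambda>x. u x + c * v x) x = wgrad u x + c *\<^sub>R wgrad v x"
    "dirichlet (\<lambda>x. u x + c * v x) = dirichlet u + 2 * c * ip lborel (wgrad u) (wgrad v)
        + c\<^sup>2 * dirichlet v"
proof -
  have s: "sqint lborel (\<lambda>x. u x + c * v x)"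
    using sqint_add[OF H1_sqint[OF u] sqint_scaleR[OF H1_sqint[OF v]], of c] by simp
  note g = H1_wgrad(1)[OF u] sqint_scaleR[OF H1_wgrad(1)[OF v], of c]
  note * = H1_I[OF s sqint_add[OF g] is_weak_grad_lin[OF u v]]
  show "(\<lambda>x. u x + c * v x) \<in> H1" by (rule *(1))
  show "AE x in lborel. wgrad (\<lambda>x. u x + c * v x) x = wgrad u x + c *\<^sub>R wgrad v x" by (rule *(2))
  show "dirichlet (\<lambda>x. u x + c * v x) = dirichlet u + 2 * c * ip lborel (wgrad u) (wgrad v)
      + c\<^sup>2 * dirichlet v"
    unfolding *(3) nsq_add[OF g] nsq_scaleR dirichlet_eq
    using ip_scaleR[of lborel c "wgrad v" "wgrad u"] by (simp add: ip_commute)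
qed

lemma H1_zero: "(\<lambda>x. 0) \<in> (H1 :: ('a::euclidean_space \<Rightarrow> real) set)"
  by (rule H1_I(1)[OF sqint_zero sqint_zero]) (simp add: is_weak_grad_def)

lemma dirichlet_nonneg: "dirichlet u \<ge> 0"
  by (simp add: dirichlet_eq nsq_nonneg)

lemma dirichlet_zero: "dirichlet (\<lambda>x. 0 :: real) = 0"
proof -
  have "dirichlet (\<lambda>x::'a. 0 :: real) = nsq lborel (\<lambda>x::'a. 0 :: 'a)"
    by (rule H1_I(3)[OF sqint_zero sqint_zero]) (simp add: is_weak_grad_def)
  then show ?thesis by (simp add: nsq_def)
qed

lemma H1_scale:
  assumes v: "v \<in> H1"
  shows "(\<lambda>x. c * v x) \<in> H1" "dirichlet (\<lambda>x. c * v x) = c\<^sup>2 * dirichlet v"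
proof -
  show "(\<lambda>x. c * v x) \<in> H1" using H1_lin(1)[OF H1_zero v, of c] by simp
  \<comment> \<open>\<open>wgrad\<close> picks some representative, so the gradient of 0 is
    controlled only through its square integral. Cauchy-Schwarz then removes the cross term.\<close>
  have "ip lborel (wgrad (\<lambda>x. 0)) (wgrad v) = 0"
    using abs_ip_le[OF H1_wgrad(1)[OF H1_zero] H1_wgrad(1)[OF v]]
    by (simp add: dirichlet_eq[symmetric] dirichlet_zero)
  then show "dirichlet (\<lambda>x. c * v x) = c\<^sup>2 * dirichlet v"
    using H1_lin(3)[OF H1_zero v, of c] by (simp add: dirichlet_zero)
qed

lemma H1_shift:
  fixes u :: "'a::euclidean_space \<Rightarrow> real"
  assumes u: "u \<in> H1"
  shows "(\<lambda>x. u (x + z)) \<in> H1" "dirichlet (\<lambda>x. u (x + z)) = dirichlet u"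
proof -
  note su = H1_sqint[OF u] and sg = H1_wgrad(1)[OF u]
  have [measurable]: "u \<in> borel_measurable borel" "wgrad u \<in> borel_measurable borel"
    using su sg by (auto simp: sqint_def)
  have w: "is_weak_grad (\<lambda>x. u (x + z)) (\<lambda>x. wgrad u (x + z))"
    unfolding is_weak_grad_def
  proof (intro allI impI ballI)
    fix \<phi> :: "'a \<Rightarrow> real" and D and i :: 'a assume t: "test_fun \<phi> D" and i: "i \<in> Basis"
    have [measurable]: "\<phi> \<in> borel_measurable borel" "(\<lambda>x. D x i) \<in> borel_measurable borel"
      using test_fun_sqint[OF t] test_fun_deriv_sqint[OF t, of i] by (auto simp: sqint_def)
    have "(LINT x|lborel. u (x + z) * D x i) = (LINT x|lborel. u x * D (x + - z) i)"
      using integral_lborel_shift[of "\<lambda>x. u x * D (x + - z) i" z] by simp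
    also have "\<dots> = - (LINT x|lborel. (wgrad u x \<bullet> i) * \<phi> (x + - z))"
      using H1_wgrad(2)[OF u] test_fun_shift[OF t, of "-z"] i unfolding is_weak_grad_def by blast
    also have "\<dots> = - (LINT x|lborel. (wgrad u (x + z) \<bullet> i) * \<phi> x)"
      using integral_lborel_shift[of "\<lambda>x. (wgrad u x \<bullet> i) * \<phi> (x + - z)" z] by simp
    finally show "(LINT x|lborel. u (x + z) * D x i) = - (LINT x|lborel. (wgrad u (x + z) \<bullet> i) * \<phi>
        x)" .
  qed
  show "(\<lambda>x. u (x + z)) \<in> H1" by (rule H1_I(1)[OF sqint_shift[OF su] sqint_shift[OF sg] w])
  show "dirichlet (\<lambda>x. u (x + z)) = dirichlet u"
    using H1_I(3)[OF sqint_shift[OF su] sqint_shift[OF sg] w] nsq_shift[OF sg]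
      by (simp add: dirichlet_eq)
qed

lemma nsq_components:
  assumes "\<And>i. i \<in> Basis \<Longrightarrow> sqint M (f i)"
  shows "sqint M (\<lambda>x. \<Sum>i\<in>Basis. f i x *\<^sub>R (i::'a::euclidean_space))"
    "nsq M (\<lambda>x. \<Sum>i\<in>Basis. f i x *\<^sub>R (i::'a)) = (\<Sum>i\<in>Basis. nsq M (f i))"
proof -
  have [measurable]: "i \<in> Basis \<Longrightarrow> f i \<in> borel_measurable M" for i using assms
    by (auto simp: sqint_def)
  have eq: "(norm (\<Sum>i\<in>Basis. f i x *\<^sub>R (i::'a)))\<^sup>2 = (\<Sum>i\<in>Basis. (norm (f i x))\<^sup>2)" for x
    unfolding power2_norm_eq_inner by (subst euclidean_inner) (simp add: power2_eq_square)
  show "sqint M (\<lambda>x. \<Sum>i\<in>Basis. f i x *\<^sub>R (i::'a))"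
    unfolding sqint_def eq
    by (intro conjI Bochner_Integration.integrable_sum sqint_integrable assms) measurable
  show "nsq M (\<lambda>x. \<Sum>i\<in>Basis. f i x *\<^sub>R (i::'a)) = (\<Sum>i\<in>Basis. nsq M (f i))"
    unfolding nsq_def eq by (intro Bochner_Integration.integral_sum sqint_integrable assms)
qed

text \<open>All coordinate quotients form one vector field, so that a single weak limit yields the
  whole gradient.\<close>

definition diffq :: "real \<Rightarrow> ('a::euclidean_space \<Rightarrow> real) \<Rightarrow> 'a \<Rightarrow> 'a" where
  "diffq t w x = (\<Sum>i\<in>Basis. ((w (x + t *\<^sub>R i) - w x) / t) *\<^sub>R i)"

lemma sqint_diffq_component: "sqint lborel w \<Longrightarrow> sqint lborel (\<lambda>x. (w (x + y) - w x) / t)"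
  for w :: "'a::euclidean_space \<Rightarrow> real"
  using sqint_scaleR[OF sqint_diff[OF sqint_shift, of w w y], of "1/t"] by simp

lemma diffq_sqint: "sqint lborel w \<Longrightarrow> sqint lborel (diffq t w)"
  unfolding diffq_def by (intro nsq_components sqint_diffq_component)

lemma nsq_diffq:
  fixes w :: "'a::euclidean_space \<Rightarrow> real"
  assumes "sqint lborel w"
  shows "nsq lborel (diffq t w) = (\<Sum>i\<in>Basis. nsq lborel (\<lambda>x. w (x + t *\<^sub>R i) - w x)) / t\<^sup>2"
proof -
  have "nsq lborel (\<lambda>x. (w (x + t *\<^sub>R i) - w x) / t) = nsq lborel (\<lambda>x. w (x + t *\<^sub>R i) - w x) / t\<^sup>2"
      for i
    using nsq_scaleR[of lborel "1/t" "\<lambda>x. w (x + t *\<^sub>R i) - w x"] by (simp add: power_divide)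
  then show ?thesis
    unfolding diffq_def
      nsq_components(2)[of lborel "\<lambda>i x. (w (x + t *\<^sub>R i) - w x) / t", OF sqint_diffq_component[OF
          assms]]
    by (simp only: sum_divide_distrib)
qed

text \<open>The translation bound is applied with the directional derivative of each coordinate, not
  with the full gradient. Summation then gives constant 1, on which the comparison of Dirichlet
  integrals for the competitors depends.\<close>

lemma nsq_diffq_le_dirichlet:
  fixes u :: "'a::euclidean_space \<Rightarrow> real"
  assumes u: "u \<in> H1" and t: "t \<noteq> 0"
  shows "nsq lborel (diffq t u) \<le> dirichlet u"
proof -
  note s = H1_sqint[OF u] and g = H1_wgrad[OF u]
  have 1: "nsq lborel (\<lambda>x. u (x + t *\<^sub>R i) - u x) \<le> t\<^sup>2 * nsq lborel (\<lambda>x. wgrad u x \<bullet> i)" for i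
    using weak_grad_translation[OF s g, of "t *\<^sub>R i"] nsq_scaleR[of lborel t "\<lambda>x. wgrad u x \<bullet> i"]
      by simp
  have "nsq lborel (diffq t u) \<le> (\<Sum>i\<in>Basis. t\<^sup>2 * nsq lborel (\<lambda>x. wgrad u x \<bullet> i)) / t\<^sup>2"
    unfolding nsq_diffq[OF s] by (intro divide_right_mono sum_mono 1) simp
  also have "\<dots> = (\<Sum>i\<in>Basis. nsq lborel (\<lambda>x. wgrad u x \<bullet> i))"
    using t by (simp add: sum_distrib_left[symmetric])
  also have "\<dots> = nsq lborel (\<lambda>x. \<Sum>i\<in>Basis. (wgrad u x \<bullet> i) *\<^sub>R i)"
    by (rule nsq_components(2)[symmetric]) (intro sqint_inner_const g)
  also have "\<dots> = dirichlet u" by (simp add: euclidean_representation dirichlet_eq)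
  finally show ?thesis .
qed

lemma test_fun_difference_quotient:
  fixes w :: "'a::euclidean_space \<Rightarrow> real"
  assumes w: "sqint lborel w" and t: "test_fun \<phi> D" and h: "h \<longlonglongrightarrow> 0" "\<And>n. h n \<noteq> 0"
  shows "(\<lambda>n. LINT x|lborel. w x * ((\<phi> (x + h n *\<^sub>R y) - \<phi> x) / h n))
      \<longlonglongrightarrow> (LINT x|lborel. w x * D x y)"
proof -
  obtain B where B: "B \<ge> 0" "\<And>x. norm (D x y) \<le> B"
    using bounded_of_compact_support[OF test_fun_deriv_continuous[OF t] test_fun_support(1)[OF t]
        test_fun_deriv_support[OF t]] by metis
  obtain R where R: "\<And>x. \<phi> x \<noteq> 0 \<Longrightarrow> norm x \<le> R"
    using compact_imp_bounded[OF test_fun_support(1)[OF t]] test_fun_support(2)[OF t]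
      by (metis bounded_iff)
  obtain H where H: "\<And>n. norm (h n) \<le> H"
    using convergent_imp_Bseq[of h] h(1) by (auto simp: convergent_def Bseq_def)
  \<comment> \<open>Since \<open>h\<close> is bounded by \<open>H\<close>, one ball contains the
    points where some translate of the test function is nonzero.\<close>
  define K where "K = cball (0::'a) (R + H * norm y)"
  have zero: "(\<phi> (x + h n *\<^sub>R y) - \<phi> x) / h n = 0" if "x \<notin> K" for x n
  proof -
    have "H * norm y \<ge> 0" by (intro mult_nonneg_nonneg[OF order_trans[OF norm_ge_zero H[of 0]]]
        norm_ge_zero)
    then have 1: "\<phi> x = 0" using that R[of x] by (auto simp: K_def)
    have "norm x \<le> norm (x + h n *\<^sub>R y) + norm (h n *\<^sub>R y)"
      using norm_triangle_ineq4[of "x + h n *\<^sub>R y" "h n *\<^sub>R y"] by simp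
    also have "norm (h n *\<^sub>R y) \<le> H * norm y" using H[of n] by (auto intro: mult_right_mono)
    finally have "\<phi> (x + h n *\<^sub>R y) = 0" using that R[of "x + h n *\<^sub>R y"] by (auto simp: K_def)
    then show ?thesis using 1 by simp
  qed
  have bound: "norm ((\<phi> (x + h n *\<^sub>R y) - \<phi> x) / h n) \<le> B * indicator K x" for x n
  proof (cases "x \<in> K")
    case True
    have "norm (\<phi> (x + h n *\<^sub>R y) - \<phi> (x + 0 *\<^sub>R y)) \<le> B * norm (h n - 0)"
      by (rule field_differentiable_bound[where S=UNIV and f="\<lambda>s. \<phi> (x + s *\<^sub>R y)"
          and f'="\<lambda>s. D (x + s *\<^sub>R y) y"])
        (auto intro: test_fun_line_deriv[OF t] B(2)[unfolded real_norm_def])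
    then show ?thesis using True h(2)[of n] by (simp add: field_simps)
  qed (simp add: zero)
  have "sqint lborel (indicator K :: 'a \<Rightarrow> real)"
    unfolding K_def by (rule sqint_indicator[OF _ emeasure_bounded_finite[OF bounded_cball]]) simp
  then have "integrable lborel (\<lambda>x. B * (w x * indicator K x))"
    using integrable_mult_sqint[OF w] by simp
  then have int: "integrable lborel (\<lambda>x. \<bar>B * (w x * indicator K x)\<bar>)" by simp
  have [measurable]: "w \<in> borel_measurable borel" "\<phi> \<in> borel_measurable borel"
      "(\<lambda>x. D x y) \<in> borel_measurable borel"
    using w test_fun_sqint[OF t] test_fun_deriv_sqint[OF t] by (auto simp: sqint_def)
  show ?thesis
  proof (rule integral_dominated_convergence[OF _ _ int])
    show "AE x in lborel. (\<lambda>n. w x * ((\<phi> (x + h n *\<^sub>R y) - \<phi> x) / h n)) \<longlonglongrightarrow> w x * D x y"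
    proof (intro AE_I2 tendsto_intros)
      fix x
      have "((\<lambda>s. (\<phi> (x + s *\<^sub>R y) - \<phi> x) / s) \<longlongrightarrow> D x y) (at 0)"
        using test_fun_line_deriv[OF t, of x y 0] by (simp add: DERIV_def)
      moreover have "filterlim h (at 0) sequentially" using h by (auto simp: filterlim_at)
      ultimately show "(\<lambda>n. (\<phi> (x + h n *\<^sub>R y) - \<phi> x) / h n) \<longlonglongrightarrow> D x y"
        by (rule filterlim_compose)
    qed
    show "AE x in lborel. norm (w x * ((\<phi> (x + h n *\<^sub>R y) - \<phi> x) / h n))
        \<le> \<bar>B * (w x * indicator K x)\<bar>" for n
    proof (rule AE_I2)
      fix x
      have "norm (w x * ((\<phi> (x + h n *\<^sub>R y) - \<phi> x) / h n)) \<le> \<bar>w x\<bar> * (B * indicator K x)"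
        using bound[of x n] unfolding norm_mult by (intro mult_mono) auto
      then show "norm (w x * ((\<phi> (x + h n *\<^sub>R y) - \<phi> x) / h n)) \<le> \<bar>B * (w x * indicator K x)\<bar>"
        using B(1) by (simp add: abs_mult mult_ac)
    qed
  qed measurable
qed

text \<open>The weak gradient is the weak limit of difference quotients.\<close>
lemma H1_of_diffq:
  fixes w :: "'a::euclidean_space \<Rightarrow> real"
  assumes w: "sqint lborel w" and h: "h \<longlonglongrightarrow> 0" "\<And>n. h n \<noteq> 0" and C: "\<And>n. nsq lborel (diffq (h n) w)
      \<le> C"
  shows "w \<in> H1" "dirichlet w \<le> C"
proof -
  obtain G where G: "sqint lborel G" "nsq lborel G \<le> C"
    "\<And>W L. sqint lborel W \<Longrightarrow> (\<lambda>n. ip lborel (diffq (h n) w) W) \<longlonglongrightarrow> L \<Longrightarrow> ip lborel G W = L"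
    by (rule weak_limit[of lborel "\<lambda>n. diffq (h n) w" C, OF diffq_sqint[OF w] C]) (rule that,
        assumption+)
  have "is_weak_grad w G"
    unfolding is_weak_grad_def
  proof (intro allI impI ballI)
    fix \<phi> :: "'a \<Rightarrow> real" and D and i :: 'a assume t: "test_fun \<phi> D" and i: "i \<in> Basis"
    note \<phi> = test_fun_sqint[OF t]
    have [measurable]: "\<phi> \<in> borel_measurable borel" "w \<in> borel_measurable borel" using \<phi> w
      by (auto simp: sqint_def)
    have s: "sqint lborel (\<lambda>x. \<phi> x *\<^sub>R i)"
    proof -
      have "(norm (\<phi> x *\<^sub>R i))\<^sup>2 = (norm (\<phi> x))\<^sup>2" for x using i
        by (simp only: norm_scaleR norm_Basis) simp
      then show ?thesis using sqint_integrable[OF \<phi>] unfolding sqint_def by (simp only:) measurable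
    qed
    \<comment> \<open>Discrete integration by parts: translation invariance moves the quotient from
      \<open>w\<close> to the test function and reverses the direction.\<close>
    have "ip lborel (diffq (h n) w) (\<lambda>x. \<phi> x *\<^sub>R i) = (LINT x|lborel. w x * ((\<phi> (x + h n *\<^sub>R (-i))
        - \<phi> x) / h n))" for n
    proof -
      have "ip lborel (diffq (h n) w) (\<lambda>x. \<phi> x *\<^sub>R i) = (LINT x|lborel. (w (x + h n *\<^sub>R i) * \<phi> x) /
          h n - (w x * \<phi> x) / h n)"
      proof -
        have "diffq (h n) w x \<bullet> i = (w (x + h n *\<^sub>R i) - w x) / h n" for x
          unfolding diffq_def using i by simp
        then show ?thesis unfolding ip_def
          by (simp only: inner_scaleR_right mult.commute[of
              "\<phi> _"] diff_divide_distrib left_diff_distrib times_divide_eq_left)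
      qed
      also have "\<dots> = (LINT x|lborel. w (x + h n *\<^sub>R i) * \<phi> x) / h n - (LINT x|lborel. w x * \<phi> x) / h
          n"
        using integrable_mult_sqint[OF w \<phi>] integrable_mult_sqint[OF sqint_shift[OF w] \<phi>] by simp
      also have "(LINT x|lborel. w (x + h n *\<^sub>R i) * \<phi> x) = (LINT x|lborel. w x * \<phi> (x
          + h n *\<^sub>R (-i)))"
        using integral_lborel_shift[of "\<lambda>x. w x * \<phi> (x + h n *\<^sub>R (-i))" "h n *\<^sub>R i"] by simp
      also have "(LINT x|lborel. w x * \<phi> (x + h n *\<^sub>R (-i))) / h n - (LINT x|lborel. w x * \<phi> x) / h
          n
          = (LINT x|lborel. (w x * \<phi> (x + h n *\<^sub>R (-i))) / h n - (w x * \<phi> x) / h n)"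
        using integrable_mult_sqint[OF w \<phi>] integrable_mult_sqint[OF w sqint_shift[OF \<phi>, of
            "h n *\<^sub>R (-i)"]] by simp
      also have "\<dots> = (LINT x|lborel. w x * ((\<phi> (x + h n *\<^sub>R (-i)) - \<phi> x) / h n))"
        by (intro Bochner_Integration.integral_cong) (auto simp: right_diff_distrib
            diff_divide_distrib)
      finally show ?thesis .
    qed
    then have "(\<lambda>n. ip lborel (diffq (h n) w) (\<lambda>x. \<phi> x *\<^sub>R i)) \<longlonglongrightarrow> (LINT x|lborel. w x * D x (-i))"
      using test_fun_difference_quotient[OF w t h, of "-i"] by simp
    from G(3)[OF s this] have "ip lborel G (\<lambda>x. \<phi> x *\<^sub>R i) = (LINT x|lborel. w x * D x (-i))" .
    then show "(LINT x|lborel. w x * D x i) = - (LINT x|lborel. (G x \<bullet> i) * \<phi> x)"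
      by (simp add: ip_def linear_neg[OF test_fun_linear[OF t]] mult.commute)
  qed
  from H1_I[OF w G(1) this] G(2) show "w \<in> H1" "dirichlet w \<le> C" by auto
qed

text \<open>For explicit profiles, where the factor given by the dimension is harmless and the bound
  is at hand only for small steps.\<close>

lemma H1_of_translation_bound:
  fixes w :: "'a::euclidean_space \<Rightarrow> real"
  assumes w: "sqint lborel w" and r: "r > 0"
    and C: "\<And>i t. i \<in> Basis \<Longrightarrow> 0 < t \<Longrightarrow> t \<le> r \<Longrightarrow> nsq lborel (\<lambda>x. w (x + t *\<^sub>R i) - w x) \<le> t\<^sup>2 * C"
  shows "w \<in> H1" "dirichlet w \<le> real DIM('a) * C"
proof -
  define h where "h n = r / real (Suc n)" for n
  have h: "h \<longlonglongrightarrow> 0" "\<And>n. h n \<noteq> 0" "\<And>n. 0 < h n" "\<And>n. h n \<le> r"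
  proof -
    show "h \<longlonglongrightarrow> 0" unfolding h_def by (rule LIMSEQ_Suc[OF lim_const_over_n])
    show "h n \<noteq> 0" "0 < h n" "h n \<le> r" for n using r by (auto simp: h_def divide_le_eq)
  qed
  have "nsq lborel (diffq (h n) w) \<le> real DIM('a) * C" for n
  proof -
    have "nsq lborel (diffq (h n) w) \<le> (\<Sum>i\<in>(Basis::'a set). (h n)\<^sup>2 * C) / (h n)\<^sup>2"
      unfolding nsq_diffq[OF w] using h by (intro divide_right_mono sum_mono C) auto
    also have "\<dots> = real DIM('a) * C" using h(2)[of n] by simp
    finally show ?thesis .
  qed
  from H1_of_diffq[OF w h(1,2) this] show "w \<in> H1" "dirichlet w \<le> real DIM('a) * C" by auto
qed

text \<open>The reverse triangle inequality in the plane.\<close>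

lemma sqrt_sum_sq_diff_le:
  "(sqrt (a\<^sup>2 + b\<^sup>2) - sqrt (c\<^sup>2 + d\<^sup>2))\<^sup>2 \<le> (a - c)\<^sup>2 + (b - d :: real)\<^sup>2"
proof -
  have "\<bar>norm (a, b) - norm (c, d)\<bar> \<le> norm ((a, b) - (c, d))" by (rule norm_triangle_ineq3)
  then have "\<bar>norm (a, b) - norm (c, d)\<bar>\<^sup>2 \<le> (norm ((a, b) - (c, d)))\<^sup>2" by (intro power_mono) auto
  then show ?thesis by (simp add: norm_Pair)
qed

text \<open>The reverse triangle inequality gives the comparison for every difference quotient, and
  the uniform bound on quotients passes to the weak gradient without loss. No derivative of the
  square root is taken, which would be singular where both functions vanish.\<close>

lemma H1_sqrt_sum_sq:
  fixes u v :: "'a::euclidean_space \<Rightarrow> real"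
  assumes u: "u \<in> H1" and v: "v \<in> H1"
  shows "(\<lambda>x. sqrt ((u x)\<^sup>2 + (v x)\<^sup>2)) \<in> H1"
    "dirichlet (\<lambda>x. sqrt ((u x)\<^sup>2 + (v x)\<^sup>2)) \<le> dirichlet u + dirichlet v"
    "nsq lborel (\<lambda>x. sqrt ((u x)\<^sup>2 + (v x)\<^sup>2)) = nsq lborel u + nsq lborel v"
proof -
  note su = H1_sqint[OF u] and sv = H1_sqint[OF v]
  have [measurable]: "u \<in> borel_measurable borel" "v \<in> borel_measurable borel" using su sv
    by (auto simp: sqint_def)
  define w where "w x = sqrt ((u x)\<^sup>2 + (v x)\<^sup>2)" for x
  have [measurable]: "w \<in> borel_measurable borel" unfolding w_def by measurable
  have sq: "(norm (w x))\<^sup>2 = (norm (u x))\<^sup>2 + (norm (v x))\<^sup>2" for x by (simp add: w_def)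
  have sw: "sqint lborel w" unfolding sqint_def sq using su sv by (auto simp: sqint_def)
  show "nsq lborel (\<lambda>x. sqrt ((u x)\<^sup>2 + (v x)\<^sup>2)) = nsq lborel u + nsq lborel v"
    unfolding w_def[symmetric] unfolding nsq_def sq using su sv by (simp add: sqint_def)
  have le: "nsq lborel (\<lambda>x. w (x + y) - w x) \<le> nsq lborel (\<lambda>x. u (x + y) - u x) + nsq lborel (\<lambda>x. v
      (x + y) - v x)" for y
  proof -
    have i: "integrable lborel (\<lambda>x. (norm (f (x + y) - f x))\<^sup>2)" if "sqint lborel f"
        for f :: "'a \<Rightarrow> real"
      by (intro sqint_integrable sqint_diff sqint_shift that)
    have "nsq lborel (\<lambda>x. w (x + y) - w x) \<le> (LINT x|lborel. (norm (u (x + y) - u x))\<^sup>2 + (norm (v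
        (x + y) - v x))\<^sup>2)"
      unfolding nsq_def
    proof (rule integral_mono)
      show "(norm (w (x + y) - w x))\<^sup>2 \<le> (norm (u (x + y) - u x))\<^sup>2 + (norm (v (x + y) - v x))\<^sup>2"
          for x
        using sqrt_sum_sq_diff_le[of "u (x+y)" "v (x+y)" "u x" "v x"] by (simp add: w_def)
    qed (use i su sv sw in auto)
    then show ?thesis using i[OF su] i[OF sv] by (simp add: nsq_def)
  qed
  define h where "h n = 1 / real (Suc n)" for n
  have h: "h \<longlonglongrightarrow> 0" "\<And>n. h n \<noteq> 0"
  proof -
    show "h \<longlonglongrightarrow> 0" unfolding h_def by (rule LIMSEQ_Suc[OF lim_const_over_n])
    show "h n \<noteq> 0" for n by (simp add: h_def)
  qed
  have "nsq lborel (diffq (h n) w) \<le> dirichlet u + dirichlet v" for n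
  proof -
    have "nsq lborel (diffq (h n) w) \<le> nsq lborel (diffq (h n) u) + nsq lborel (diffq (h n) v)"
      unfolding nsq_diffq[OF su] nsq_diffq[OF sv] nsq_diffq[OF sw] add_divide_distrib[symmetric]
          sum.distrib[symmetric]
      by (intro divide_right_mono sum_mono le) simp
    also have "\<dots> \<le> dirichlet u + dirichlet v"
      using nsq_diffq_le_dirichlet[OF u h(2)] nsq_diffq_le_dirichlet[OF v h(2)] by (intro add_mono)
    finally show ?thesis .
  qed
  from H1_of_diffq[OF sw h this]
  show "(\<lambda>x. sqrt ((u x)\<^sup>2 + (v x)\<^sup>2)) \<in> H1" "dirichlet (\<lambda>x. sqrt ((u x)\<^sup>2 + (v x)\<^sup>2))
      \<le> dirichlet u + dirichlet v"
    unfolding w_def by auto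
qed

section \<open>Ball averages and integral bounds\<close>

definition ball_kernel :: "real \<Rightarrow> 'a::euclidean_space \<Rightarrow> real" where
  "ball_kernel e z = indicator (ball 0 e) z / measure lborel (ball (0::'a) e)"

text \<open>A mollification by the normalised ball indicator, written as an average of translates so
  that translation bounds apply to it directly.\<close>

definition bavg :: "real \<Rightarrow> ('a::euclidean_space \<Rightarrow> real) \<Rightarrow> 'a \<Rightarrow> real" where
  "bavg e u x = (LINT z|lborel. ball_kernel e z * u (x + z))"

lemma ball_kernel:
  assumes "e > 0"
  shows "integrable lborel (ball_kernel e :: 'a::euclidean_space \<Rightarrow> real)" "ball_kernel e (z::'a)
      \<ge> 0"
    "(LINT z|lborel. ball_kernel e (z::'a)) = 1" "sqint lborel (ball_kernel e :: 'a \<Rightarrow> real)"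
    "nsq lborel (ball_kernel e :: 'a \<Rightarrow> real) = 1 / measure lborel (ball (0::'a) e)"
proof -
  have V: "measure lborel (ball (0::'a) e) > 0" using assms by (rule content_ball_pos)
  have fin: "emeasure lborel (ball (0::'a) e) < \<infinity>" by (rule emeasure_bounded_finite) simp
  have i: "integrable lborel (indicator (ball (0::'a) e) :: 'a \<Rightarrow> real)" using fin
    by (simp add: less_top)
  show "integrable lborel (ball_kernel e :: 'a \<Rightarrow> real)" unfolding ball_kernel_def[abs_def] using i
    by simp
  show "ball_kernel e z \<ge> 0" using V by (simp add: ball_kernel_def)
  show "(LINT z|lborel. ball_kernel e (z::'a)) = 1" unfolding ball_kernel_def using V by simp
  show "sqint lborel (ball_kernel e :: 'a \<Rightarrow> real)"
    using sqint_scaleR[OF sqint_indicator[OF _ fin], of "1 / measure lborel (ball (0::'a) e)"]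
    by (simp add: ball_kernel_def[abs_def])
  have "(norm (ball_kernel e z))\<^sup>2 = indicator (ball (0::'a) e) z * (1 / measure lborel (ball
      (0::'a) e))\<^sup>2" for z
    by (auto simp: ball_kernel_def power_divide split: split_indicator)
  then show "nsq lborel (ball_kernel e :: 'a \<Rightarrow> real) = 1 / measure lborel (ball (0::'a) e)"
    using V by (simp add: nsq_def power2_eq_square)
qed

lemma sqint_shift': "sqint lborel f \<Longrightarrow> sqint lborel (\<lambda>z. f (x + z))"
  using sqint_shift[of f x] by (simp add: add.commute)

lemma bavg_integrable:
  fixes u :: "'a::euclidean_space \<Rightarrow> real"
  shows "e > 0 \<Longrightarrow> sqint lborel u \<Longrightarrow> integrable lborel (\<lambda>z. ball_kernel e z * u (x + z))"
  by (intro integrable_mult_sqint ball_kernel sqint_shift')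

lemma bavg_diff:
  fixes u v :: "'a::euclidean_space \<Rightarrow> real"
  assumes "e > 0" "sqint lborel u" "sqint lborel v"
  shows "bavg e (\<lambda>y. u y - v y) x = bavg e u x - bavg e v x"
  unfolding bavg_def using bavg_integrable[OF assms(1,2)] bavg_integrable[OF assms(1,3)]
  by (simp add: right_diff_distrib)

lemma bavg_eq_ip:
  fixes u :: "'a::euclidean_space \<Rightarrow> real"
  assumes "e > 0" "sqint lborel u"
  shows "bavg e u x = ip lborel u (\<lambda>y. ball_kernel e (y - x))"
proof -
  have [measurable]: "u \<in> borel_measurable borel" "(ball_kernel e :: 'a \<Rightarrow> real) \<in> borel_measurable
      borel"
    using assms ball_kernel(4) by (auto simp: sqint_def)
  show ?thesis
    using integral_lborel_shift[of "\<lambda>y. u y * ball_kernel e (y - x)" x]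
    by (simp add: bavg_def ip_def add.commute mult.commute)
qed

lemma bavg_sq_le:
  fixes u :: "'a::euclidean_space \<Rightarrow> real"
  assumes e: "e > 0" and u: "sqint lborel u"
  shows "(bavg e u x)\<^sup>2 \<le> nsq lborel u / measure lborel (ball (0::'a) e)"
proof -
  note k = ball_kernel(4)[OF e, where 'a='a]
  have "(bavg e u x)\<^sup>2 \<le> nsq lborel u * nsq lborel (\<lambda>y::'a. ball_kernel e (y + - x))"
    unfolding bavg_eq_ip[OF e u] using ip_sq_le[OF u sqint_shift[OF k, of "-x"]] by simp
  then show ?thesis unfolding nsq_shift[OF k] ball_kernel(5)[OF e] by simp
qed

lemma nsq_translation_le:
  fixes u :: "'a::euclidean_space \<Rightarrow> real"
  assumes u: "u \<in> H1"
  shows "nsq lborel (\<lambda>x. u (x + y) - u x) \<le> (norm y)\<^sup>2 * dirichlet u"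
proof -
  note g = H1_wgrad(1)[OF u]
  have "nsq lborel (\<lambda>x. u (x + y) - u x) \<le> nsq lborel (\<lambda>x. wgrad u x \<bullet> y)"
    by (rule weak_grad_translation[OF H1_sqint[OF u] H1_wgrad[OF u]])
  also have "\<dots> \<le> (LINT x|lborel. (norm y)\<^sup>2 * (norm (wgrad u x))\<^sup>2)"
    unfolding nsq_def
  proof (rule integral_mono)
    show "integrable lborel (\<lambda>x. (norm (wgrad u x \<bullet> y))\<^sup>2)"
      by (intro sqint_integrable sqint_inner_const g)
    show "integrable lborel (\<lambda>x. (norm y)\<^sup>2 * (norm (wgrad u x))\<^sup>2)" using g
      by (simp add: sqint_def)
    show "(norm (wgrad u x \<bullet> y))\<^sup>2 \<le> (norm y)\<^sup>2 * (norm (wgrad u x))\<^sup>2" for x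
      using power_mono[OF Cauchy_Schwarz_ineq2[of "wgrad u x" y] abs_ge_zero, of 2]
      by (simp add: power_mult_distrib mult.commute)
  qed
  also have "\<dots> = (norm y)\<^sup>2 * dirichlet u" by (simp add: dirichlet_def)
  finally show ?thesis .
qed

text \<open>Averaging commutes with translation, so the difference at two points is the average of a
  translation difference of \<open>u\<close>, which the gradient controls. The Lipschitz constant
  depends on \<open>u\<close> only through its Dirichlet integral.\<close>

lemma bavg_equicontinuous:
  fixes u :: "'a::euclidean_space \<Rightarrow> real"
  assumes e: "e > 0" and u: "u \<in> H1"
  shows "(bavg e u x - bavg e u y)\<^sup>2 \<le> (norm (x - y))\<^sup>2 * dirichlet u / measure lborel (ball (0::'a)
      e)"
proof -
  note s = H1_sqint[OF u]
  have "bavg e u x = bavg e (\<lambda>p. u (p + (x - y))) y" by (simp add: bavg_def add_ac)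
  then have "bavg e u x - bavg e u y = bavg e (\<lambda>p. u (p + (x - y)) - u p) y"
    using bavg_diff[OF e sqint_shift[OF s] s] by simp
  then have "(bavg e u x - bavg e u y)\<^sup>2 \<le> nsq lborel (\<lambda>p. u (p + (x - y)) - u p) / measure lborel
      (ball (0::'a) e)"
    using bavg_sq_le[OF e sqint_diff[OF sqint_shift[OF s] s]] by simp
  also have "\<dots> \<le> (norm (x - y))\<^sup>2 * dirichlet u / measure lborel (ball (0::'a) e)"
    by (intro divide_right_mono nsq_translation_le u) simp
  finally show ?thesis .
qed

lemma bavg_measurable:
  fixes u :: "'a::euclidean_space \<Rightarrow> real"
  assumes e: "e > 0" and u: "sqint lborel u"
  shows "bavg e u \<in> borel_measurable borel"
proof -
  have [measurable]: "u \<in> borel_measurable borel" "(ball_kernel e :: 'a \<Rightarrow> real) \<in> borel_measurable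
      borel"
    using u ball_kernel(4)[OF e] by (auto simp: sqint_def)
  show ?thesis unfolding bavg_def[abs_def] by measurable
qed

text \<open>The error is an average over \<open>norm z < e\<close> of the differences
  \<open>u x - u (x + z)\<close>, each of square norm at most \<open>e^2\<close> times the Dirichlet
  integral.\<close>

lemma nsq_bavg_error:
  fixes u :: "'a::euclidean_space \<Rightarrow> real"
  assumes e: "e > 0" and u: "u \<in> H1"
  shows "sqint lborel (\<lambda>x. u x - bavg e u x)" "nsq lborel (\<lambda>x. u x - bavg e u x)
      \<le> e\<^sup>2 * dirichlet u"
proof -
  note s = H1_sqint[OF u] and k = ball_kernel[OF e, where 'a='a]
  have [measurable]: "u \<in> borel_measurable borel" "bavg e u \<in> borel_measurable borel"
    using s bavg_measurable[OF e s] by (auto simp: sqint_def)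
  have eq: "u x - bavg e u x = (LINT z|lborel. ball_kernel e z * (u x - u (x + z)))" for x
    using bavg_integrable[OF e s] k by (simp add: bavg_def right_diff_distrib)
  have C0: "e\<^sup>2 * dirichlet u \<ge> 0" by (simp add: dirichlet_nonneg)
  have "(\<integral>\<^sup>+x. ennreal ((LINT z|lborel. ball_kernel e z * (u x - u (x + z)))\<^sup>2) \<partial>lborel)
      \<le> ennreal (e\<^sup>2 * dirichlet u)"
  proof (rule nn_integral_average_sq[OF k(1,2,3) _ _ C0])
    show "(\<lambda>(z, x). u x - u (x + z)) \<in> borel_measurable (lborel \<Otimes>\<^sub>M lborel)" by measurable
    fix z :: 'a assume "ball_kernel e z \<noteq> 0"
    then have z: "norm z < e" by (auto simp: ball_kernel_def split: split_indicator_asm)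
    have "(\<integral>\<^sup>+x. ennreal ((u x - u (x + z))\<^sup>2) \<partial>lborel) = ennreal (nsq lborel (\<lambda>x. u (x + z)
        - u x))"
      using ennreal_nsq[OF sqint_diff[OF sqint_shift[OF s] s], of z] by (simp add: power2_commute)
    also have "\<dots> \<le> ennreal (e\<^sup>2 * dirichlet u)"
      using z by (intro ennreal_leI order_trans[OF nsq_translation_le[OF u]] mult_right_mono
          power_mono)
        (auto simp: dirichlet_nonneg)
    finally show "(\<integral>\<^sup>+x. ennreal ((u x - u (x + z))\<^sup>2) \<partial>lborel) \<le> ennreal (e\<^sup>2 * dirichlet u)" .
  qed
  then have *: "(\<integral>\<^sup>+x. ennreal ((norm (u x - bavg e u x))\<^sup>2) \<partial>lborel) \<le> ennreal (e\<^sup>2 * dirichlet u)"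
    by (simp add: eq)
  show "sqint lborel (\<lambda>x. u x - bavg e u x)" "nsq lborel (\<lambda>x. u x - bavg e u x) \<le> e\<^sup>2 * dirichlet u"
    using sqintI_nn[OF _ * C0] by auto
qed

section \<open>Mass above a level and subcritical power integrals\<close>

definition tailsq :: "real \<Rightarrow> ('a::euclidean_space \<Rightarrow> real) \<Rightarrow> real" where
  "tailsq l u = (LINT x|lborel. indicator {x. \<bar>u x\<bar> > l} x * (u x)\<^sup>2)"

lemma tailsq_integrable:
  fixes u :: "'a::euclidean_space \<Rightarrow> real"
  assumes u: "sqint lborel u"
  shows "integrable lborel (\<lambda>x. indicator {x. \<bar>u x\<bar> > l} x * (u x)\<^sup>2)" "tailsq l u \<le> nsq lborel u"
      "tailsq l u \<ge> 0"
proof -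
  have [measurable]: "u \<in> borel_measurable borel" using u by (simp add: sqint_def)
  have i: "integrable lborel (\<lambda>x. (u x)\<^sup>2)" using u by (simp add: sqint_def)
  show 1: "integrable lborel (\<lambda>x. indicator {x. \<bar>u x\<bar> > l} x * (u x)\<^sup>2)"
    using i by (rule Bochner_Integration.integrable_bound) (auto split: split_indicator)
  show "tailsq l u \<le> nsq lborel u"
    unfolding tailsq_def nsq_def using 1 i by (intro integral_mono) (auto split: split_indicator)
  show "tailsq l u \<ge> 0" unfolding tailsq_def by simp
qed

text \<open>Where \<open>u\<close> exceeds \<open>l\<close> in modulus and its average is at most
  \<open>l / 2\<close>, the error of averaging is at least half of the modulus of \<open>u\<close>;
  hence the factor 4.\<close>

lemma tailsq_le:
  fixes u :: "'a::euclidean_space \<Rightarrow> real"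
  assumes e: "e > 0" and u: "u \<in> H1" and b: "\<And>x. \<bar>bavg e u x\<bar> \<le> l / 2"
  shows "tailsq l u \<le> 4 * e\<^sup>2 * dirichlet u"
proof -
  have "tailsq l u \<le> (LINT x|lborel. 4 * (norm (u x - bavg e u x))\<^sup>2)"
    unfolding tailsq_def
  proof (rule integral_mono)
    show "integrable lborel (\<lambda>x. indicator {x. \<bar>u x\<bar> > l} x * (u x)\<^sup>2)"
      by (rule tailsq_integrable[OF H1_sqint[OF u]])
    show "integrable lborel (\<lambda>x. 4 * (norm (u x - bavg e u x))\<^sup>2)"
      using sqint_integrable[OF nsq_bavg_error(1)[OF e u]] by simp
    fix x
    show "indicator {x. \<bar>u x\<bar> > l} x * (u x)\<^sup>2 \<le> 4 * (norm (u x - bavg e u x))\<^sup>2"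
    proof (cases "\<bar>u x\<bar> > l")
      case True
      then have "\<bar>u x\<bar> \<le> 2 * \<bar>u x - bavg e u x\<bar>"
        using b[of x] abs_triangle_ineq2[of "u x" "bavg e u x"] by argo
      then have "\<bar>u x\<bar>\<^sup>2 \<le> (2 * \<bar>u x - bavg e u x\<bar>)\<^sup>2" by (intro power_mono) auto
      then show ?thesis using True by (simp add: power_mult_distrib)
    qed simp
  qed
  also have "\<dots> = 4 * nsq lborel (\<lambda>x. u x - bavg e u x)" by (simp add: nsq_def)
  also have "\<dots> \<le> 4 * (e\<^sup>2 * dirichlet u)" using nsq_bavg_error(2)[OF e u] by simp
  finally show ?thesis by simp
qed

text \<open>Averages over a ball are bounded by the mass over the volume, so for a suitable radius
  they are automatically at most \<open>l / 2\<close>. That radius decays like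
  \<open>l powr (- 2 / N)\<close>, and its square gives the rate.\<close>

lemma tailsq_decay:
  fixes m :: real
  assumes m: "m > 0"
  obtains C where "C > 0"
    "\<And>(u :: 'a::euclidean_space \<Rightarrow> real) l. u \<in> H1 \<Longrightarrow> nsq lborel u \<le> m \<Longrightarrow> l > 0 \<Longrightarrow>
       tailsq l u \<le> C * l powr (- (4 / real DIM('a))) * dirichlet u"
proof -
  define N where "N = real DIM('a)"
  define w where "w = unit_ball_vol N"
  have N: "N > 0" by (simp add: N_def)
  have w: "w > 0" by (simp add: w_def N_def)
  define C where "C = 4 * (4 * m / w) powr (2 / N)"
  have "C > 0" using m w by (simp add: C_def)
  moreover have "tailsq l u \<le> C * l powr (- (4 / N)) * dirichlet u"
    if u: "u \<in> H1" "nsq lborel u \<le> m" and l: "l > 0" for u :: "'a \<Rightarrow> real" and l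
  proof -
    \<comment> \<open>The radius for which the ball has volume \<open>4 * m / l^2\<close>.\<close>
    define e where "e = (4 * m / w / l\<^sup>2) powr (1 / N)"
    have e: "e > 0" using m w l by (simp add: e_def)
    have "e ^ DIM('a) = e powr N" using e by (simp add: powr_realpow N_def)
    also have "\<dots> = 4 * m / w / l\<^sup>2" unfolding e_def powr_powr using N m w l by simp
    finally have "e ^ DIM('a) = 4 * m / w / l\<^sup>2" .
    moreover have "measure lborel (ball (0::'a) e) = w * e ^ DIM('a)"
      using e by (simp add: content_ball w_def N_def)
    ultimately have V: "measure lborel (ball (0::'a) e) = 4 * m / l\<^sup>2" using w by simp
    have "\<bar>bavg e u x\<bar> \<le> l / 2" for x
    proof -
      have "(bavg e u x)\<^sup>2 \<le> m / (4 * m / l\<^sup>2)"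
        using bavg_sq_le[OF e H1_sqint[OF u(1)], of x] u(2) m l unfolding V
        by (smt (verit) divide_right_mono zero_le_divide_iff zero_le_power2)
      also have "\<dots> = (l / 2)\<^sup>2" using m by (simp add: power_divide)
      finally show ?thesis using l by (simp add: abs_le_square_iff[symmetric])
    qed
    then have "tailsq l u \<le> 4 * e\<^sup>2 * dirichlet u" by (rule tailsq_le[OF e u(1)])
    also have "4 * e\<^sup>2 = C * l powr (- (4 / N))"
    proof -
      have "e\<^sup>2 = e powr 2" using e by simp
      also have "\<dots> = (4 * m / w / l\<^sup>2) powr (2 / N)" unfolding e_def powr_powr by simp
      also have "\<dots> = (4 * m / w) powr (2 / N) / (l powr 2) powr (2 / N)"
      proof -
        have "l\<^sup>2 = l powr 2" using l by simp
        then show ?thesis by (simp only:) (subst powr_divide, use m w l in simp_all)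
      qed
      also have "(l powr 2) powr (2 / N) = l powr (4 / N)" by (simp add: powr_powr)
      finally show ?thesis by (simp add: C_def powr_minus divide_inverse)
    qed
    finally show ?thesis .
  qed
  ultimately show ?thesis using that unfolding N_def by blast
qed

text \<open>Picks the dyadic interval, with ends \<open>2 ^ k * K\<close> and
  \<open>2 ^ Suc k * K\<close>, that contains \<open>s\<close>.\<close>

lemma dyadic_bound:
  fixes s K p :: real
  assumes K: "K > 0" and p: "p > 2" and s: "s > K"
  shows "\<exists>k. 2 ^ k * K < s \<and> s powr p \<le> (2 ^ Suc k * K) powr (p - 2) * s\<^sup>2"
proof -
  obtain n where n: "s / K < 2 ^ n" using real_arch_pow[of 2 "s / K"] by auto
  define j where "j = (LEAST n. s \<le> 2 ^ n * K)"
  have "s \<le> 2 ^ n * K" using n K by (simp add: field_simps)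
  then have j: "s \<le> 2 ^ j * K" unfolding j_def by (rule LeastI)
  have "j \<noteq> 0" using j s by (cases j) auto
  then obtain k where k: "j = Suc k" by (cases j) auto
  have "\<not> s \<le> 2 ^ k * K" using not_less_Least[of k "\<lambda>n. s \<le> 2 ^ n * K"] k by (simp add: j_def)
  moreover have "s powr p \<le> (2 ^ Suc k * K) powr (p - 2) * s\<^sup>2"
  proof -
    have "s powr p = s powr (p - 2) * s powr 2" by (simp add: powr_add[symmetric])
    also have "s powr 2 = s\<^sup>2" using s K by simp
    also have "s powr (p - 2) * s\<^sup>2 \<le> (2 ^ Suc k * K) powr (p - 2) * s\<^sup>2"
      using j k s K p by (intro mult_right_mono powr_mono2) auto
    finally show ?thesis .
  qed
  ultimately show ?thesis by (intro exI[of _ k]) auto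
qed

text \<open>A Gagliardo--Nirenberg type inequality, from summing \<open>tailsq\<close> over dyadic levels.\<close>
lemma power_integral_bound:
  fixes m p :: real
  assumes m: "m > 0" and p: "2 < p" "p < 2 + 4 / real DIM('a)"
  obtains C where "C > 0"
    "\<And>u :: 'a::euclidean_space \<Rightarrow> real. u \<in> H1 \<Longrightarrow> nsq lborel u \<le> m \<Longrightarrow> integrable lborel (\<lambda>x. \<bar>u x\<bar> powr
        p)"
    "\<And>(u :: 'a \<Rightarrow> real) l K. u \<in> H1 \<Longrightarrow> nsq lborel u \<le> m \<Longrightarrow> l > 0 \<Longrightarrow> K > 0 \<Longrightarrow>
       (LINT x|lborel. \<bar>u x\<bar> powr p) \<le> l powr (p - 2) * nsq lborel u + K powr (p - 2) * tailsq l u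
          + C * K powr (- (2 + 4 / real DIM('a) - p)) * dirichlet u"
proof -
  define N where "N = real DIM('a)"
  define t where "t = 2 + 4 / N - p"
  have t: "t > 0" using p by (simp add: t_def N_def)
  obtain C0 where C0: "C0 > 0" "\<And>(u :: 'a \<Rightarrow> real) l. u \<in> H1 \<Longrightarrow> nsq lborel u \<le> m \<Longrightarrow> l > 0 \<Longrightarrow>
       tailsq l u \<le> C0 * l powr (- (4 / N)) * dirichlet u"
    using tailsq_decay[OF m, where 'a='a] unfolding N_def by metis
  \<comment> \<open>The ratio of the dyadic series: level \<open>k\<close> contributes
    \<open>(2^k K) powr (p - 2)\<close> times the decay \<open>(2^k K) powr (- 4 / N)\<close>, that
    is \<open>(2^k K) powr (- t)\<close>. It is below 1 exactly because \<open>p\<close> is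
    subcritical.\<close>
  define r where "r = 2 powr (- t)"
  have r: "0 < r" "r < 1" using t by (auto simp: r_def powr_less_one)
  define C where "C = C0 * 2 powr (p - 2) / (1 - r)"
  have C: "C > 0" using C0 r by (simp add: C_def)
  have tail: "(\<integral>\<^sup>+x. ennreal (indicator {x. \<bar>u x\<bar> > K} x * \<bar>u x\<bar> powr p) \<partial>lborel)
      \<le> ennreal (C * K powr (- t) * dirichlet u)"
    if u: "u \<in> H1" "nsq lborel u \<le> m" and K: "K > 0" for u :: "'a \<Rightarrow> real" and K
  proof -
    have [measurable]: "u \<in> borel_measurable borel" using H1_sqint[OF u(1)] by (simp add: sqint_def)
    define a where "a k = (2 ^ Suc k * K) powr (p - 2)" for k :: nat
    have a0: "a k \<ge> 0" for k by (simp add: a_def)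
    define f where "f k x = a k * (indicator {x. \<bar>u x\<bar> > 2 ^ k * K} x * (u x)\<^sup>2)" for k x
    have f0: "f k x \<ge> 0" for k x unfolding f_def using a0 by simp
    have [measurable]: "f k \<in> borel_measurable borel" for k unfolding f_def by measurable
    have int: "integrable lborel (f k)" for k
      unfolding f_def using tailsq_integrable(1)[OF H1_sqint[OF u(1)]] by simp
    have fi: "(\<integral>\<^sup>+x. ennreal (f k x) \<partial>lborel) \<le> ennreal (C0 * 2 powr (p - 2) * K powr (- t) *
        dirichlet u * r ^ k)" for k
    proof -
      have "(\<integral>\<^sup>+x. ennreal (f k x) \<partial>lborel) = ennreal (LINT x|lborel. f k x)"
        using int f0 by (intro nn_integral_eq_integral) auto
      also have "(LINT x|lborel. f k x) = a k * tailsq (2 ^ k * K) u"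
        by (simp add: f_def tailsq_def)
      also have "\<dots> \<le> a k * (C0 * (2 ^ k * K) powr (- (4 / N)) * dirichlet u)"
        using K by (intro mult_left_mono C0 u a0) auto
      also have "\<dots> = C0 * dirichlet u * ((2 ^ Suc k * K) powr (p - 2) * (2 ^ k * K) powr (- (4 /
          N)))"
        by (simp add: a_def)
      also have "(2 ^ Suc k * K) powr (p - 2) * (2 ^ k * K) powr (- (4 / N))
          = 2 powr (p - 2) * ((2 ^ k * K) powr (p - 2) * (2 ^ k * K) powr (- (4 / N)))"
        using K by (simp add: powr_mult)
      also have "(2 ^ k * K) powr (p - 2) * (2 ^ k * K) powr (- (4 / N)) = (2 ^ k * K) powr (- t)"
        unfolding t_def powr_add[symmetric] by (simp add: algebra_simps)
      also have "\<dots> = r ^ k * K powr (- t)"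
        using K by (simp add: powr_mult r_def powr_power powr_powr powr_realpow[symmetric]
            mult.commute)
      finally show ?thesis by (simp add: mult_ac ennreal_leI)
    qed
    have "(\<integral>\<^sup>+x. ennreal (indicator {x. \<bar>u x\<bar> > K} x * \<bar>u x\<bar> powr p) \<partial>lborel)
        \<le> (\<integral>\<^sup>+x. (\<Sum>k. ennreal (f k x)) \<partial>lborel)"
    proof (rule nn_integral_mono)
      fix x
      show "ennreal (indicator {x. \<bar>u x\<bar> > K} x * \<bar>u x\<bar> powr p) \<le> (\<Sum>k. ennreal (f k x))"
      proof (cases "\<bar>u x\<bar> > K")
        case True
        then obtain k where k: "2 ^ k * K < \<bar>u x\<bar>" "\<bar>u x\<bar> powr p \<le> (2 ^ Suc k * K) powr (p
            - 2) * \<bar>u x\<bar>\<^sup>2"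
          using dyadic_bound[OF K p(1)] by blast
        then have "ennreal (indicator {x. \<bar>u x\<bar> > K} x * \<bar>u x\<bar> powr p) \<le> ennreal (f k x)"
          using True by (intro ennreal_leI) (simp add: f_def a_def)
        also have "\<dots> \<le> (\<Sum>k. ennreal (f k x))"
          using sum_le_suminf[of "\<lambda>k. ennreal (f k x)" "{k}"] by simp
        finally show ?thesis .
      qed simp
    qed
    also have "\<dots> = (\<Sum>k. \<integral>\<^sup>+x. ennreal (f k x) \<partial>lborel)" by (intro nn_integral_suminf) measurable
    also have "\<dots> \<le> (\<Sum>k. ennreal (C0 * 2 powr (p - 2) * K powr (- t) * dirichlet u * r ^ k))"
      by (intro suminf_le fi) auto
    also have "\<dots> = ennreal (\<Sum>k. C0 * 2 powr (p - 2) * K powr (- t) * dirichlet u * r ^ k)"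
      using r C0 by (intro suminf_ennreal2) (auto simp: dirichlet_nonneg intro!: summable_mult
          summable_geometric mult_nonneg_nonneg)
    also have "(\<Sum>k. C0 * 2 powr (p - 2) * K powr (- t) * dirichlet u * r ^ k)
        = C * K powr (- t) * dirichlet u"
      using r by (subst suminf_mult) (auto simp: suminf_geometric C_def intro!: summable_geometric)
    finally show ?thesis .
  qed
  have main: "integrable lborel (\<lambda>x. \<bar>u x\<bar> powr p)"
     "(LINT x|lborel. \<bar>u x\<bar> powr p) \<le> l powr (p - 2) * nsq lborel u + K powr (p - 2) * tailsq l u
         + C * K powr (- t) * dirichlet u"
    if u: "u \<in> H1" "nsq lborel u \<le> m" and K: "K > 0" and l: "l > 0" for u :: "'a \<Rightarrow> real" and K l
  proof -
    note s = H1_sqint[OF u(1)]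
    have [measurable]: "u \<in> borel_measurable borel" using s by (simp add: sqint_def)
    define f1 where "f1 x = indicator {x. \<bar>u x\<bar> > K} x * \<bar>u x\<bar> powr p" for x
    have [measurable]: "f1 \<in> borel_measurable borel" unfolding f1_def by measurable
    have f10: "f1 x \<ge> 0" for x by (simp add: f1_def)
    have t1: "(\<integral>\<^sup>+x. ennreal (f1 x) \<partial>lborel) \<le> ennreal (C * K powr (- t) * dirichlet u)"
      unfolding f1_def by (rule tail[OF u K])
    have i1: "integrable lborel f1"
      using t1 f10 by (intro integrableI_bounded) (auto simp: order_le_less_trans[OF _
          ennreal_less_top])
    have I1: "(LINT x|lborel. f1 x) \<le> C * K powr (- t) * dirichlet u"
      using t1 nn_integral_eq_integral[OF i1] f10 C by (simp add: dirichlet_nonneg)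
    have iu: "integrable lborel (\<lambda>x. (u x)\<^sup>2)" using sqint_integrable[OF s] by simp
    note it = tailsq_integrable(1)[OF s, of l]
    \<comment> \<open>One summand for each range of the modulus: up to \<open>l\<close>, between
      \<open>l\<close> and \<open>K\<close>, and above \<open>K\<close>. For small \<open>l\<close>
      the first is controlled by the mass, for large \<open>K\<close> the last by the gradient; only
      the middle one sees concentration.\<close>
    define g where "g x = l powr (p - 2) * (u x)\<^sup>2 + K powr (p - 2) * (indicator {x. \<bar>u x\<bar>
        > l} x * (u x)\<^sup>2) + f1 x" for x
    have ig: "integrable lborel g" unfolding g_def using iu it i1 by simp
    have pt: "\<bar>u x\<bar> powr p \<le> g x" for x
    proof -
      have *: "\<bar>u x\<bar> powr p \<le> M powr (p - 2) * (u x)\<^sup>2" if "\<bar>u x\<bar> \<le> M" for M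
      proof (cases "u x = 0")
        case False
        have "\<bar>u x\<bar> powr p = \<bar>u x\<bar> powr (p - 2) * \<bar>u x\<bar> powr 2"
          by (simp only: powr_add[symmetric]) simp
        also have "\<bar>u x\<bar> powr 2 = (u x)\<^sup>2" using False by simp
        also have "\<bar>u x\<bar> powr (p - 2) * (u x)\<^sup>2 \<le> M powr (p - 2) * (u x)\<^sup>2"
          using that p by (intro mult_right_mono powr_mono2) auto
        finally show ?thesis .
      qed (use p in simp)
      consider "\<bar>u x\<bar> \<le> l" | "l < \<bar>u x\<bar>" "\<bar>u x\<bar> \<le> K" | "\<bar>u x\<bar> > K" by linarith
      then show ?thesis
      proof cases
        case 1
        have "0 \<le> K powr (p - 2) * (indicator {x. \<bar>u x\<bar> > l} x * (u x)\<^sup>2) + f1 x" using f10[of x]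
          by simp
        then show ?thesis using *[OF 1] unfolding g_def by linarith
      next
        case 2
        have "0 \<le> l powr (p - 2) * (u x)\<^sup>2 + f1 x" using f10[of x] by simp
        then show ?thesis using *[OF 2(2)] 2(1) unfolding g_def by simp
      next
        case 3
        then show ?thesis unfolding g_def f1_def by simp
      qed
    qed
    show i: "integrable lborel (\<lambda>x. \<bar>u x\<bar> powr p)"
    proof (rule Bochner_Integration.integrable_bound[OF ig])
      show "AE x in lborel. norm (\<bar>u x\<bar> powr p) \<le> norm (g x)"
        by (intro AE_I2) (use pt order_trans[OF pt abs_ge_self] in simp)
    qed measurable
    have "(LINT x|lborel. \<bar>u x\<bar> powr p) \<le> (LINT x|lborel. g x)" by (rule integral_mono[OF i ig pt])
    also have "\<dots> = l powr (p - 2) * nsq lborel u + K powr (p - 2) * tailsq l u + (LINT x|lborel. f1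
        x)"
      unfolding g_def using iu it i1 by (simp add: nsq_def tailsq_def)
    finally show "(LINT x|lborel. \<bar>u x\<bar> powr p) \<le> l powr (p - 2) * nsq lborel u + K powr (p
        - 2) * tailsq l u + C * K powr (- t) * dirichlet u"
      using I1 by linarith
  qed
  show ?thesis
  proof (rule that[OF C])
    show "integrable lborel (\<lambda>x. \<bar>u x\<bar> powr p)" if "u \<in> H1" "nsq lborel u \<le> m" for u :: "'a \<Rightarrow> real"
      by (rule main(1)[OF that, of 1 1]) auto
    show "(LINT x|lborel. \<bar>u x\<bar> powr p) \<le> l powr (p - 2) * nsq lborel u + K powr (p - 2) * tailsq l
        u
          + C * K powr (- (2 + 4 / real DIM('a) - p)) * dirichlet u"
      if "u \<in> H1" "nsq lborel u \<le> m" "l > 0" "K > 0" for u :: "'a \<Rightarrow> real" and l K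
      using main(2)[OF that(1,2,4,3)] unfolding t_def N_def .
  qed
qed

lemma tendsto_powr_neg_at_top: "t > 0 \<Longrightarrow> ((\<lambda>K::real. C * K powr (- t)) \<longlongrightarrow> 0) at_top"
  using tendsto_mult_right_zero[OF tendsto_neg_powr[OF _ filterlim_ident], of "-t" C] by simp

text \<open>Choose \<open>l\<close> small and \<open>K\<close> large so that the low and the high
  values contribute at most \<open>d / 4\<close> each. If all averages at scale \<open>e\<close>
  were at most \<open>l / 2\<close>, the middle range would also contribute at most
  \<open>d / 4\<close>, and the total would stay below \<open>d\<close>. The constants depend only
  on the bounds, not on \<open>u\<close>.\<close>

lemma nonvanishing:
  fixes m G p d :: real
  assumes m: "m > 0" and G: "G \<ge> 0" and d: "d > 0" and p: "2 < p" "p < 2 + 4 / real DIM('a)"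
  obtains e k where "e > 0" "k > 0"
    "\<And>u :: 'a::euclidean_space \<Rightarrow> real. u \<in> H1 \<Longrightarrow> nsq lborel u \<le> m \<Longrightarrow> dirichlet u \<le> G \<Longrightarrow>
       (LINT x|lborel. \<bar>u x\<bar> powr p) \<ge> d \<Longrightarrow> \<exists>x. \<bar>bavg e u x\<bar> > k"
proof -
  define t where "t = 2 + 4 / real DIM('a) - p"
  have t: "t > 0" using p by (simp add: t_def)
  obtain C where C: "C > 0" "\<And>(u :: 'a \<Rightarrow> real) l K. u \<in> H1 \<Longrightarrow> nsq lborel u \<le> m \<Longrightarrow> l > 0 \<Longrightarrow> K > 0 \<Longrightarrow>
       (LINT x|lborel. \<bar>u x\<bar> powr p) \<le> l powr (p - 2) * nsq lborel u + K powr (p - 2) * tailsq l u +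
           C * K powr (- t) * dirichlet u"
    using power_integral_bound[OF m p] unfolding t_def by metis
  define l where "l = (d / (4 * m)) powr (1 / (p - 2))"
  have l: "l > 0" "l powr (p - 2) = d / (4 * m)" using d m p by (auto simp: l_def powr_powr)
  have "\<forall>\<^sub>F K in at_top. (C * G) * K powr (- t) < d / 4"
    by (rule order_tendstoD(2)[OF tendsto_powr_neg_at_top[OF t]]) (use d in simp)
  moreover have "\<forall>\<^sub>F K in at_top. K > (0::real)" by (rule eventually_gt_at_top)
  ultimately obtain K where K: "(C * G) * K powr (- t) < d / 4" "K > 0"
    using eventually_conj eventually_happens' trivial_limit_at_top_linorder
      by (metis (mono_tags, lifting))
  \<comment> \<open>Solves \<open>K powr (p - 2) * (4 * e^2 * (G + 1)) = d / 4\<close>;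
    \<open>G + 1\<close> keeps the divisor positive when \<open>G = 0\<close>.\<close>
  define e where "e = sqrt (d / (4 * (4 * K powr (p - 2) * (G + 1))))"
  have pos: "4 * (4 * K powr (p - 2) * (G + 1)) > 0" using K G by simp
  have e: "e > 0" "e\<^sup>2 = d / (4 * (4 * K powr (p - 2) * (G + 1)))" using d pos by (auto simp: e_def)
  have "\<exists>x. \<bar>bavg e u x\<bar> > l / 2"
    if u: "u \<in> H1" "nsq lborel u \<le> m" "dirichlet u \<le> G" "(LINT x|lborel. \<bar>u x\<bar> powr p) \<ge> d"
        for u :: "'a \<Rightarrow> real"
  proof (rule ccontr)
    assume "\<not> ?thesis"
    then have "\<bar>bavg e u x\<bar> \<le> l / 2" for x by (simp add: not_less)
    then have "tailsq l u \<le> 4 * e\<^sup>2 * dirichlet u" by (rule tailsq_le[OF e(1) u(1)])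
    also have "\<dots> \<le> 4 * e\<^sup>2 * (G + 1)" using u(3) by (intro mult_left_mono) auto
    finally have "K powr (p - 2) * tailsq l u \<le> K powr (p - 2) * (4 * e\<^sup>2 * (G + 1))"
      by (intro mult_left_mono) auto
    also have "\<dots> = d / 4"
    proof -
      have "a * (4 * (d / (4 * (4 * a * b))) * b) = d / 4" if "a \<noteq> 0" "b \<noteq> 0" for a b :: real
        using that by (simp add: field_simps)
      then show ?thesis unfolding e(2) using K G by simp
    qed
    finally have 1: "K powr (p - 2) * tailsq l u \<le> d / 4" .
    have "l powr (p - 2) * nsq lborel u \<le> d / (4 * m) * m"
      unfolding l(2) using u(2) d m by (intro mult_left_mono) auto
    then have 2: "l powr (p - 2) * nsq lborel u \<le> d / 4" using m by simp
    have "C * K powr (- t) * dirichlet u \<le> C * K powr (- t) * G" using C u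
      by (intro mult_left_mono) auto
    then have 3: "C * K powr (- t) * dirichlet u < d / 4" using K by (simp add: mult_ac)
    show False using C(2)[OF u(1,2) l(1) K(2)] 1 2 3 u(4) d by linarith
  qed
  then show ?thesis using that[of e "l/2"] e l by auto
qed

section \<open>Compactness\<close>

text \<open>Dominated convergence with a defect that is small only in the mean, as in the proof of
  the Brezis-Lieb lemma. The positive part of \<open>X n - e * Y n\<close> is dominated by
  \<open>Z\<close> and tends to 0, while \<open>e * Y n\<close> has integral at most
  \<open>e * B\<close>.\<close>

lemma eventually_integral_le:
  fixes X Y :: "nat \<Rightarrow> 'm \<Rightarrow> real"
  assumes X: "\<And>n. integrable M (X n)" "AE x in M. (\<lambda>n. X n x) \<longlonglongrightarrow> 0"
    and Y: "\<And>n. integrable M (Y n)" "\<And>n x. Y n x \<ge> 0" "\<And>n. (LINT x|M. Y n x) \<le> B"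
    and dom: "\<And>e. e > 0 \<Longrightarrow> \<exists>Z. integrable M Z \<and> (\<forall>x. Z x \<ge> 0) \<and> (\<forall>n x. X n x \<le> e * Y n x + Z x)"
    and d: "d > 0"
  shows "\<forall>\<^sub>F n in sequentially. (LINT x|M. X n x) \<le> d"
proof -
  have [measurable]: "X n \<in> borel_measurable M" "Y n \<in> borel_measurable M" for n using X Y by auto
  have B: "B \<ge> 0" using Y(3)[of 0] Bochner_Integration.integral_nonneg[of M "Y 0"] Y(2)
    by (meson order_trans)
  define e where "e = d / (2 * (B + 1))"
  have e: "e > 0" using B d by (simp add: e_def)
  obtain Z where Z: "integrable M Z" "\<And>x. Z x \<ge> 0" "\<And>n x. X n x \<le> e * Y n x + Z x" using dom[OF e]
    by blast
  define P where "P n x = max 0 (X n x - e * Y n x)" for n x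
  have [measurable]: "P n \<in> borel_measurable M" for n unfolding P_def by measurable
  have PZ: "norm (P n x) \<le> Z x" for n x using Z(2)[of x] Z(3)[of n x] by (auto simp: P_def)
  have iP: "integrable M (P n)" for n
    by (rule Bochner_Integration.integrable_bound[OF Z(1)]) (use PZ order_trans[OF PZ abs_ge_self]
        in auto)
  have "(\<lambda>n. LINT x|M. P n x) \<longlonglongrightarrow> (LINT x|M. 0)"
  proof (rule integral_dominated_convergence[OF _ _ Z(1)])
    show "AE x in M. (\<lambda>n. P n x) \<longlonglongrightarrow> 0"
      using X(2)
    proof eventually_elim
      case (elim x)
      have "(\<lambda>n. \<bar>X n x\<bar>) \<longlonglongrightarrow> 0" using tendsto_rabs[OF elim] by simp
      then show ?case
      proof (rule Lim_null_comparison[rotated])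
        show "\<forall>\<^sub>F n in sequentially. norm (P n x) \<le> \<bar>X n x\<bar>"
        proof (intro always_eventually allI)
          fix n
          have "0 \<le> e * Y n x" using Y(2)[of n x] e by simp
          then show "norm (P n x) \<le> \<bar>X n x\<bar>" unfolding P_def real_norm_def by linarith
        qed
      qed
    qed
  qed (use PZ in auto)
  then have "\<forall>\<^sub>F n in sequentially. (LINT x|M. P n x) < d / 2"
    using d by (intro order_tendstoD(2)[where y="LINT x|M. 0"]) auto
  then show ?thesis
  proof eventually_elim
    case (elim n)
    have "(LINT x|M. X n x) \<le> (LINT x|M. P n x + e * Y n x)"
      using X iP Y by (intro integral_mono) (auto simp: P_def)
    also have "\<dots> = (LINT x|M. P n x) + e * (LINT x|M. Y n x)" using iP Y by simp
    also have "e * (LINT x|M. Y n x) \<le> e * B" using e Y by (intro mult_left_mono) auto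
    also have "e * B \<le> d / 2" using B d by (simp add: e_def field_simps)
    finally show ?case using elim by linarith
  qed
qed

text \<open>Young's inequality bounds the product by \<open>e * f^2 + g^2 / e\<close>, a domination
  with a defect bounded in the mean.\<close>

lemma tendsto_ip_of_AE:
  fixes f :: "nat \<Rightarrow> 'm \<Rightarrow> real"
  assumes f: "\<And>n. sqint M (f n)" "\<And>n. nsq M (f n) \<le> B" and g: "sqint M g"
    and lim: "AE x in M. (\<lambda>n. f n x) \<longlonglongrightarrow> g x"
  shows "(\<lambda>n. ip M (f n) g) \<longlonglongrightarrow> nsq M g"
proof (rule LIMSEQ_I)
  fix d :: real assume d: "d > 0"
  have "\<forall>\<^sub>F n in sequentially. (LINT x|M. \<bar>f n x * g x - g x * g x\<bar>) \<le> d / 2"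
  proof (rule eventually_integral_le)
    show "integrable M (\<lambda>x. \<bar>f n x * g x - g x * g x\<bar>)" for n
      using integrable_mult_sqint[OF f(1) g] integrable_mult_sqint[OF g g] by simp
    show "AE x in M. (\<lambda>n. \<bar>f n x * g x - g x * g x\<bar>) \<longlonglongrightarrow> 0"
      using lim
    proof eventually_elim
      case (elim x)
      have "(\<lambda>n. \<bar>f n x * g x - g x * g x\<bar>) \<longlonglongrightarrow> \<bar>g x * g x - g x * g x\<bar>"
        by (intro tendsto_intros elim)
      then show ?case by simp
    qed
    show "integrable M (\<lambda>x. (norm (f n x))\<^sup>2)" "(LINT x|M. (norm (f n x))\<^sup>2) \<le> B" for n
      using f by (auto simp: sqint_def nsq_def)
    show "\<exists>Z. integrable M Z \<and> (\<forall>x. 0 \<le> Z x) \<and> (\<forall>n x. \<bar>f n x * g x - g x * g x\<bar>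
        \<le> e * (norm (f n x))\<^sup>2 + Z x)"
      if e: "e > 0" for e
    proof (intro exI conjI allI)
      show "integrable M (\<lambda>x. (1 / e + 1) * (norm (g x))\<^sup>2)" using g by (simp add: sqint_def)
      show "0 \<le> (1 / e + 1) * (norm (g x))\<^sup>2" for x using e by simp
      fix n x
      have "0 \<le> (sqrt e * \<bar>f n x\<bar> - \<bar>g x\<bar> / sqrt e)\<^sup>2" by simp
      also have "\<dots> = e * (f n x)\<^sup>2 + (g x)\<^sup>2 / e - 2 * (\<bar>f n x\<bar> * \<bar>g x\<bar>)"
        using e by (simp add: power2_diff power_mult_distrib power_divide)
      finally have "\<bar>f n x * g x\<bar> \<le> e * (f n x)\<^sup>2 + (g x)\<^sup>2 / e"
        using abs_ge_zero[of "f n x * g x"] unfolding abs_mult by linarith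
      moreover have "\<bar>f n x * g x - g x * g x\<bar> \<le> \<bar>f n x * g x\<bar> + (g x)\<^sup>2"
        using abs_triangle_ineq4[of "f n x * g x" "g x * g x"]
          by (simp add: power2_eq_square abs_mult)
      ultimately show "\<bar>f n x * g x - g x * g x\<bar> \<le> e * (norm (f n x))\<^sup>2 + (1 / e + 1) * (norm (g
          x))\<^sup>2"
        by (simp add: distrib_right)
    qed
  qed (use d in auto)
  then obtain N where N: "\<And>n. n \<ge> N \<Longrightarrow> (LINT x|M. \<bar>f n x * g x - g x * g x\<bar>) \<le> d / 2"
    by (auto simp: eventually_sequentially)
  have "norm (ip M (f n) g - nsq M g) < d" if "n \<ge> N" for n
  proof -
    have "ip M (f n) g - nsq M g = (LINT x|M. f n x * g x - g x * g x)"
      using integrable_mult_sqint[OF f(1) g] integrable_mult_sqint[OF g g]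
      by (simp add: ip_self[symmetric]) (simp add: ip_def)
    also have "norm \<dots> \<le> (LINT x|M. norm (f n x * g x - g x * g x))" by (rule integral_norm_bound)
    finally show ?thesis using N[OF that] d by simp
  qed
  then show "\<exists>N. \<forall>n\<ge>N. norm (ip M (f n) g - nsq M g) < d" by blast
qed

section \<open>Extraction of subsequences and compactness\<close>

lemma diagonal_convergent:
  fixes a :: "nat \<Rightarrow> nat \<Rightarrow> real"
  assumes "\<And>k. Bseq (a k)"
  obtains r where "strict_mono r" "\<And>k. convergent (\<lambda>n. a k (r n))"
proof -
  interpret subseqs "\<lambda>k s. convergent (\<lambda>n. a k (s n))"
  proof
    fix k and s :: "nat \<Rightarrow> nat"
    have "bounded (range (\<lambda>n. a k (s n)))"
      using assms[of k] by (auto simp: Bseq_eq_bounded intro: bounded_subset)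
    then obtain l t where "strict_mono t" "((\<lambda>n. a k (s n)) \<circ> t) \<longlonglongrightarrow> l"
      using bounded_imp_convergent_subsequence by blast
    then show "\<exists>r'. strict_mono r' \<and> convergent (\<lambda>n. a k ((s \<circ> r') n))"
      by (auto simp: convergent_def o_def)
  qed
  have "convergent (\<lambda>n. a k (diagseq n))" for k
  proof -
    have "convergent (\<lambda>n. a k ((diagseq \<circ> (+) (Suc k)) n))"
    proof (rule diagseq_holds)
      fix r s :: "nat \<Rightarrow> nat" and j assume "strict_mono r" "convergent (\<lambda>n. a j (s n))"
      then show "convergent (\<lambda>n. a j ((s \<circ> r) n))"
        using convergent_subseq_convergent[of "\<lambda>n. a j (s n)" r] by (simp add: o_def)
    qed
    then show ?thesis
      using convergent_ignore_initial_segment[of "\<lambda>n. a k (diagseq n)" "Suc k"]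
        by (simp add: add.commute)
  qed
  with subseq_diagseq that show ?thesis by blast
qed

lemma eventually_subseq_choice:
  assumes "\<And>k. eventually (P k) sequentially"
  obtains s :: "nat \<Rightarrow> nat" where "strict_mono s" "\<And>k. P k (s k)"
proof -
  have ex: "\<exists>y. P k y \<and> x < y" for k x
  proof -
    have "\<forall>\<^sub>F y in sequentially. P k y \<and> x < y"
      using assms eventually_gt_at_top by (rule eventually_conj)
    then show ?thesis using eventually_happens'[OF sequentially_bot] by blast
  qed
  have "\<exists>f. \<forall>n. P n (f n) \<and> f n < f (Suc n)"
    by (rule dependent_nat_choice) (use ex in blast)+
  then show ?thesis using that by (auto simp: strict_mono_Suc_iff)
qed

text \<open>Lets a function and its gradient be treated as one vector field, so that a single weak
  limit provides both and keeps their relation.\<close>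

lemma sqint_Pair:
  assumes u: "sqint M u" and g: "sqint M g"
  shows "sqint M (\<lambda>x. (u x, g x))" "nsq M (\<lambda>x. (u x, g x)) = nsq M u + nsq M g"
proof -
  have [measurable]: "u \<in> borel_measurable M" "g \<in> borel_measurable M" using u g
    by (auto simp: sqint_def)
  have eq: "(norm (u x, g x))\<^sup>2 = (norm (u x))\<^sup>2 + (norm (g x))\<^sup>2" for x by (simp add: norm_Pair)
  have "(\<lambda>x. (u x, g x)) \<in> borel_measurable M" by measurable
  then show "sqint M (\<lambda>x. (u x, g x))" unfolding sqint_def eq using u g by (auto simp: sqint_def)
  show "nsq M (\<lambda>x. (u x, g x)) = nsq M u + nsq M g" unfolding nsq_def eq using u g
    by (auto simp: sqint_def)
qed

lemma sqint_fst_snd: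
  fixes G :: "'m \<Rightarrow> 'b::euclidean_space \<times> 'c::euclidean_space"
  assumes G: "sqint M G"
  shows "sqint M (\<lambda>x. fst (G x))" "sqint M (\<lambda>x. snd (G x))"
proof -
  have [measurable]: "G \<in> borel_measurable M" using G by (simp add: sqint_def)
  have i: "integrable M (\<lambda>x. (norm (G x))\<^sup>2)" using G by (simp add: sqint_def)
  have m1: "(\<lambda>x. fst (G x)) \<in> borel_measurable M"
    by (rule borel_measurable_continuous_on[OF _ \<open>G \<in> _\<close>]) (intro continuous_intros)
  have m2: "(\<lambda>x. snd (G x)) \<in> borel_measurable M"
    by (rule borel_measurable_continuous_on[OF _ \<open>G \<in> _\<close>]) (intro continuous_intros)
  have "integrable M (\<lambda>x. (norm (fst (G x)))\<^sup>2)"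
  proof (rule Bochner_Integration.integrable_bound[OF i])
    have "norm (fst (G x)) \<le> norm (G x)" for x using norm_fst_le[of "fst (G x)" "snd (G x)"] by simp
    then show "AE x in M. norm ((norm (fst (G x)))\<^sup>2) \<le> norm ((norm (G x))\<^sup>2)"
      by (auto intro!: power_mono)
  qed (use m1 in measurable)
  then show "sqint M (\<lambda>x. fst (G x))" using m1 by (simp add: sqint_def)
  have "integrable M (\<lambda>x. (norm (snd (G x)))\<^sup>2)"
  proof (rule Bochner_Integration.integrable_bound[OF i])
    have "norm (snd (G x)) \<le> norm (G x)" for x using norm_snd_le[of "snd (G x)" "fst (G x)"] by simp
    then show "AE x in M. norm ((norm (snd (G x)))\<^sup>2) \<le> norm ((norm (G x))\<^sup>2)"
      by (auto intro!: power_mono)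
  qed (use m2 in measurable)
  then show "sqint M (\<lambda>x. snd (G x))" using m2 by (simp add: sqint_def)
qed

text \<open>At a fixed scale the averages tend to 0 pointwise and are uniformly bounded by the mass,
  so their squares tend to 0 in the mean on the ball. The error of averaging is small uniformly in
  \<open>n\<close>.\<close>

lemma local_sq_tendsto_0:
  fixes z :: "nat \<Rightarrow> 'a::euclidean_space \<Rightarrow> real"
  assumes z: "\<And>n. z n \<in> H1" "\<And>n. nsq lborel (z n) \<le> m" "\<And>n. dirichlet (z n) \<le> G"
    and lim: "\<And>i x. (\<lambda>n. bavg (1 / real (Suc i)) (z n) x) \<longlonglongrightarrow> 0" and d: "d > 0"
  shows "\<forall>\<^sub>F n in sequentially. (LINT x|lborel. indicator (ball 0 R) x * (z n x)\<^sup>2) < d"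
proof -
  have G: "G \<ge> 0" using z(3)[of 0] dirichlet_nonneg[of "z 0"] by linarith
  \<comment> \<open>A scale with \<open>e^2 * G < d / 4\<close>, so the error of averaging costs
    less than \<open>d / 2\<close>; \<open>e \<le> 1\<close> serves to replace \<open>e^2\<close> by
    \<open>e\<close>.\<close>
  obtain i where i: "1 / real (Suc i) < min 1 (d / (4 * (G + 1)))"
    using G d by (metis nat_approx_posE min_less_iff_conj divide_pos_pos zero_less_one
        add_nonneg_pos mult_pos_pos zero_less_numeral)
  define e where "e = 1 / real (Suc i)"
  have e: "e > 0" by (simp add: e_def)
  have e1: "e \<le> 1" "e < d / (4 * (G + 1))" using i by (auto simp: e_def)
  have "e\<^sup>2 * G \<le> e * G" using e e1(1) G by (intro mult_right_mono) (auto simp: power2_eq_square)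
  also have "\<dots> \<le> e * (G + 1)" using e by simp
  also have "\<dots> < d / 4" using e1(2) G by (simp add: field_simps)
  finally have eG: "e\<^sup>2 * G < d / 4" .
  define V where "V = measure lborel (ball (0::'a) e)"
  have V: "V > 0" unfolding V_def using e by (rule content_ball_pos)
  have [measurable]: "z n \<in> borel_measurable borel" "bavg e (z n) \<in> borel_measurable borel" for n
    using H1_sqint[OF z(1)] bavg_measurable[OF e H1_sqint[OF z(1)]] by (auto simp: sqint_def)
  have [measurable]: "ball (0::'a) R \<in> sets borel" by simp
  have ind: "integrable lborel (indicator (ball (0::'a) R) :: 'a \<Rightarrow> real)"
    using emeasure_bounded_finite[OF bounded_ball, of "0::'a" R] by (simp add: less_top)
  have bd: "norm (indicator (ball 0 R) x * (bavg e (z n) x)\<^sup>2) \<le> indicator (ball 0 R) x * (m / V)"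
      for n x
  proof -
    have "(bavg e (z n) x)\<^sup>2 \<le> m / V"
      using bavg_sq_le[OF e H1_sqint[OF z(1)], of n x] z(2)[of n] V unfolding V_def[symmetric]
      by (meson divide_right_mono less_imp_le order_trans)
    then show ?thesis by (auto split: split_indicator)
  qed
  have iV: "integrable lborel (\<lambda>x::'a. indicator (ball 0 R) x * (m / V))" using ind by simp
  have ib: "integrable lborel (\<lambda>x. indicator (ball 0 R) x * (bavg e (z n) x)\<^sup>2)" for n
  proof (rule Bochner_Integration.integrable_bound[OF iV])
    show "AE x in lborel. norm (indicator (ball 0 R) x * (bavg e (z n) x)\<^sup>2)
        \<le> norm (indicator (ball 0 R) x * (m / V))"
      using order_trans[OF bd abs_ge_self] by simp
  qed measurable
  have "(\<lambda>n. LINT x|lborel. indicator (ball 0 R) x * (bavg e (z n) x)\<^sup>2)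
      \<longlonglongrightarrow> (LINT x::'a|lborel. (0::real))"
  proof (rule integral_dominated_convergence[OF _ _ iV])
    show "AE x in lborel. (\<lambda>n. indicator (ball 0 R) x * (bavg e (z n) x)\<^sup>2) \<longlonglongrightarrow> 0"
    proof (rule AE_I2)
      fix x
      have "(\<lambda>n. indicator (ball 0 R) x * (bavg e (z n) x)\<^sup>2) \<longlonglongrightarrow> indicator (ball 0 R) x * 0\<^sup>2"
        by (intro tendsto_intros lim[of i x, folded e_def])
      then show "(\<lambda>n. indicator (ball 0 R) x * (bavg e (z n) x)\<^sup>2) \<longlonglongrightarrow> 0" by simp
    qed
  qed (use bd in auto)
  then have "\<forall>\<^sub>F n in sequentially. (LINT x|lborel. indicator (ball 0 R) x * (bavg e (z n) x)\<^sup>2)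
      < d / 4"
    using d by (intro order_tendstoD(2)[where y="LINT x::'a|lborel. (0::real)"]) auto
  then show ?thesis
  proof eventually_elim
    case (elim n)
    note err = nsq_bavg_error[OF e z(1), of n]
    have "(LINT x|lborel. indicator (ball 0 R) x * (z n x)\<^sup>2)
       \<le> (LINT x|lborel. 2 * (norm (z n x - bavg e (z n) x))\<^sup>2 + 2 * (indicator (ball 0 R) x * (bavg
           e (z n) x)\<^sup>2))"
    proof (rule integral_mono)
      have "integrable lborel (\<lambda>x. (z n x)\<^sup>2)" using H1_sqint[OF z(1)] by (simp add: sqint_def)
      then show "integrable lborel (\<lambda>x. indicator (ball 0 R) x * (z n x)\<^sup>2)"
        by (rule Bochner_Integration.integrable_bound) (auto split: split_indicator)
      show "integrable lborel (\<lambda>x. 2 * (norm (z n x - bavg e (z n) x))\<^sup>2 + 2 * (indicator (ball 0 R)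
          x * (bavg e (z n) x)\<^sup>2))"
        using sqint_integrable[OF err(1)] ib by simp
      fix x
      have "(z n x)\<^sup>2 \<le> 2 * (z n x - bavg e (z n) x)\<^sup>2 + 2 * (bavg e (z n) x)\<^sup>2"
        using norm_add_sq_le[of "z n x - bavg e (z n) x" "bavg e (z n) x"] by simp
      then show "indicator (ball 0 R) x * (z n x)\<^sup>2
         \<le> 2 * (norm (z n x - bavg e (z n) x))\<^sup>2 + 2 * (indicator (ball 0 R) x * (bavg e (z n)
             x)\<^sup>2)"
        by (auto split: split_indicator)
    qed
    also have "\<dots> = 2 * nsq lborel (\<lambda>x. z n x - bavg e (z n) x) + 2 * (LINT x|lborel. indicator (ball
        0 R) x * (bavg e (z n) x)\<^sup>2)"
      using sqint_integrable[OF err(1)] ib by (simp add: nsq_def)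
    also have "\<dots> < 2 * (e\<^sup>2 * G) + 2 * (d / 4)"
      using err(2) mult_left_mono[OF z(3)[of n], of "e\<^sup>2"] elim by (intro add_le_less_mono) auto
    finally show ?case using eG by linarith
  qed
qed

text \<open>The \<open>k\<close>-th member is chosen with integral below \<open>(1/2)^k\<close> on
  the ball of radius \<open>k\<close>. The sum is finite almost everywhere, and each point lies in
  all but finitely many of the balls.\<close>

lemma AE_subseq_of_local_sq:
  fixes z :: "nat \<Rightarrow> 'a::euclidean_space \<Rightarrow> real"
  assumes z: "\<And>n. sqint lborel (z n)"
    and lim: "\<And>R d. d > 0 \<Longrightarrow> \<forall>\<^sub>F n in sequentially. (LINT x|lborel. indicator (ball 0 R) x * (z n
        x)\<^sup>2) < d"
  obtains s where "strict_mono s" "AE x in lborel. (\<lambda>n. z (s n) x) \<longlonglongrightarrow> 0"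
proof -
  have "\<forall>\<^sub>F n in sequentially. (LINT x|lborel. indicator (ball 0 (real k)) x * (z n x)\<^sup>2) < (1/2)^k"
      for k
    by (rule lim) simp
  then obtain s where s: "strict_mono s" "\<And>k. (LINT x|lborel. indicator (ball 0 (real k)) x * (z (s
      k) x)\<^sup>2) < (1/2)^k"
    using eventually_subseq_choice[of "\<lambda>k n. (LINT x|lborel. indicator (ball 0 (real k)) x * (z n
        x)\<^sup>2) < (1/2)^k"] by blast
  define f where "f k x = indicator (ball 0 (real k)) x * (z (s k) x)\<^sup>2" for k x
  have [measurable]: "z n \<in> borel_measurable borel" for n using z by (auto simp: sqint_def)
  have [measurable]: "ball (0::'a) (real k) \<in> sets borel" for k by simp
  have [measurable]: "f k \<in> borel_measurable borel" for k unfolding f_def by measurable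
  have f0: "f k x \<ge> 0" for k x by (simp add: f_def)
  have i: "integrable lborel (f k)" for k
  proof -
    have "integrable lborel (\<lambda>x. (z (s k) x)\<^sup>2)" using z by (simp add: sqint_def)
    then show ?thesis by (rule Bochner_Integration.integrable_bound) (auto simp: f_def split:
        split_indicator)
  qed
  have "(\<integral>\<^sup>+x. (\<Sum>k. ennreal (f k x)) \<partial>lborel) = (\<Sum>k. \<integral>\<^sup>+x. ennreal (f k x) \<partial>lborel)"
    by (intro nn_integral_suminf) measurable
  also have "\<dots> \<le> (\<Sum>k. ennreal ((1/2)^k))"
  proof (intro suminf_le)
    fix k
    have "(\<integral>\<^sup>+x. ennreal (f k x) \<partial>lborel) = ennreal (LINT x|lborel. f k x)"
      using i f0 by (intro nn_integral_eq_integral) auto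
    also have "\<dots> \<le> ennreal ((1/2)^k)" using s(2)[of k] unfolding f_def by (intro ennreal_leI) simp
    finally show "(\<integral>\<^sup>+x. ennreal (f k x) \<partial>lborel) \<le> ennreal ((1/2)^k)" .
  qed auto
  also have "\<dots> = ennreal (\<Sum>k. (1/2)^k)"
    by (intro suminf_ennreal2) (auto intro!: summable_geometric)
  also have "\<dots> < \<infinity>" by simp
  finally have "AE x in lborel. (\<Sum>k. ennreal (f k x)) \<noteq> \<infinity>"
    by (intro nn_integral_PInf_AE) auto
  then have "AE x in lborel. (\<lambda>n. z (s n) x) \<longlonglongrightarrow> 0"
  proof eventually_elim
    case (elim x)
    have "summable (\<lambda>k. f k x)" using elim f0 by (intro summable_suminf_not_top) auto
    then have "(\<lambda>k. f k x) \<longlonglongrightarrow> 0" by (rule summable_LIMSEQ_zero)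
    moreover have "\<forall>\<^sub>F k in sequentially. f k x = (z (s k) x)\<^sup>2"
    proof -
      obtain N where "norm x < real N" using reals_Archimedean2 by blast
      then show ?thesis by (intro eventually_sequentiallyI[of N]) (auto simp: f_def)
    qed
    ultimately have "(\<lambda>k. (z (s k) x)\<^sup>2) \<longlonglongrightarrow> 0" by (rule Lim_transform_eventually)
    then have "(\<lambda>k. sqrt ((z (s k) x)\<^sup>2)) \<longlonglongrightarrow> sqrt 0" by (rule tendsto_real_sqrt)
    then show ?case by (simp add: tendsto_rabs_zero_iff)
  qed
  then show ?thesis using that s(1) by blast
qed

text \<open>Averages over balls converge along a diagonal subsequence at a countable dense set of centres,
  hence everywhere by equicontinuity; they approximate the functions uniformly in the mean square.\<close>

theorem H1_compactness:
  fixes u :: "nat \<Rightarrow> 'a::euclidean_space \<Rightarrow> real"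
  assumes u: "\<And>n. u n \<in> H1" "\<And>n. nsq lborel (u n) \<le> m" "\<And>n. dirichlet (u n) \<le> G"
  obtains r w where "strict_mono r" "w \<in> H1" "AE x in lborel. (\<lambda>n. u (r n) x) \<longlonglongrightarrow> w x"
    "(\<lambda>n. ip lborel (u (r n)) w) \<longlonglongrightarrow> nsq lborel w"
    "\<And>e. e > 0 \<Longrightarrow> \<forall>\<^sub>F n in sequentially. ip lborel (wgrad (u (r n))) (wgrad w) \<ge> dirichlet w - e"
proof -
  note su = H1_sqint[OF u(1)] and sg = H1_wgrad(1)[OF u(1)]
  obtain D :: "'a set" where D: "countable D" "\<And>X. open X \<Longrightarrow> X \<noteq> {} \<Longrightarrow> \<exists>d\<in>D. d \<in> X"
    by (rule countable_dense_setE) blast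
  have "D \<noteq> {}" using D(2)[of UNIV] by auto
  \<comment> \<open>Enumerates all pairs of a dense centre and a radius \<open>1 / (i + 1)\<close>,
    so that one diagonal sequence handles every pair.\<close>
  define pt where "pt k = from_nat_into D (fst (prod_decode k))" for k
  define ep where "ep k = 1 / real (Suc (snd (prod_decode k)))" for k
  have ep: "ep k > 0" for k by (simp add: ep_def)
  define a where "a k n = bavg (ep k) (u n) (pt k)" for k n
  have "Bseq (a k)" for k
  proof (rule BseqI')
    fix n
    have V: "measure lborel (ball (0::'a) (ep k)) > 0" using ep by (rule content_ball_pos)
    have "(a k n)\<^sup>2 \<le> m / measure lborel (ball (0::'a) (ep k))"
      using bavg_sq_le[OF ep su, of k n "pt k"] u(2)[of n] V unfolding a_def
      by (meson divide_right_mono less_imp_le order_trans)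
    then have "sqrt ((a k n)\<^sup>2) \<le> sqrt (m / measure lborel (ball (0::'a) (ep k)))"
      by (rule real_sqrt_le_mono)
    then show "norm (a k n) \<le> sqrt (m / measure lborel (ball (0::'a) (ep k)))" by simp
  qed
  then obtain r where r: "strict_mono r" "\<And>k. convergent (\<lambda>n. a k (r n))"
    using diagonal_convergent by blast
  have dense: "convergent (\<lambda>n. bavg (1 / real (Suc i)) (u (r n)) y)" if "y \<in> D" for i y
  proof -
    have "a (prod_encode (to_nat_on D y, i)) n = bavg (1 / real (Suc i)) (u n) y" for n
      using that D(1) by (simp add: a_def pt_def ep_def)
    then show ?thesis using r(2)[of "prod_encode (to_nat_on D y, i)"] by simp
  qed
  have conv: "convergent (\<lambda>n. bavg (1 / real (Suc i)) (u (r n)) x)" for i x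
  proof -
    define e where "e = 1 / real (Suc i)"
    have e: "e > 0" by (simp add: e_def)
    define V where "V = measure lborel (ball (0::'a) e)"
    have V: "V > 0" unfolding V_def using e by (rule content_ball_pos)
    have G: "G \<ge> 0" using u(3)[of 0] dirichlet_nonneg[of "u 0"] by linarith
    define L where "L = sqrt (G / V)"
    have lip: "\<bar>bavg e (u n) x - bavg e (u n) y\<bar> \<le> norm (x - y) * L" for n y
    proof -
      have "(bavg e (u n) x - bavg e (u n) y)\<^sup>2 \<le> (norm (x - y))\<^sup>2 * dirichlet (u n) / V"
        unfolding V_def by (rule bavg_equicontinuous[OF e u(1)])
      also have "\<dots> \<le> (norm (x - y))\<^sup>2 * G / V"
        using V u(3) by (intro divide_right_mono mult_left_mono) auto
      also have "\<dots> = (norm (x - y))\<^sup>2 * (G / V)" by simp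
      finally have "sqrt ((bavg e (u n) x - bavg e (u n) y)\<^sup>2) \<le> sqrt ((norm (x - y))\<^sup>2 * (G / V))"
        by (rule real_sqrt_le_mono)
      then show ?thesis unfolding real_sqrt_mult L_def by simp
    qed
    have "Cauchy (\<lambda>n. bavg e (u (r n)) x)"
    proof (rule CauchyI)
      fix d :: real assume d: "d > 0"
      have L: "L \<ge> 0" using G V by (simp add: L_def)
      obtain y where y: "y \<in> D" "y \<in> ball x (d / (4 * (L + 1)))"
      proof -
        have "0 < d / (4 * (L + 1))" using d L by simp
        then have "ball x (d / (4 * (L + 1))) \<noteq> {}" using centre_in_ball by blast
        then show ?thesis using D(2)[OF open_ball] that by blast
      qed
      have "norm (x - y) * L \<le> d / (4 * (L + 1)) * (L + 1)"
        using y L d by (intro mult_mono) (auto simp: dist_norm)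
      also have "\<dots> = d / 4" using L by (simp add: divide_simps)
      finally have close: "norm (x - y) * L \<le> d / 4" .
      have "Cauchy (\<lambda>n. bavg e (u (r n)) y)" using dense[OF y(1), of i]
        by (simp add: Cauchy_convergent_iff e_def)
      then obtain N where N: "\<And>m n. m \<ge> N \<Longrightarrow> n \<ge> N \<Longrightarrow> norm (bavg e (u (r m)) y - bavg e (u (r n)) y)
          < d / 4"
        using CauchyD[of _ "d/4"] d by (metis zero_less_divide_iff zero_less_numeral)
      have "norm (bavg e (u (r m)) x - bavg e (u (r n)) x) < d" if "m \<ge> N" "n \<ge> N" for m n
        using N[OF that] lip[of "r m" y] lip[of "r n" y] close d unfolding real_norm_def by linarith
      then show "\<exists>M. \<forall>m\<ge>M. \<forall>n\<ge>M. norm (bavg e (u (r m)) x - bavg e (u (r n)) x) < d" by blast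
    qed
    then show ?thesis unfolding e_def by (simp add: Cauchy_convergent_iff)
  qed
  define F where "F n x = (u (r n) x, wgrad (u (r n)) x)" for n x
  have F: "sqint lborel (F n)" "nsq lborel (F n) \<le> m + G" for n
    using sqint_Pair[OF su sg, of "r n" "r n"] u(2,3)[of "r n"]
      unfolding F_def[abs_def] dirichlet_eq by auto
  obtain H where H: "sqint lborel H"
    "\<And>W L. sqint lborel W \<Longrightarrow> (\<lambda>n. ip lborel (F n) W) \<longlonglongrightarrow> L \<Longrightarrow> ip lborel H W = L"
    "\<And>e. e > 0 \<Longrightarrow> \<forall>\<^sub>F n in sequentially. ip lborel (F n) H \<ge> nsq lborel H - e"
    by (rule weak_limit[of lborel F "m + G", OF F]) (rule that, assumption+)
  define w where "w x = fst (H x)" for x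
  define g where "g x = snd (H x)" for x
  have w: "sqint lborel w" and g: "sqint lborel g" unfolding w_def g_def
    using sqint_fst_snd[OF H(1)] by auto
  have Hwg: "H = (\<lambda>x. (w x, g x))" by (simp add: w_def g_def)
  have wg: "is_weak_grad w g"
    unfolding is_weak_grad_def
  proof (intro allI impI ballI)
    fix \<phi> :: "'a \<Rightarrow> real" and D and i :: 'a assume t: "test_fun \<phi> D" and i: "i \<in> Basis"
    note \<phi> = test_fun_sqint[OF t] and d = test_fun_deriv_sqint[OF t, of i]
    have s: "sqint lborel (\<lambda>x. \<phi> x *\<^sub>R i)"
    proof -
      have [measurable]: "\<phi> \<in> borel_measurable lborel" using \<phi> by (simp add: sqint_def)
      have "(norm (\<phi> x *\<^sub>R i))\<^sup>2 = (norm (\<phi> x))\<^sup>2" for x using i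
        by (simp only: norm_scaleR norm_Basis) simp
      then show ?thesis using sqint_integrable[OF \<phi>] unfolding sqint_def by (simp only:) measurable
    qed
    have eq: "ip lborel (\<lambda>x. (p x, k x)) (\<lambda>x. (D x i, \<phi> x *\<^sub>R i)) = (LINT x|lborel. p x * D x i)
        + (LINT x|lborel. (k x \<bullet> i) * \<phi> x)"
      if "sqint lborel p" "sqint lborel k" for p k
      using integrable_mult_sqint[OF that(1) d] integrable_mult_sqint[OF sqint_inner_const[OF
          that(2)] \<phi>, of i]
      by (simp add: ip_def mult.commute[of "\<phi> _"])
    \<comment> \<open>The weak gradient relation is orthogonality of the pair to
      \<open>(D x i, phi x i)\<close>, a condition that survives weak limits.\<close>
    have "ip lborel (F n) (\<lambda>x. (D x i, \<phi> x *\<^sub>R i)) = 0" for n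
      unfolding F_def[abs_def] eq[OF su sg] using H1_wgrad(2)[OF u(1), of "r n"] t i
        by (simp add: is_weak_grad_def)
    then have "ip lborel H (\<lambda>x. (D x i, \<phi> x *\<^sub>R i)) = 0"
      by (intro H(2) sqint_Pair d s) simp
    then show "(LINT x|lborel. w x * D x i) = - (LINT x|lborel. (g x \<bullet> i) * \<phi> x)"
      unfolding Hwg eq[OF w g] by simp
  qed
  note wH = H1_I[OF w g wg]
  define z where "z n x = u (r n) x + (-1) * w x" for n x
  have z1: "z n \<in> H1" for n unfolding z_def[abs_def] by (rule H1_lin(1)[OF u(1) wH(1)])
  have z2: "nsq lborel (z n) \<le> 2 * m + 2 * nsq lborel w" for n
    using nsq_diff_le[OF su w, of "r n"] u(2)[of "r n"] by (simp add: z_def[abs_def])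
  have z3: "dirichlet (z n) \<le> 2 * G + 2 * dirichlet w" for n
  proof -
    have "nsq lborel (\<lambda>x. wgrad (u (r n)) x - wgrad w x) = dirichlet (z n)"
      using H1_lin(3)[OF u(1) wH(1), of "r n" "-1"] nsq_diff[OF sg H1_wgrad(1)[OF wH(1)], of "r n"]
      by (simp add: z_def[abs_def] dirichlet_eq)
    then show ?thesis
      using nsq_diff_le[OF sg H1_wgrad(1)[OF wH(1)], of "r n"] u(3)[of "r n"]
        by (simp add: dirichlet_eq)
  qed
  \<comment> \<open>Each average is a pairing of the function with a shifted kernel. As these
    pairings converge, their limit is the pairing with the weak limit, namely the average of
    \<open>w\<close>.\<close>
  have blim: "(\<lambda>n. bavg (1 / real (Suc i)) (z n) x) \<longlonglongrightarrow> 0" for i x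
  proof -
    define e where "e = 1 / real (Suc i)"
    have e: "e > 0" by (simp add: e_def)
    have k: "sqint lborel (\<lambda>y. ball_kernel e (y - x))"
      using sqint_shift[OF ball_kernel(4)[OF e], of "-x"] by simp
    obtain L where L: "(\<lambda>n. bavg e (u (r n)) x) \<longlonglongrightarrow> L" using conv[of i x]
      by (auto simp: convergent_def e_def)
    have eq: "ip lborel (\<lambda>x. (p x, j x)) (\<lambda>y. (ball_kernel e (y - x), 0::'a)) = bavg e p x"
        if "sqint lborel p" for p and j :: "'a \<Rightarrow> 'a"
      unfolding bavg_eq_ip[OF e that] by (simp add: ip_def)
    have "ip lborel H (\<lambda>y. (ball_kernel e (y - x), 0)) = L"
      using L by (intro H(2) sqint_Pair(1)[OF k sqint_zero]) (simp add: F_def[abs_def] eq[OF su])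
    then have "bavg e w x = L" unfolding Hwg eq[OF w] .
    then have "(\<lambda>n. bavg e (u (r n)) x - bavg e w x) \<longlonglongrightarrow> 0" using L by (simp add: LIM_zero)
    moreover have "bavg e (z n) x = bavg e (u (r n)) x - bavg e w x" for n
      using bavg_diff[OF e su w] by (simp add: z_def[abs_def])
    ultimately show ?thesis unfolding e_def by simp
  qed
  obtain s where s: "strict_mono s" "AE x in lborel. (\<lambda>n. z (s n) x) \<longlonglongrightarrow> 0"
    using AE_subseq_of_local_sq[OF H1_sqint[OF z1] local_sq_tendsto_0[OF z1 z2 z3 blim]] by blast
  have ae: "AE x in lborel. (\<lambda>n. u (r (s n)) x) \<longlonglongrightarrow> w x"
    using s(2)
  proof eventually_elim
    case (elim x)
    then have "(\<lambda>n. z (s n) x + w x) \<longlonglongrightarrow> 0 + w x" by (intro tendsto_intros)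
    then show ?case by (simp add: z_def)
  qed
  have lim1: "(\<lambda>n. ip lborel (u (r (s n))) w) \<longlonglongrightarrow> nsq lborel w"
    by (rule tendsto_ip_of_AE[OF su u(2) w ae])
  \<comment> \<open>The semicontinuity inequality is known for the pair. The function component
    converges along the subsequence, and subtracting it leaves the inequality for the
    gradient.\<close>
  have "\<forall>\<^sub>F n in sequentially. ip lborel (wgrad (u (r (s n)))) (wgrad w) \<ge> dirichlet w - e"
      if e: "e > 0" for e
  proof -
    have "\<forall>\<^sub>F n in sequentially. ip lborel (F (s n)) H \<ge> nsq lborel H - e / 2"
      using eventually_subseq[OF s(1) H(3)[of "e/2"]] e by simp
    moreover have "\<forall>\<^sub>F n in sequentially. ip lborel (u (r (s n))) w < nsq lborel w + e / 2"
      by (rule order_tendstoD(2)[OF lim1]) (use e in simp)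
    ultimately show ?thesis
    proof eventually_elim
      case (elim n)
      have 1: "ip lborel (F (s n)) H = ip lborel (u (r (s n))) w + ip lborel (wgrad (u (r (s n))))
          g"
        unfolding Hwg F_def[abs_def]
        using integrable_mult_sqint[OF su w] integrable_inner[OF sg g] by (simp add: ip_def)
      have 2: "nsq lborel H = nsq lborel w + dirichlet w"
        unfolding Hwg sqint_Pair(2)[OF w g] wH(3) ..
      have 3: "ip lborel (wgrad (u (r (s n)))) g = ip lborel (wgrad (u (r (s n)))) (wgrad w)"
      proof -
        have [measurable]: "g \<in> borel_measurable lborel" "wgrad w \<in> borel_measurable lborel"
            "wgrad (u (r (s n))) \<in> borel_measurable lborel"
          using g H1_wgrad(1)[OF wH(1)] sg by (auto simp: sqint_def)
        show ?thesis unfolding ip_def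
          by (intro integral_cong_AE) (measurable, use wH(2) in \<open>auto elim: eventually_mono\<close>)
      qed
      show ?case using elim 1 2 3 by linarith
    qed
  qed
  moreover have "strict_mono (r \<circ> s)" using r(1) s(1) by (rule strict_mono_o)
  ultimately show ?thesis using that[of "r \<circ> s" w] wH(1) ae lim1 by (simp add: o_def)
qed

section \<open>Competitors\<close>

lemma abs_powr_eq_sq_powr: "\<bar>s\<bar> powr r = (s\<^sup>2) powr (r / 2)" for s r :: real
proof (cases "s = 0")
  case False
  then have "s\<^sup>2 = \<bar>s\<bar> powr 2" by simp
  then show ?thesis by (simp only: powr_powr) simp
qed simp

text \<open>Both \<open>x powr (r - 1)\<close> and \<open>y powr (r - 1)\<close> are at most
  \<open>(x + y) powr (r - 1)\<close>. With exponent \<open>p / 2\<close> and squares it shows that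
  the competitor does not lose L^p energy.\<close>

lemma powr_superadditive:
  fixes x y r :: real
  assumes "x \<ge> 0" "y \<ge> 0" "r \<ge> 1"
  shows "x powr r + y powr r \<le> (x + y) powr r"
proof -
  have *: "z powr r = z * z powr (r - 1)" if "z \<ge> 0" for z :: real
    using that by (cases "z = 0") (auto simp: powr_diff)
  have "x powr r + y powr r \<le> x * (x + y) powr (r - 1) + y * (x + y) powr (r - 1)"
    unfolding *[OF assms(1)] *[OF assms(2)] using assms
      by (intro add_mono mult_left_mono powr_mono2) auto
  also have "\<dots> = (x + y) powr r" using *[of "x + y"] assms by (simp add: distrib_right)
  finally show ?thesis .
qed

text \<open>For exponents below 1 the increment shrinks as \<open>s\<close> grows. So
  \<open>s\<close> is confined to a compact interval, on which the positive continuous increment has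
  a positive minimum.\<close>

lemma powr_increment_bound:
  fixes r K t :: real
  assumes r: "r > 0" and t: "t > 0" and K: "K \<ge> 0"
  obtains k where "k > 0" "\<And>s y. 0 \<le> s \<Longrightarrow> s \<le> K \<Longrightarrow> t \<le> y \<Longrightarrow> (s + y) powr r - s powr r \<ge> k"
proof -
  have "continuous_on {0..K} (\<lambda>s. (s + t) powr r - s powr r)"
    using r t by (intro continuous_intros continuous_on_powr') auto
  from continuous_attains_inf[OF compact_Icc _ this] K
  obtain s0 where s0: "s0 \<in> {0..K}" "\<And>s. s \<in> {0..K} \<Longrightarrow> (s0 + t) powr r - s0 powr r
      \<le> (s + t) powr r - s powr r"
    by force
  have "(s0 + t) powr r - s0 powr r > 0" using s0(1) r t by (auto intro!: powr_less_mono2)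
  moreover have "(s0 + t) powr r - s0 powr r \<le> (s + y) powr r - s powr r" if "0 \<le> s" "s \<le> K" "t \<le> y"
      for s y
  proof -
    have "(s + t) powr r \<le> (s + y) powr r" using that r t by (intro powr_mono2) auto
    then show ?thesis using s0(2)[of s] that by auto
  qed
  ultimately show ?thesis using that by blast
qed

text \<open>Take \<open>d\<close> with \<open>(1 + d) powr r = 1 + e\<close>. If
  \<open>\<bar>s\<bar> \<le> d * \<bar>t\<bar>\<close> the first term alone suffices, otherwise
  \<open>t\<close> is controlled by \<open>s / d\<close> and the second one does.\<close>

lemma powr_add_young:
  fixes e r :: real
  assumes e: "e > 0" and r: "r > 0"
  obtains C where "C \<ge> 0" "\<And>s t. \<bar>s + t\<bar> powr r \<le> (1 + e) * \<bar>t\<bar> powr r + C * \<bar>s\<bar> powr r"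
proof -
  define d where "d = (1 + e) powr (1 / r) - 1"
  have d: "d > 0" using e r by (simp add: d_def gr_one_powr)
  have d': "(1 + d) powr r = 1 + e" using e r by (simp add: d_def powr_powr)
  have "\<bar>s + t\<bar> powr r \<le> (1 + e) * \<bar>t\<bar> powr r + (1 + 1 / d) powr r * \<bar>s\<bar> powr r" for s t
  proof (cases "\<bar>s\<bar> \<le> d * \<bar>t\<bar>")
    case True
    then have "\<bar>s + t\<bar> \<le> (1 + d) * \<bar>t\<bar>" using abs_triangle_ineq[of s t] by (simp add: distrib_right)
    then have "\<bar>s + t\<bar> powr r \<le> ((1 + d) * \<bar>t\<bar>) powr r" using r by (intro powr_mono2) auto
    also have "\<dots> = (1 + e) * \<bar>t\<bar> powr r" using d by (simp add: powr_mult d')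
    finally show ?thesis by (meson add_increasing2 mult_nonneg_nonneg powr_ge_zero)
  next
    case False
    then have "\<bar>t\<bar> \<le> \<bar>s\<bar> / d" using d by (simp add: field_simps)
    then have "\<bar>s + t\<bar> \<le> (1 + 1 / d) * \<bar>s\<bar>" using abs_triangle_ineq[of s t]
      by (simp add: distrib_right)
    then have "\<bar>s + t\<bar> powr r \<le> ((1 + 1 / d) * \<bar>s\<bar>) powr r" using r by (intro powr_mono2) auto
    also have "\<dots> = (1 + 1 / d) powr r * \<bar>s\<bar> powr r" using d by (simp add: powr_mult)
    finally show ?thesis using e
      by (meson add_increasing mult_nonneg_nonneg powr_ge_zero add_nonneg_nonneg less_imp_le
          zero_le_one)
  qed
  then show ?thesis using that[of "(1 + 1 / d) powr r"] by auto
qed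

text \<open>A cone of slope \<open>1 / R\<close>: its mass is of order \<open>R^N\<close> and its
  Dirichlet integral at most of order \<open>R^(N - 2)\<close>, which is why spreading is
  cheap.\<close>

definition hat :: "real \<Rightarrow> 'a::euclidean_space \<Rightarrow> real" where
  "hat R x = max 0 (1 - norm x / R)"

lemma hat_props:
  fixes R :: real
  assumes R: "R > 0"
  shows "sqint lborel (hat R :: 'a::euclidean_space \<Rightarrow> real)"
    and "(hat R :: 'a \<Rightarrow> real) \<in> H1"
    and "dirichlet (hat R :: 'a \<Rightarrow> real) \<le> real DIM('a) * (measure lborel (ball (0::'a) (2 * R)) /
        R\<^sup>2)"
    and "nsq lborel (hat R :: 'a \<Rightarrow> real) \<le> measure lborel (ball (0::'a) R)"
    and "nsq lborel (hat R :: 'a \<Rightarrow> real) \<ge> measure lborel (ball (0::'a) (R / 2)) / 4"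
proof -
  have h0: "hat R x = 0" if "R \<le> norm x" for x :: 'a using that R by (simp add: hat_def)
  have hb: "0 \<le> hat R x" "hat R x \<le> 1" for x :: 'a using R by (auto simp: hat_def)
  have cont: "continuous_on UNIV (hat R :: 'a \<Rightarrow> real)"
    unfolding hat_def[abs_def] using R by (intro continuous_intros) auto
  show s: "sqint lborel (hat R :: 'a \<Rightarrow> real)"
    by (rule sqint_of_compact_support[OF cont compact_cball[of 0 R]]) (auto intro: h0)
  have ib: "integrable lborel (indicator (ball (0::'a) r) :: 'a \<Rightarrow> real)" for r
    using emeasure_bounded_finite[OF bounded_ball, of "0::'a" r] by (simp add: less_top)
  have lip: "\<bar>hat R x - hat R y\<bar> \<le> norm (x - y) / R" for x y :: 'a
  proof -
    have "\<bar>hat R x - hat R y\<bar> \<le> \<bar>norm x / R - norm y / R\<bar>" by (auto simp: hat_def)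
    also have "\<dots> = \<bar>norm x - norm y\<bar> / R" using R by (simp add: diff_divide_distrib[symmetric])
    also have "\<dots> \<le> norm (x - y) / R" using R by (intro divide_right_mono norm_triangle_ineq3) auto
    finally show ?thesis .
  qed
  \<comment> \<open>For steps \<open>t \<le> R\<close> both the cone and its translate vanish
    outside the ball of radius \<open>2 * R\<close>, and inside it the difference is at most
    \<open>t / R\<close>.\<close>
  have tr: "nsq lborel (\<lambda>x::'a. hat R (x + t *\<^sub>R i) - hat R x) \<le> t\<^sup>2 * (measure lborel (ball (0::'a)
      (2 * R)) / R\<^sup>2)"
    if i: "i \<in> Basis" and t: "0 < t" "t \<le> R" for i :: 'a and t
  proof -
    have "nsq lborel (\<lambda>x::'a. hat R (x + t *\<^sub>R i) - hat R x) \<le> (LINT x|lborel. indicator (ball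
        (0::'a) (2 * R)) x * (t / R)\<^sup>2)"
      unfolding nsq_def
    proof (rule integral_mono)
      show "integrable lborel (\<lambda>x::'a. (norm (hat R (x + t *\<^sub>R i) - hat R x))\<^sup>2)"
        by (intro sqint_integrable sqint_diff sqint_shift s)
      show "integrable lborel (\<lambda>x. indicator (ball (0::'a) (2 * R)) x * (t / R)\<^sup>2)" using ib by simp
      fix x :: 'a
      show "(norm (hat R (x + t *\<^sub>R i) - hat R x))\<^sup>2 \<le> indicator (ball (0::'a) (2 * R)) x * (t /
          R)\<^sup>2"
      proof (cases "x \<in> ball 0 (2 * R)")
        case True
        have "\<bar>hat R (x + t *\<^sub>R i) - hat R x\<bar> \<le> t / R" using lip[of "x + t *\<^sub>R i" x] i t by simp
        then have "\<bar>hat R (x + t *\<^sub>R i) - hat R x\<bar>\<^sup>2 \<le> (t / R)\<^sup>2" by (intro power_mono) auto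
        then show ?thesis using True by simp
      next
        case False
        then have "norm x \<ge> 2 * R" by simp
        moreover have "norm x \<le> norm (x + t *\<^sub>R i) + t"
          using norm_triangle_ineq4[of "x + t *\<^sub>R i" "t *\<^sub>R i"] i t by simp
        ultimately have "R \<le> norm (x + t *\<^sub>R i)" "R \<le> norm x" using t R by linarith+
        then show ?thesis using False by (simp add: h0)
      qed
    qed
    also have "\<dots> = t\<^sup>2 * (measure lborel (ball (0::'a) (2 * R)) / R\<^sup>2)" by (simp add: power_divide)
    finally show ?thesis .
  qed
  show "(hat R :: 'a \<Rightarrow> real) \<in> H1"
    "dirichlet (hat R :: 'a \<Rightarrow> real) \<le> real DIM('a) * (measure lborel (ball (0::'a) (2 * R)) / R\<^sup>2)"
    using H1_of_translation_bound[OF s R tr] by auto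
  have "nsq lborel (hat R :: 'a \<Rightarrow> real) \<le> (LINT x|lborel. indicator (ball (0::'a) R) x)"
    unfolding nsq_def
  proof (rule integral_mono[OF sqint_integrable[OF s] ib])
    fix x :: 'a
    show "(norm (hat R x))\<^sup>2 \<le> indicator (ball 0 R) x"
      using h0[of x] hb[of x] by (auto simp: power_le_one split: split_indicator)
  qed
  then show "nsq lborel (hat R :: 'a \<Rightarrow> real) \<le> measure lborel (ball (0::'a) R)" by simp
  have "(LINT x|lborel. indicator (ball (0::'a) (R / 2)) x / 4) \<le> nsq lborel (hat R :: 'a \<Rightarrow> real)"
    unfolding nsq_def
  proof (rule integral_mono[OF _ sqint_integrable[OF s]])
    show "integrable lborel (\<lambda>x. indicator (ball (0::'a) (R / 2)) x / 4 :: real)" using ib by simp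
    fix x :: 'a
    show "indicator (ball 0 (R / 2)) x / 4 \<le> (norm (hat R x))\<^sup>2"
    proof (cases "x \<in> ball 0 (R / 2)")
      case True
      then have "hat R x \<ge> 1 / 2" using R by (auto simp: hat_def field_simps)
      then have "(1 / 2)\<^sup>2 \<le> (hat R x)\<^sup>2" by (intro power_mono) auto
      then show ?thesis using True by (simp add: power2_eq_square)
    qed simp
  qed
  then show "nsq lborel (hat R :: 'a \<Rightarrow> real) \<ge> measure lborel (ball (0::'a) (R / 2)) / 4" by simp
qed

text \<open>The exponent \<open>2 / (2 - q)\<close> is conjugate to \<open>2 / q\<close>, so
  \<open>h |u|^q\<close> is integrable for every square integrable \<open>u\<close>.\<close>

locale kirchhoff =
  fixes a b p q :: real and h :: "'a::euclidean_space \<Rightarrow> real"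
  assumes a: "a > 0" and b: "b > 0" and q: "1 \<le> q" "q < 2"
    and p: "2 < p" "p < 2 + 4 / real DIM('a)"
    and h_nonneg: "h x \<ge> 0" and h_meas[measurable]: "h \<in> borel_measurable lborel"
    and h_int: "integrable lborel (\<lambda>x. \<bar>h x\<bar> powr (2 / (2 - q)))"
    and h_pos: "emeasure lborel {x. h x > 0} > 0"
begin

section \<open>The terms of the functional and their behaviour on competitors\<close>

abbreviation P :: "('a \<Rightarrow> real) \<Rightarrow> real" where "P u \<equiv> LINT x|lborel. \<bar>u x\<bar> powr p"
abbreviation Q :: "('a \<Rightarrow> real) \<Rightarrow> real" where "Q u \<equiv> LINT x|lborel. h x * \<bar>u x\<bar> powr q"

abbreviation dP :: "('a \<Rightarrow> real) \<Rightarrow> ('a \<Rightarrow> real) \<Rightarrow> real" where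
  "dP u v \<equiv> LINT x|lborel. sgn (u x) * \<bar>u x\<bar> powr (p - 1) * v x"
abbreviation dQ :: "('a \<Rightarrow> real) \<Rightarrow> ('a \<Rightarrow> real) \<Rightarrow> real" where
  "dQ u v \<equiv> LINT x|lborel. h x * sgn (u x) * \<bar>u x\<bar> powr (q - 1) * v x"

definition kin :: "real \<Rightarrow> real" where "kin t = a / 2 * t + b / 4 * t\<^sup>2"

lemma energy_eq: "energy a b p q h u = kin (dirichlet u) - P u / p - Q u / q"
  by (simp add: energy_def kin_def)

lemma kin_mono: "0 \<le> s \<Longrightarrow> s \<le> t \<Longrightarrow> kin s \<le> kin t"
  unfolding kin_def using a b by (intro add_mono mult_left_mono power_mono) auto

text \<open>The derivative of \<open>kin\<close> on \<open>[0, M]\<close> is at most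
  \<open>a / 2 + b * M / 2\<close>, so \<open>a + b * M\<close> is a generous constant. The
  one-sided hypothesis \<open>s \<le> t + e\<close> fits the one-sided splitting of the Dirichlet
  integral; if \<open>s \<le> t\<close>, monotonicity is enough.\<close>

lemma kin_lipschitz:
  assumes "0 \<le> s" "0 \<le> t" "s \<le> M" "t \<le> M" "s \<le> t + e" "e \<ge> 0"
  shows "kin s \<le> kin t + (a + b * M) * e"
proof (cases "s \<le> t")
  case True
  have "0 \<le> (a + b * M) * e" using assms a b by simp
  then show ?thesis using kin_mono[OF assms(1) True] by linarith
next
  case False
  have "kin s - kin t = (s - t) * (a / 2 + b / 4 * (s + t))"
    by (simp add: kin_def power2_eq_square diff_divide_distrib add_divide_distrib distrib_left
        left_diff_distrib right_diff_distrib mult.commute mult.left_commute)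
  also have "\<dots> \<le> e * (a + b * M)"
  proof (rule mult_mono)
    have "b / 4 * (s + t) \<le> b / 4 * (4 * M)" using assms b by (intro mult_left_mono) auto
    then show "a / 2 + b / 4 * (s + t) \<le> a + b * M" using a by simp
  qed (use assms False a b in auto)
  finally show ?thesis by (simp add: mult.commute)
qed

lemma P_integrable:
  fixes u :: "'a \<Rightarrow> real"
  assumes "u \<in> H1" shows "integrable lborel (\<lambda>x. \<bar>u x\<bar> powr p)"
proof -
  have "nsq lborel u + 1 > 0" using nsq_nonneg[of lborel u] by simp
  from power_integral_bound[OF this p] obtain C where
    "\<And>v :: 'a \<Rightarrow> real. v \<in> H1 \<Longrightarrow> nsq lborel v \<le> nsq lborel u + 1 \<Longrightarrow> integrable lborel (\<lambda>x. \<bar>v x\<bar> powr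
        p)"
    by metis
  from this[OF assms] show ?thesis by simp
qed

lemma P_nonneg: "P u \<ge> 0" by simp

text \<open>Either \<open>h x\<close> is at most \<open>e * \<bar>s\<bar> powr (2 - q)\<close> and
  the first term suffices, or \<open>\<bar>s\<bar>\<close> is bounded by a power of
  \<open>h x / e\<close>, whose insertion gives the second term. Small \<open>e\<close> makes the
  dependence on \<open>s\<close> negligible in the mean.\<close>

lemma young:
  assumes e: "e > 0"
  shows "h x * \<bar>s\<bar> powr q \<le> e * s\<^sup>2 + e powr (- (q / (2 - q))) * \<bar>h x\<bar> powr (2 / (2 - q))"
proof (cases "h x \<le> e * \<bar>s\<bar> powr (2 - q)")
  case True
  have "h x * \<bar>s\<bar> powr q \<le> e * \<bar>s\<bar> powr (2 - q) * \<bar>s\<bar> powr q" using True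
    by (intro mult_right_mono) auto
  also have "\<dots> = e * \<bar>s\<bar> powr 2" by (simp only: mult.assoc powr_add[symmetric]) simp
  also have "\<bar>s\<bar> powr 2 = s\<^sup>2" by (cases "s = 0") auto
  finally show ?thesis by (meson add_increasing2 mult_nonneg_nonneg powr_ge_zero)
next
  case False
  have hx: "h x > 0" using False e h_nonneg[of x] by (smt (verit) mult_nonneg_nonneg powr_ge_zero)
  have "\<bar>s\<bar> powr (2 - q) \<le> h x / e" using False e by (simp add: field_simps)
  then have "(\<bar>s\<bar> powr (2 - q)) powr (q / (2 - q)) \<le> (h x / e) powr (q / (2 - q))"
    using q by (intro powr_mono2) auto
  then have "\<bar>s\<bar> powr q \<le> (h x / e) powr (q / (2 - q))" using q by (simp add: powr_powr)
  then have "h x * \<bar>s\<bar> powr q \<le> h x * (h x / e) powr (q / (2 - q))" using hx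
    by (intro mult_left_mono) auto
  also have "\<dots> = e powr (- (q / (2 - q))) * (h x powr 1 * h x powr (q / (2 - q)))"
  proof -
    have "(h x / e) powr (q / (2 - q)) = h x powr (q / (2 - q)) / e powr (q / (2 - q))"
      by (rule powr_divide)
    then show ?thesis using hx by (simp add: powr_minus divide_inverse)
  qed
  also have "h x powr 1 * h x powr (q / (2 - q)) = \<bar>h x\<bar> powr (2 / (2 - q))"
  proof -
    have "1 + q / (2 - q) = 2 / (2 - q)" using q by (simp add: field_simps)
    then show ?thesis using hx by (simp only: powr_add[symmetric] abs_of_pos)
  qed
  finally show ?thesis using e by (simp add: add_increasing)
qed

lemma Q_integrable:
  assumes "sqint lborel u" shows "integrable lborel (\<lambda>x. h x * \<bar>u x\<bar> powr q)"
proof (rule Bochner_Integration.integrable_bound)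
  have [measurable]: "u \<in> borel_measurable lborel" using assms by (simp add: sqint_def)
  show "integrable lborel (\<lambda>x. (u x)\<^sup>2 + \<bar>h x\<bar> powr (2 / (2 - q)))" using assms h_int
    by (simp add: sqint_def)
  show "(\<lambda>x. h x * \<bar>u x\<bar> powr q) \<in> borel_measurable lborel" by measurable
  show "AE x in lborel. norm (h x * \<bar>u x\<bar> powr q) \<le> norm ((u x)\<^sup>2 + \<bar>h x\<bar> powr (2 / (2 - q)))"
    using young[of 1 _ "u _"] h_nonneg by (intro AE_I2) (auto intro!: order_trans[OF young[of 1]])
qed

lemma P_sqrt_sum_sq:
  assumes u: "u \<in> H1" and v: "v \<in> H1"
  shows "P (\<lambda>x. sqrt ((u x)\<^sup>2 + (v x)\<^sup>2)) \<ge> P u + P v"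
proof -
  have "P u + P v = (LINT x|lborel. \<bar>u x\<bar> powr p + \<bar>v x\<bar> powr p)"
    using P_integrable[OF u] P_integrable[OF v] by simp
  also have "\<dots> \<le> P (\<lambda>x. sqrt ((u x)\<^sup>2 + (v x)\<^sup>2))"
  proof (rule integral_mono)
    show "integrable lborel (\<lambda>x. \<bar>u x\<bar> powr p + \<bar>v x\<bar> powr p)"
      using P_integrable[OF u] P_integrable[OF v] by simp
    show "integrable lborel (\<lambda>x. \<bar>sqrt ((u x)\<^sup>2 + (v x)\<^sup>2)\<bar> powr p)"
      by (rule P_integrable[OF H1_sqrt_sum_sq(1)[OF u v]])
    fix x
    show "\<bar>u x\<bar> powr p + \<bar>v x\<bar> powr p \<le> \<bar>sqrt ((u x)\<^sup>2 + (v x)\<^sup>2)\<bar> powr p"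
      using powr_superadditive[of "(u x)\<^sup>2" "(v x)\<^sup>2" "p / 2"] p
      by (simp only: abs_powr_eq_sq_powr) simp
  qed
  finally show ?thesis .
qed

lemma Q_pointwise_mono: "h x * \<bar>u x\<bar> powr q \<le> h x * \<bar>sqrt ((u x)\<^sup>2 + (v x)\<^sup>2)\<bar> powr q"
  using h_nonneg[of x] q by (intro mult_left_mono powr_mono2) (auto simp: real_le_rsqrt)

lemma Q_sqrt_sum_sq:
  assumes u: "u \<in> H1" and v: "v \<in> H1"
  shows "Q (\<lambda>x. sqrt ((u x)\<^sup>2 + (v x)\<^sup>2)) \<ge> Q u"
  by (intro integral_mono Q_integrable H1_sqint H1_sqrt_sum_sq u v Q_pointwise_mono)

text \<open>A cone normalised to mass \<open>\<beta>\<close> has squared height of order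
  \<open>R powr (- N)\<close>. Its gradient energy is then at most of order
  \<open>R powr (-2)\<close>, and its L^p term at least of order \<open>R powr (- N p / 2)\<close>
  times the volume of a ball of radius \<open>R / 2\<close>.\<close>

lemma spread_profile:
  assumes \<beta>: "\<beta> > 0"
  obtains C1 C2 where "C1 > 0" "C2 > 0"
    "\<And>R. R > 0 \<Longrightarrow> \<exists>v :: 'a \<Rightarrow> real. v \<in> H1 \<and> nsq lborel v = \<beta> \<and> dirichlet v \<le> C1 * R powr (-2) \<and>
       P v \<ge> C2 * R powr (- (real DIM('a) * (p - 2) / 2))"
proof -
  define N where "N = real DIM('a)"
  define w where "w = unit_ball_vol N"
  have w: "w > 0" by (simp add: w_def N_def)
  have N: "N > 0" by (simp add: N_def)
  have V: "measure lborel (ball (0::'a) R) = w * R powr N" if "R > 0" for R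
    using that by (simp add: content_ball w_def N_def powr_realpow)
  \<comment> \<open>\<open>4 powr N\<close> is the volume ratio of the balls of radius
    \<open>2 * R\<close> (from the gradient) and \<open>R / 2\<close> (from the lower mass bound);
    the factor 4 comes from the cone being at least 1/2 on the smaller ball.\<close>
  define C1 where "C1 = 4 * \<beta> * N * 4 powr N"
  define C2 where "C2 = (\<beta> / (4 * w)) powr (p / 2) * (w * (1 / 2) powr N)"
  have "C1 > 0" "C2 > 0" using \<beta> w N by (auto simp: C1_def C2_def)
  moreover have "\<exists>v :: 'a \<Rightarrow> real. v \<in> H1 \<and> nsq lborel v = \<beta> \<and> dirichlet v \<le> C1 * R powr (-2) \<and>
       P v \<ge> C2 * R powr (- (N * (p - 2) / 2))" if R: "R > 0" for R
  proof -
    note hp = hat_props[OF R, where 'a='a]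
    define m where "m = nsq lborel (hat R :: 'a \<Rightarrow> real)"
    have m1: "m \<ge> w * (R / 2) powr N / 4" using hp(5) R V[of "R/2"] by (simp add: m_def)
    have m2: "m \<le> w * R powr N" using hp(4) R V[of R] by (simp add: m_def)
    have m0: "m > 0" using m1 w R by (smt (verit) divide_pos_pos mult_pos_pos powr_gt_zero)
    define k where "k = sqrt (\<beta> / m)"
    have k: "k > 0" "k\<^sup>2 = \<beta> / m" using \<beta> m0 by (auto simp: k_def)
    define v where "v x = k * hat R x" for x :: 'a
    have vH: "v \<in> H1" unfolding v_def[abs_def] by (rule H1_scale(1)[OF hp(2)])
    have v1: "nsq lborel v = \<beta>"
      using nsq_scaleR[of lborel k "hat R :: 'a \<Rightarrow> real"] k m0
        by (simp add: v_def[abs_def] m_def[symmetric])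
    have v2: "dirichlet v \<le> C1 * R powr (-2)"
    proof -
      have "dirichlet v = \<beta> / m * dirichlet (hat R :: 'a \<Rightarrow> real)"
        using H1_scale(2)[OF hp(2), of k] k by (simp add: v_def[abs_def])
      also have "\<dots> \<le> \<beta> / (w * (R / 2) powr N / 4) * (N * (w * (2 * R) powr N / R\<^sup>2))"
      proof (rule mult_mono)
        show "\<beta> / m \<le> \<beta> / (w * (R / 2) powr N / 4)" using m1 m0 \<beta> w R
          by (intro divide_left_mono) auto
        show "dirichlet (hat R :: 'a \<Rightarrow> real) \<le> N * (w * (2 * R) powr N / R\<^sup>2)"
          using hp(3) R V[of "2 * R"] by (simp add: N_def)
      qed (use \<beta> w R in \<open>auto simp: dirichlet_nonneg\<close>)
      also have "\<dots> = 4 * \<beta> * N * ((2 * R) powr N / (R / 2) powr N) / R\<^sup>2" using w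
        by (simp add: field_simps)
      also have "(2 * R) powr N / (R / 2) powr N = 4 powr N"
        using R by (simp add: powr_divide[symmetric])
      also have "4 * \<beta> * N * 4 powr N / R\<^sup>2 = C1 * R powr (-2)"
        using R by (simp add: C1_def powr_minus divide_inverse)
      finally show ?thesis .
    qed
    have v3: "P v \<ge> C2 * R powr (- (N * (p - 2) / 2))"
    proof -
      have "\<beta> / (w * R powr N) \<le> k\<^sup>2" unfolding k(2) using m0 m2 \<beta> w R
        by (intro divide_left_mono) auto
      then have "\<beta> / (4 * w) * R powr (- N) \<le> (k / 2)\<^sup>2"
        using w R by (simp add: power_divide powr_minus field_simps)
      then have "(\<beta> / (4 * w) * R powr (- N)) powr (p / 2) \<le> ((k / 2)\<^sup>2) powr (p / 2)"
        using \<beta> w p by (intro powr_mono2) auto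
      moreover have "(\<beta> / (4 * w) * R powr (- N)) powr (p / 2) = (\<beta> / (4 * w)) powr (p / 2) * R powr
          (- (N * p / 2))"
      proof -
        have "(R powr (- N)) powr (p / 2) = R powr (- (N * p / 2))" by (simp add: powr_powr)
        then show ?thesis by (subst powr_mult) (use \<beta> w in simp_all)
      qed
      ultimately have kp: "(\<beta> / (4 * w)) powr (p / 2) * R powr (- (N * p / 2)) \<le> (k / 2) powr p"
        using k(1) abs_powr_eq_sq_powr[of "k/2" p] by simp
      have "C2 * R powr (- (N * (p - 2) / 2)) = ((\<beta> / (4 * w)) powr (p / 2) * R powr (- (N * p /
          2))) * (w * (R / 2) powr N)"
      proof -
        have "R powr (- (N * (p - 2) / 2)) = R powr (- (N * p / 2)) * R powr N"
        proof -
          have "- (N * (p - 2) / 2) = - (N * p / 2) + N" by (simp add: field_simps)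
          then show ?thesis by (simp only: powr_add)
        qed
        moreover have "(R / 2) powr N = R powr N * (1 / 2) powr N"
          using R by (simp add: powr_divide)
        ultimately show ?thesis by (simp add: C2_def)
      qed
      also have "\<dots> \<le> (k / 2) powr p * (w * (R / 2) powr N)" using kp w
        by (intro mult_right_mono) auto
      also have "\<dots> = (LINT x|lborel. (k / 2) powr p * indicator (ball (0::'a) (R / 2)) x)"
        using V[of "R / 2"] R by simp
      also have "\<dots> \<le> P v"
      proof (rule integral_mono[OF _ P_integrable[OF vH]])
        show "integrable lborel (\<lambda>x. (k / 2) powr p * indicator (ball (0::'a) (R / 2)) x)"
          using emeasure_bounded_finite[OF bounded_ball, of "0::'a" "R / 2"] by (simp add: less_top)
        fix x :: 'a
        show "(k / 2) powr p * indicator (ball 0 (R / 2)) x \<le> \<bar>v x\<bar> powr p"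
        proof (cases "x \<in> ball 0 (R / 2)")
          case True
          then have "1 / 2 \<le> hat R x" using R by (auto simp: hat_def field_simps)
          then have "k * (1 / 2) \<le> k * hat R x" using k by (intro mult_left_mono) auto
          then have "(k / 2) powr p \<le> \<bar>v x\<bar> powr p" using k p unfolding v_def
            by (intro powr_mono2) auto
          then show ?thesis using True by simp
        qed simp
      qed
      finally show ?thesis .
    qed
    show ?thesis using vH v1 v2 v3 by blast
  qed
  ultimately show ?thesis using that unfolding N_def by blast
qed

section \<open>Lowering the energy by adding mass\<close>

lemma S_eq: "u \<in> S c \<longleftrightarrow> u \<in> H1 \<and> nsq lborel u = c"
  by (simp add: S_def nsq_def)

lemma energy_sqrt_sum_sq:
  assumes u: "u \<in> H1" and v: "v \<in> H1"
  shows "energy a b p q h (\<lambda>x. sqrt ((u x)\<^sup>2 + (v x)\<^sup>2))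
     \<le> kin (dirichlet u + dirichlet v) - (P u + P v) / p - Q (\<lambda>x. sqrt ((u x)\<^sup>2 + (v x)\<^sup>2)) / q"
  unfolding energy_eq using P_sqrt_sum_sq[OF u v] kin_mono[OF dirichlet_nonneg H1_sqrt_sum_sq(2)[OF
      u v]] p q
  by (intro diff_mono divide_right_mono) auto

text \<open>A widely spread profile costs less gradient energy than it gains, because
  \<open>N (p - 2) / 2 < 2\<close>.\<close>
lemma add_mass_decreases_energy:
  assumes u: "u \<in> H1" and mass: "nsq lborel u < c"
  obtains w where "w \<in> S c" "energy a b p q h w < energy a b p q h u"
proof -
  define \<beta> where "\<beta> = c - nsq lborel u"
  have \<beta>: "\<beta> > 0" using mass by (simp add: \<beta>_def)
  \<comment> \<open>The decay exponent of the L^p term of the spread profile. That it lies below the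
    decay exponent 2 of the gradient is the condition \<open>p < 2 + 4 / N\<close>.\<close>
  define t where "t = real DIM('a) * (p - 2) / 2"
  have t: "t < 2" using p by (simp add: t_def field_simps)
  obtain C1 C2 where C: "C1 > 0" "C2 > 0"
    "\<And>R. R > 0 \<Longrightarrow> \<exists>v :: 'a \<Rightarrow> real. v \<in> H1 \<and> nsq lborel v = \<beta> \<and> dirichlet v \<le> C1 * R powr (-2) \<and> P v
        \<ge> C2 * R powr (- t)"
    using spread_profile[OF \<beta>] unfolding t_def by metis
  define A where "A = dirichlet u"
  have A: "A \<ge> 0" unfolding A_def by (rule dirichlet_nonneg)
  \<comment> \<open>A Lipschitz constant of \<open>kin\<close> on \<open>[0, A + C1]\<close>, the
    range reached once \<open>R \<ge> 1\<close> ensures \<open>dirichlet v \<le> C1\<close>.\<close>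
  define L where "L = a + b * (A + C1)"
  have L: "L > 0" unfolding L_def using a b A C by (intro add_pos_nonneg) auto
  \<comment> \<open>The cost \<open>L * C1 * R powr (-2)\<close> is below the gain
    \<open>C2 * R powr (- t) / p\<close> exactly when this product is below
    \<open>C2\<close>.\<close>
  have "((\<lambda>R. (L * C1 * p) * R powr (- (2 - t))) \<longlongrightarrow> 0) at_top"
    by (rule tendsto_powr_neg_at_top) (use t in simp)
  then have "\<forall>\<^sub>F R in at_top. (L * C1 * p) * R powr (- (2 - t)) < C2"
    by (rule order_tendstoD(2)) (rule C)
  moreover have "\<forall>\<^sub>F R in at_top. R \<ge> (1::real)" by (rule eventually_ge_at_top)
  ultimately have "\<forall>\<^sub>F R in at_top. (L * C1 * p) * R powr (- (2 - t)) < C2 \<and> R \<ge> (1::real)"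
    by (rule eventually_conj)
  then obtain R where R: "(L * C1 * p) * R powr (- (2 - t)) < C2" "R \<ge> 1"
    using eventually_happens'[OF trivial_limit_at_top_linorder] by blast
  obtain v where v: "v \<in> H1" "nsq lborel v = \<beta>" "dirichlet v \<le> C1 * R powr (-2)" "P v
      \<ge> C2 * R powr (- t)"
    using C(3)[of R] R by auto
  define w where "w x = sqrt ((u x)\<^sup>2 + (v x)\<^sup>2)" for x
  have "w \<in> S c" unfolding S_eq w_def[abs_def] using H1_sqrt_sum_sq[OF u v(1)] v(2)
    by (simp add: \<beta>_def)
  moreover have "energy a b p q h w < energy a b p q h u"
  proof -
    have R2: "R powr (-2) \<le> 1" using R(2) powr_mono[of "-2" 0 R] by simp
    have B1: "dirichlet v \<le> C1"
      by (rule order_trans[OF v(3) mult_left_le[OF R2]]) (use C in simp)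
    have "energy a b p q h w \<le> kin (A + dirichlet v) - (P u + P v) / p - Q w / q"
      unfolding w_def[abs_def] A_def by (rule energy_sqrt_sum_sq[OF u v(1)])
    moreover have "kin (A + dirichlet v) \<le> kin A + L * dirichlet v"
      unfolding L_def by (rule kin_lipschitz) (use A B1 C dirichlet_nonneg[of v] in auto)
    moreover have "L * dirichlet v < P v / p"
    proof -
      have "L * dirichlet v \<le> L * (C1 * R powr (-2))" using v(3) L by (intro mult_left_mono) auto
      also have "\<dots> = (L * C1 * p) * R powr (- (2 - t)) * R powr (- t) / p"
      proof -
        have "R powr (- (2 - t)) * R powr (- t) = R powr (-2)"
          by (simp only: powr_add[symmetric]) simp
        then show ?thesis using p by (simp add: mult.assoc)
      qed
      also have "\<dots> < C2 * R powr (- t) / p"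
        using R p by (intro divide_strict_right_mono mult_strict_right_mono) auto
      also have "\<dots> \<le> P v / p" using v(4) p by (intro divide_right_mono) auto
      finally show ?thesis .
    qed
    moreover have "Q u / q \<le> Q w / q" unfolding w_def[abs_def] using Q_sqrt_sum_sq[OF u v(1)] q
      by (intro divide_right_mono) auto
    ultimately show ?thesis unfolding energy_eq[of u] A_def[symmetric] add_divide_distrib
      by linarith
  qed
  ultimately show ?thesis using that by blast
qed

text \<open>The whole mass \<open>c\<close> is added to the zero function.\<close>

lemma S_nonempty: assumes "c > 0" shows "S c \<noteq> ({} :: ('a \<Rightarrow> real) set)"
proof -
  have "nsq lborel (\<lambda>x::'a. 0::real) < c" using assms by (simp add: nsq_def)
  from add_mass_decreases_energy[OF H1_zero this] show ?thesis by blast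
qed

section \<open>Uniform gain of the h-term from translated mass\<close>

lemma h_positive_set:
  fixes u :: "'a \<Rightarrow> real"
  assumes u: "sqint lborel u"
  obtains E \<eta> K R where "E \<in> sets borel" "E \<subseteq> ball 0 R" "emeasure lborel E > 0" "\<eta> > 0" "K \<ge> 0"
    "\<And>x. x \<in> E \<Longrightarrow> h x \<ge> \<eta> \<and> \<bar>u x\<bar> \<le> K"
proof -
  have [measurable]: "u \<in> borel_measurable borel" "h \<in> borel_measurable borel" using u h_meas
    by (auto simp: sqint_def)
  \<comment> \<open>One index for three bounds: these sets exhaust \<open>{x. h x > 0}\<close>, so
    by countable subadditivity one of them has positive measure.\<close>
  define E where "E j = {x::'a. norm x < real j \<and> h x \<ge> 1 / real (Suc j) \<and> \<bar>u x\<bar> \<le> real j}" for j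
  have [measurable]: "E j \<in> sets borel" for j unfolding E_def by measurable
  have sub: "{x. h x > 0} \<subseteq> (\<Union>j. E j)"
  proof
    fix x assume "x \<in> {x. h x > 0}"
    then have hx: "h x > 0" by simp
    obtain j1 where j1: "norm x < real j1" using reals_Archimedean2 by blast
    obtain j2 where j2: "1 / real (Suc j2) < h x" using nat_approx_posE[OF hx] by blast
    obtain j3 where j3: "\<bar>u x\<bar> < real j3" using reals_Archimedean2 by blast
    define j where "j = j1 + j2 + j3"
    have "1 / real (Suc j) \<le> 1 / real (Suc j2)" by (intro divide_left_mono) (auto simp: j_def)
    then have "x \<in> E j" using j1 j2 j3 by (auto simp: E_def j_def)
    then show "x \<in> (\<Union>j. E j)" by blast
  qed
  have "\<exists>j. emeasure lborel (E j) > 0"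
  proof (rule ccontr)
    assume "\<nexists>j. emeasure lborel (E j) > 0"
    then have "E j \<in> null_sets lborel" for j by (auto simp: null_sets_def zero_less_iff_neq_zero)
    then have "(\<Union>j. E j) \<in> null_sets lborel" by (rule null_sets_UN)
    then have "emeasure lborel {x. h x > 0} \<le> 0"
      using emeasure_mono[OF sub, of lborel] by (auto simp: null_sets_def)
    then show False using h_pos by simp
  qed
  then obtain j where j: "emeasure lborel (E j) > 0" by blast
  show ?thesis by (rule that[of "E j" "real j" "1 / real (Suc j)" "real j"]) (use j in \<open>auto simp:
      E_def\<close>)
qed

text \<open>Off the set where \<open>v\<close> exceeds \<open>k / 2\<close> the average is at most
  \<open>k / 2\<close>, so that set carries the other half. By Cauchy-Schwarz and the mass bound it
  cannot be small: a Paley-Zygmund argument.\<close>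

lemma bavg_large_set:
  fixes v :: "'a \<Rightarrow> real"
  assumes v: "sqint lborel v" and m: "nsq lborel v \<le> m" "m > 0" and e: "e > 0" and k: "k > 0"
      and big: "\<bar>bavg e v x0\<bar> > k"
  shows "measure lborel {z \<in> ball 0 e. \<bar>v (x0 + z)\<bar> > k / 2} \<ge> (measure lborel (ball (0::'a) e))\<^sup>2 *
      k\<^sup>2 / (4 * m)"
proof -
  define V where "V = measure lborel (ball (0::'a) e)"
  have V: "V > 0" unfolding V_def using e by (rule content_ball_pos)
  have [measurable]: "v \<in> borel_measurable borel" using v by (simp add: sqint_def)
  define F where "F = {z \<in> ball 0 e. \<bar>v (x0 + z)\<bar> > k / 2}"
  have [measurable]: "ball (0::'a) e \<in> sets borel" by simp
  have Fm[measurable]: "F \<in> sets borel" unfolding F_def by measurable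
  have "F \<subseteq> ball 0 e" by (auto simp: F_def)
  then have Ff: "emeasure lborel F < \<infinity>"
    by (intro emeasure_bounded_finite) (rule bounded_subset[OF bounded_ball])
  note sF = sqint_indicator[OF _ Ff]
  note sv = sqint_shift'[OF v, of x0]
  have av: "sqint lborel (\<lambda>z. \<bar>v (x0 + z)\<bar>)" using sv by (simp add: sqint_def)
  have nv: "nsq lborel (\<lambda>z. \<bar>v (x0 + z)\<bar>) \<le> m"
    using nsq_shift[OF v, of x0] m by (simp add: nsq_def add.commute)
  note kb = ball_kernel[OF e, where 'a='a]
  have iF: "integrable lborel (\<lambda>z. indicator F z * \<bar>v (x0 + z)\<bar>)"
    using integrable_mult_sqint[OF sF av] by simp
  have "k < \<bar>bavg e v x0\<bar>" by (rule big)
  also have "\<dots> \<le> (LINT z|lborel. \<bar>ball_kernel e z * v (x0 + z)\<bar>)"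
    unfolding bavg_def by (rule integral_abs_bound)
  also have "\<dots> \<le> (LINT z|lborel. k / 2 * ball_kernel e z + 1 / V * (indicator F z * \<bar>v (x0 + z)\<bar>))"
  proof (rule integral_mono)
    show "integrable lborel (\<lambda>z. \<bar>ball_kernel e z * v (x0 + z)\<bar>)" using bavg_integrable[OF e v]
      by simp
    show "integrable lborel (\<lambda>z. k / 2 * ball_kernel e z + 1 / V * (indicator F z * \<bar>v (x0 + z)\<bar>))"
      using kb(1) iF by simp
    fix z :: 'a
    show "\<bar>ball_kernel e z * v (x0 + z)\<bar> \<le> k / 2 * ball_kernel e z + 1 / V * (indicator F z * \<bar>v (x0
        + z)\<bar>)"
    proof (cases "z \<in> ball 0 e")
      case True
      then have kz: "ball_kernel e z = 1 / V" by (simp add: ball_kernel_def V_def)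
      show ?thesis
      proof (cases "z \<in> F")
        case True
        then show ?thesis unfolding kz using V k by (simp add: abs_mult)
      next
        case False
        then have "\<bar>v (x0 + z)\<bar> \<le> k / 2" using True by (auto simp: F_def)
        then have "\<bar>v (x0 + z)\<bar> / V \<le> (k / 2) / V" using V by (intro divide_right_mono) auto
        then show ?thesis unfolding kz using V False by (simp add: abs_mult)
      qed
    next
      case False
      then show ?thesis using V by (simp add: ball_kernel_def)
    qed
  qed
  also have "\<dots> = k / 2 + 1 / V * (LINT z|lborel. indicator F z * \<bar>v (x0 + z)\<bar>)" using kb(1,3) iF
    by simp
  finally have "V * k / 2 < (LINT z|lborel. indicator F z * \<bar>v (x0 + z)\<bar>)" using V
    by (simp add: field_simps)
  then have "(V * k / 2)\<^sup>2 \<le> (LINT z|lborel. indicator F z * \<bar>v (x0 + z)\<bar>)\<^sup>2" using V k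
    by (intro power_mono) auto
  also have "\<dots> \<le> nsq lborel (indicator F :: 'a \<Rightarrow> real) * nsq lborel (\<lambda>z. \<bar>v (x0 + z)\<bar>)"
    using ip_sq_le[OF sF av] by (simp add: ip_def)
  also have "\<dots> \<le> measure lborel F * m"
  proof (rule mult_mono)
    have *: "(\<lambda>x. (norm (indicator F x :: real))\<^sup>2) = indicator F"
      by (auto simp: fun_eq_iff split: split_indicator)
    show "nsq lborel (indicator F :: 'a \<Rightarrow> real) \<le> measure lborel F" unfolding nsq_def * by simp
  qed (use nv nsq_nonneg in auto)
  finally show ?thesis unfolding F_def[symmetric] V_def[symmetric] using m(2)
    by (simp add: field_simps power_mult_distrib power_divide)
qed

text \<open>The overlap, integrated over all translations, is the product of the two measures.\<close>
lemma translate_overlap: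
  fixes E F :: "'a set"
  assumes [measurable]: "E \<in> sets borel" "F \<in> sets borel" and E: "E \<subseteq> ball 0 R"
      and F: "F \<subseteq> ball 0 e"
    and pos: "measure lborel E > 0" "measure lborel F \<ge> f" "f > 0"
  shows "\<exists>z. measure lborel {x \<in> E. x + z \<in> F} \<ge> measure lborel E * f / (2 * measure lborel (ball
      (0::'a) (R + e)))"
proof (rule ccontr)
  define B where "B = ball (0::'a) (R + e)"
  have [measurable]: "B \<in> sets borel" by (simp add: B_def)
  have fin: "emeasure lborel E < \<infinity>" "emeasure lborel F < \<infinity>" "emeasure lborel B < \<infinity>"
    unfolding B_def using bounded_subset[OF bounded_ball E] bounded_subset[OF bounded_ball F]
        bounded_ball
    by (blast intro: emeasure_bounded_finite[folded infinity_ennreal_def])+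
  have mE: "emeasure lborel E = ennreal (measure lborel E)"
      and mF: "emeasure lborel F = ennreal (measure lborel F)"
    and mB: "emeasure lborel B = ennreal (measure lborel B)"
    using fin by (auto simp: emeasure_eq_ennreal_measure less_top)
  have "E \<noteq> {}" "F \<noteq> {}" using pos by auto
  then obtain x y where "x \<in> E" "y \<in> F" by blast
  then have Re: "R + e > 0" using E F norm_ge_zero[of x] norm_ge_zero[of y]
    by (smt (verit, best) mem_ball_0 subsetD)
  have Bpos: "measure lborel B > 0" unfolding B_def using Re by (rule content_ball_pos)
  \<comment> \<open>The factor 1/2 makes the contradiction strict: if every overlap were below
    \<open>\<rho>\<close>, their integral over \<open>B\<close> would be at most half of the product
    of \<open>measure lborel E\<close> and \<open>f\<close>.\<close>
  define \<rho> where "\<rho> = measure lborel E * f / (2 * measure lborel B)"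
  have \<rho>: "\<rho> \<ge> 0" using pos Bpos by (simp add: \<rho>_def)
  assume neg: "\<nexists>z. measure lborel {x \<in> E. x + z \<in> F} \<ge> measure lborel E * f / (2 * measure lborel
      (ball (0::'a) (R + e)))"
  \<comment> \<open>An overlap is possible only for \<open>z\<close> in \<open>B\<close>, because
    \<open>z\<close> is the difference of a point of \<open>F\<close> and a point of
    \<open>E\<close>.\<close>
  have th: "(\<integral>\<^sup>+x. indicator E x * indicator F (x + z) \<partial>lborel) \<le> ennreal \<rho> * indicator B z" for z
  proof (cases "z \<in> B")
    case True
    have "(\<integral>\<^sup>+x. indicator E x * indicator F (x + z) \<partial>lborel) = (\<integral>\<^sup>+x. indicator {x \<in> E. x
        + z \<in> F} x \<partial>lborel)"
      by (intro nn_integral_cong) (auto split: split_indicator)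
    also have "\<dots> = emeasure lborel {x \<in> E. x + z \<in> F}" by (intro nn_integral_indicator) measurable
    also have "\<dots> = ennreal (measure lborel {x \<in> E. x + z \<in> F})"
    proof (rule emeasure_eq_ennreal_measure)
      have "emeasure lborel {x \<in> E. x + z \<in> F} \<le> emeasure lborel E" by (intro emeasure_mono) auto
      then show "emeasure lborel {x \<in> E. x + z \<in> F} \<noteq> top" using fin(1) by (auto simp: top_unique)
    qed
    also have "\<dots> \<le> ennreal \<rho>" using neg unfolding \<rho>_def B_def
      by (intro ennreal_leI) (auto simp: not_le less_imp_le)
    finally show ?thesis using True by simp
  next
    case False
    have zero: "indicator E x * indicator F (x + z) = (0::ennreal)" for x
    proof (rule ccontr)
      assume "\<not> ?thesis"
      then have "x \<in> E" "x + z \<in> F" by (auto split: split_indicator_asm)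
      then have "norm x < R" "norm (x + z) < e" using E F by auto
      then have "norm z < R + e" using norm_triangle_ineq4[of "x + z" x] by simp
      then show False using False by (simp add: B_def)
    qed
    show ?thesis unfolding zero by simp
  qed
  have "emeasure lborel E * emeasure lborel F = (\<integral>\<^sup>+x. indicator E x * emeasure lborel F \<partial>lborel)"
    by (subst nn_integral_multc) auto
  also have "\<dots> = (\<integral>\<^sup>+x. \<integral>\<^sup>+z. indicator E x * indicator F (x + z) \<partial>lborel \<partial>lborel)"
  proof (intro nn_integral_cong)
    fix x :: 'a
    have "(\<integral>\<^sup>+z. indicator F (x + z) \<partial>lborel) = emeasure lborel F"
      using nn_integral_lborel_shift[of "indicator F" x] by (simp add: add.commute)
    then show "indicator E x * emeasure lborel F = (\<integral>\<^sup>+z. indicator E x * indicator F (x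
        + z) \<partial>lborel)"
      by (subst nn_integral_cmult) auto
  qed
  also have "\<dots> = (\<integral>\<^sup>+z. \<integral>\<^sup>+x. indicator E x * indicator F (x + z) \<partial>lborel \<partial>lborel)"
    by (rule lborel_pair.Fubini') measurable
  also have "\<dots> \<le> (\<integral>\<^sup>+z. ennreal \<rho> * indicator B z \<partial>lborel)" by (intro nn_integral_mono th)
  also have "\<dots> = ennreal \<rho> * emeasure lborel B" by (simp add: nn_integral_cmult)
  finally have "measure lborel E * measure lborel F \<le> \<rho> * measure lborel B"
    unfolding mE mF mB using \<rho> by (simp add: ennreal_mult[symmetric])
  also have "\<dots> = measure lborel E * f / 2" using Bpos by (simp add: \<rho>_def)
  also have "\<dots> < measure lborel E * f" using pos by simp
  also have "\<dots> \<le> measure lborel E * measure lborel F" using pos by (intro mult_left_mono) auto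
  finally show False by simp
qed

text \<open>On the overlap \<open>h\<close> is at least \<open>\<eta>\<close>, \<open>u\<close> is
  at most \<open>K\<close> and the translate of \<open>v\<close> is at least \<open>k / 2\<close>,
  so the integrand grows by at least \<open>\<eta> * \<kappa>\<close>. The measure of the overlap is
  at least \<open>\<rho>\<close>, which depends on \<open>v\<close> only through \<open>m\<close>,
  \<open>e\<close> and \<open>k\<close>; hence \<open>d\<close> is uniform.\<close>

lemma translation_gain:
  assumes u: "u \<in> H1" and m: "m > 0" and e: "e > 0" and k: "k > 0"
  obtains d where "d > 0"
    "\<And>v :: 'a \<Rightarrow> real. v \<in> H1 \<Longrightarrow> nsq lborel v \<le> m \<Longrightarrow> \<exists>x. \<bar>bavg e v x\<bar> > k \<Longrightarrow>
       \<exists>z. Q (\<lambda>x. sqrt ((u x)\<^sup>2 + (v (x + z))\<^sup>2)) \<ge> Q u + d"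
proof -
  obtain E \<eta> K R where E[measurable]: "E \<in> sets borel" and E2: "E \<subseteq> ball 0 R" "emeasure lborel E
      > 0" and \<eta>: "\<eta> > 0" and K: "K \<ge> 0"
    and EhK: "\<And>x. x \<in> E \<Longrightarrow> h x \<ge> \<eta> \<and> \<bar>u x\<bar> \<le> K"
    using h_positive_set[OF H1_sqint[OF u]] by metis
  have "emeasure lborel E < \<infinity>" using E2(1)
    by (intro emeasure_bounded_finite) (rule bounded_subset[OF bounded_ball])
  then have mE: "measure lborel E > 0" using E2(2)
    by (simp add: measure_def enn2real_positive_iff less_top)
  obtain \<kappa> where \<kappa>: "\<kappa> > 0" "\<And>s y. 0 \<le> s \<Longrightarrow> s \<le> K\<^sup>2 \<Longrightarrow> (k / 2)\<^sup>2 \<le> y \<Longrightarrow> (s + y) powr (q / 2)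
      - s powr (q / 2) \<ge> \<kappa>"
    using powr_increment_bound[of "q / 2" "(k/2)\<^sup>2" "K\<^sup>2"] q k by auto
  define f where "f = (measure lborel (ball (0::'a) e))\<^sup>2 * k\<^sup>2 / (4 * m)"
  have f: "f > 0" unfolding f_def using content_ball_pos[OF e, of "0::'a"] k m by simp
  define \<rho> where "\<rho> = measure lborel E * f / (2 * measure lborel (ball (0::'a) (R + e)))"
  define d where "d = \<eta> * \<kappa> * \<rho>"
  have "E \<noteq> {}" using mE by auto
  then obtain x where "x \<in> E" by blast
  then have "norm x < R" using E2(1) by auto
  then have "R + e > 0" using e norm_ge_zero[of x] by linarith
  then have \<rho>: "\<rho> > 0" unfolding \<rho>_def using content_ball_pos[of "R + e" "0::'a"] f mE by simp
  have "d > 0" unfolding d_def using \<eta> \<kappa> \<rho> by simp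
  moreover have "\<exists>z. Q (\<lambda>x. sqrt ((u x)\<^sup>2 + (v (x + z))\<^sup>2)) \<ge> Q u + d"
    if v: "v \<in> H1" "nsq lborel v \<le> m" and big: "\<exists>x. \<bar>bavg e v x\<bar> > k" for v :: "'a \<Rightarrow> real"
  proof -
    obtain x0 where x0: "\<bar>bavg e v x0\<bar> > k" using big by blast
    have [measurable]: "v \<in> borel_measurable borel" "u \<in> borel_measurable borel"
      using H1_sqint[OF v(1)] H1_sqint[OF u] by (auto simp: sqint_def)
    define F where "F = {z \<in> ball 0 e. \<bar>v (x0 + z)\<bar> > k / 2}"
    have [measurable]: "ball (0::'a) e \<in> sets borel" by simp
    have Fm[measurable]: "F \<in> sets borel" unfolding F_def by measurable
    have "measure lborel F \<ge> f" unfolding F_def f_def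
      by (rule bavg_large_set[OF H1_sqint[OF v(1)] v(2) m e k x0])
    moreover have "F \<subseteq> ball 0 e" by (auto simp: F_def)
    ultimately obtain y where y: "measure lborel {x \<in> E. x + y \<in> F} \<ge> \<rho>"
      using translate_overlap[OF E Fm E2(1) _ mE _ f] unfolding \<rho>_def by blast
    define G where "G = {x \<in> E. x + y \<in> F}"
    have [measurable]: "G \<in> sets borel" unfolding G_def by measurable
    have "G \<subseteq> ball 0 R" using E2(1) by (auto simp: G_def)
    then have Gf: "emeasure lborel G < \<infinity>"
      by (intro emeasure_bounded_finite) (rule bounded_subset[OF bounded_ball])
    \<comment> \<open>\<open>x0\<close> brings the set where \<open>v\<close> is large to the
      origin, and \<open>y\<close> moves it onto \<open>E\<close>.\<close>
    define z where "z = x0 + y"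
    define w where "w x = sqrt ((u x)\<^sup>2 + (v (x + z))\<^sup>2)" for x
    have wH: "w \<in> H1" unfolding w_def[abs_def]
      by (rule H1_sqrt_sum_sq(1)[OF u H1_shift(1)[OF v(1)]])
    have iu: "integrable lborel (\<lambda>x. h x * \<bar>u x\<bar> powr q)" by (rule Q_integrable[OF H1_sqint[OF u]])
    have iG: "integrable lborel (\<lambda>x. \<eta> * \<kappa> * indicator G x)" using Gf by (simp add: less_top)
    have "Q u + d \<le> Q u + \<eta> * \<kappa> * measure lborel G"
      using y \<eta> \<kappa> unfolding d_def G_def[symmetric] by simp
    also have "\<dots> = (LINT x|lborel. h x * \<bar>u x\<bar> powr q + \<eta> * \<kappa> * indicator G x)" using iu iG by simp
    also have "\<dots> \<le> Q w"
    proof (rule integral_mono)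
      show "integrable lborel (\<lambda>x. h x * \<bar>u x\<bar> powr q + \<eta> * \<kappa> * indicator G x)" using iu iG by simp
      show "integrable lborel (\<lambda>x. h x * \<bar>w x\<bar> powr q)" by (rule Q_integrable[OF H1_sqint[OF wH]])
      fix x
      show "h x * \<bar>u x\<bar> powr q + \<eta> * \<kappa> * indicator G x \<le> h x * \<bar>w x\<bar> powr q"
      proof (cases "x \<in> G")
        case True
        then have x: "x \<in> E" "x + y \<in> F" by (auto simp: G_def)
        have "\<bar>v (x + z)\<bar> > k / 2" using x(2) by (simp add: F_def z_def add_ac)
        then have "(k / 2)\<^sup>2 \<le> \<bar>v (x + z)\<bar>\<^sup>2" using k by (intro power_mono) auto
        moreover have "\<bar>u x\<bar>\<^sup>2 \<le> K\<^sup>2" using EhK[OF x(1)] by (intro power_mono) auto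
        ultimately have "((u x)\<^sup>2 + (v (x + z))\<^sup>2) powr (q / 2) - ((u x)\<^sup>2) powr (q / 2) \<ge> \<kappa>"
          using \<kappa>(2)[of "(u x)\<^sup>2"] by simp
        then have "\<bar>w x\<bar> powr q - \<bar>u x\<bar> powr q \<ge> \<kappa>" by (simp only: abs_powr_eq_sq_powr w_def) simp
        then have "\<eta> * \<kappa> \<le> h x * (\<bar>w x\<bar> powr q - \<bar>u x\<bar> powr q)"
          using EhK[OF x(1)] \<eta> \<kappa>(1) by (intro mult_mono) auto
        then show ?thesis using True by (simp add: right_diff_distrib)
      next
        case False
        then show ?thesis unfolding w_def using Q_pointwise_mono by simp
      qed
    qed
    finally show ?thesis unfolding w_def by blast
  qed
  ultimately show ?thesis using that by blast
qed

end

section \<open>Minimizers and the Euler--Lagrange equation\<close>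

text \<open>A supporting line for a convex function. At \<open>x = 0\<close> the slope is 0 because
  of \<open>sgn\<close>, which is still a subgradient when \<open>r = 1\<close>. For
  \<open>x > 0\<close> and \<open>x + y \<le> 0\<close> the line is already nonpositive; negative
  \<open>x\<close> follows by reflection.\<close>

lemma powr_tangent:
  fixes r x y :: real
  assumes r: "r \<ge> 1"
  shows "\<bar>x\<bar> powr r + r * (sgn x * \<bar>x\<bar> powr (r - 1)) * y \<le> \<bar>x + y\<bar> powr r"
proof -
  have pos: "s powr r + r * s powr (r - 1) * d \<le> \<bar>s + d\<bar> powr r" if s: "s > 0" for s d :: real
  proof (cases "s + d > 0")
    case True
    have "(\<lambda>x. x powr r) (s + d) - s powr r \<ge> (r * s powr (r - 1)) * ((s + d) - s)"
    proof (rule convex_on_imp_above_tangent[OF powr_convex[OF r]])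
      show "((\<lambda>x. x powr r) has_real_derivative r * s powr (r - 1)) (at s within {0<..})"
        using s by (intro has_real_derivative_powr[THEN has_field_derivative_at_within]) auto
    qed (use s True in \<open>auto simp: interior_open\<close>)
    then show ?thesis using True by simp
  next
    case False
    have "s powr r = s powr (r - 1) * s" using s by (simp add: powr_diff)
    then have "s powr r + r * s powr (r - 1) * d = s powr (r - 1) * (s + r * d)"
      by (simp add: algebra_simps)
    also have "\<dots> \<le> 0"
    proof (rule mult_nonneg_nonpos)
      have "d \<le> - s" using False by simp
      then have "r * d \<le> 1 * d" using s r by (intro mult_right_mono_neg) auto
      then show "s + r * d \<le> 0" using False by simp
    qed simp
    also have "0 \<le> \<bar>s + d\<bar> powr r" by simp
    finally show ?thesis .
  qed
  consider "x > 0" | "x = 0" | "x < 0" by linarith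
  then show ?thesis
  proof cases
    case 1 then show ?thesis using pos[of x y] by simp
  next
    case 2 then show ?thesis using r by simp
  next
    case 3
    then have "\<bar>x + y\<bar> = \<bar>(-x) + (-y)\<bar>" by simp
    then show ?thesis using pos[of "-x" "-y"] 3 by simp
  qed
qed

section \<open>The Euler-Lagrange equation\<close>

context kirchhoff
begin

text \<open>Replacing both factors by the larger of \<open>\<bar>s\<bar>\<close> and
  \<open>\<bar>t\<bar>\<close> bounds the product by
  \<open>\<bar>s\<bar> powr r + \<bar>t\<bar> powr r\<close>. This covers \<open>r = 1\<close>,
  where no conjugate exponent is at hand.\<close>

lemma integrable_power_pairing:
  assumes u: "u \<in> H1" and v: "v \<in> H1"
  shows "integrable lborel (\<lambda>x. sgn (u x) * \<bar>u x\<bar> powr (p - 1) * v x)"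
    "integrable lborel (\<lambda>x. h x * sgn (u x) * \<bar>u x\<bar> powr (q - 1) * v x)"
proof -
  have [measurable]: "u \<in> borel_measurable lborel" "v \<in> borel_measurable lborel"
    using H1_sqint[OF u] H1_sqint[OF v] by (auto simp: sqint_def)
  have bd: "\<bar>sgn s * \<bar>s\<bar> powr (r - 1) * t\<bar> \<le> \<bar>s\<bar> powr r + \<bar>t\<bar> powr r" if r: "r \<ge> 1"
      for s t r :: real
  proof (cases "s = 0 \<or> t = 0")
    case False
    define M where "M = max \<bar>s\<bar> \<bar>t\<bar>"
    have M: "M > 0" "\<bar>s\<bar> \<le> M" "\<bar>t\<bar> \<le> M" using False by (auto simp: M_def)
    have "\<bar>sgn s * \<bar>s\<bar> powr (r - 1) * t\<bar> = \<bar>s\<bar> powr (r - 1) * \<bar>t\<bar>" using False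
      by (simp add: abs_mult)
    also have "\<dots> \<le> M powr (r - 1) * M" using M r by (intro mult_mono powr_mono2) auto
    also have "\<dots> = M powr r" using M by (simp add: powr_diff)
    also have "\<dots> \<le> \<bar>s\<bar> powr r + \<bar>t\<bar> powr r" by (auto simp: M_def max_def)
    finally show ?thesis .
  qed auto
  have "integrable lborel (\<lambda>x. \<bar>u x\<bar> powr p + \<bar>v x\<bar> powr p)"
    using P_integrable[OF u] P_integrable[OF v] by simp
  then show "integrable lborel (\<lambda>x. sgn (u x) * \<bar>u x\<bar> powr (p - 1) * v x)"
  proof (rule Bochner_Integration.integrable_bound)
    show "AE x in lborel. norm (sgn (u x) * \<bar>u x\<bar> powr (p - 1) * v x) \<le> norm (\<bar>u x\<bar> powr p
        + \<bar>v x\<bar> powr p)"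
      using bd[of p] p by (intro AE_I2) (simp del: abs_mult)
  qed measurable
  have "integrable lborel (\<lambda>x. h x * \<bar>u x\<bar> powr q + h x * \<bar>v x\<bar> powr q)"
    using Q_integrable[OF H1_sqint[OF u]] Q_integrable[OF H1_sqint[OF v]] by simp
  then show "integrable lborel (\<lambda>x. h x * sgn (u x) * \<bar>u x\<bar> powr (q - 1) * v x)"
  proof (rule Bochner_Integration.integrable_bound)
    have "norm (h x * sgn (u x) * \<bar>u x\<bar> powr (q - 1) * v x) \<le> norm (h x * \<bar>u x\<bar> powr q + h x * \<bar>v x\<bar>
        powr q)" for x
    proof -
      have "norm (h x * sgn (u x) * \<bar>u x\<bar> powr (q - 1) * v x) = h x * \<bar>sgn (u x) * \<bar>u x\<bar> powr (q
          - 1) * v x\<bar>"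
        using h_nonneg[of x] by (simp add: abs_mult)
      also have "\<dots> \<le> h x * (\<bar>u x\<bar> powr q + \<bar>v x\<bar> powr q)" using h_nonneg[of x] bd[of q] q
        by (intro mult_left_mono) auto
      finally show ?thesis by (simp add: distrib_left)
    qed
    then show "AE x in lborel. norm (h x * sgn (u x) * \<bar>u x\<bar> powr (q - 1) * v x)
        \<le> norm (h x * \<bar>u x\<bar> powr q + h x * \<bar>v x\<bar> powr q)"
      by (intro AE_I2)
  qed measurable
qed

text \<open>Both power terms enter the energy with a negative sign, so convexity bounds the energy along
  a line from above by a function that is differentiable even when \<open>q = 1\<close>.\<close>
lemma power_terms_tangent:
  assumes u: "u \<in> H1" and v: "v \<in> H1"
  shows "P u + t * (p * dP u v) \<le> P (\<lambda>x. u x + t * v x)"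
    "Q u + t * (q * dQ u v) \<le> Q (\<lambda>x. u x + t * v x)"
proof -
  note ip = integrable_power_pairing[OF u v]
  have w: "(\<lambda>x. u x + t * v x) \<in> H1" by (rule H1_lin(1)[OF u v])
  have "P u + t * (p * dP u v)
     = (LINT x|lborel. \<bar>u x\<bar> powr p + t * (p * (sgn (u x) * \<bar>u x\<bar> powr (p - 1) * v x)))"
    using P_integrable[OF u] ip(1) by simp
  also have "\<dots> \<le> P (\<lambda>x. u x + t * v x)"
  proof (rule integral_mono[OF _ P_integrable[OF w]])
    show "integrable lborel (\<lambda>x. \<bar>u x\<bar> powr p + t * (p * (sgn (u x) * \<bar>u x\<bar> powr (p - 1) * v x)))"
      using P_integrable[OF u] ip(1) by simp
    show "\<bar>u x\<bar> powr p + t * (p * (sgn (u x) * \<bar>u x\<bar> powr (p - 1) * v x)) \<le> \<bar>u x + t * v x\<bar> powr p"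
        for x
      using powr_tangent[of p "u x" "t * v x"] p by (simp add: mult_ac)
  qed
  finally show "P u + t * (p * dP u v) \<le> P (\<lambda>x. u x + t * v x)" .
  have "Q u + t * (q * dQ u v)
     = (LINT x|lborel. h x * \<bar>u x\<bar> powr q + t * (q * (h x * sgn (u x) * \<bar>u x\<bar> powr (q - 1) * v x)))"
    using Q_integrable[OF H1_sqint[OF u]] ip(2) by simp
  also have "\<dots> \<le> Q (\<lambda>x. u x + t * v x)"
  proof (rule integral_mono[OF _ Q_integrable[OF H1_sqint[OF w]]])
    show "integrable lborel (\<lambda>x. h x * \<bar>u x\<bar> powr q + t * (q * (h x * sgn (u x) * \<bar>u x\<bar> powr (q
        - 1) * v x)))"
      using Q_integrable[OF H1_sqint[OF u]] ip(2) by simp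
    fix x
    have "h x * (\<bar>u x\<bar> powr q + q * (sgn (u x) * \<bar>u x\<bar> powr (q - 1)) * (t * v x))
        \<le> h x * \<bar>u x + t * v x\<bar> powr q"
      using powr_tangent[of q "u x" "t * v x"] q h_nonneg[of x] by (intro mult_left_mono) auto
    then show "h x * \<bar>u x\<bar> powr q + t * (q * (h x * sgn (u x) * \<bar>u x\<bar> powr (q - 1) * v x))
        \<le> h x * \<bar>u x + t * v x\<bar> powr q"
      by (simp add: distrib_left mult_ac)
  qed
  finally show "Q u + t * (q * dQ u v) \<le> Q (\<lambda>x. u x + t * v x)" .
qed

lemma PQ_scale:
  assumes "s > 0"
  shows "P (\<lambda>x. s * u x) = s powr p * P u" "Q (\<lambda>x. s * u x) = s powr q * Q u"
  using assms by (simp_all add: abs_mult powr_mult mult.left_commute[of "h _"])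

text \<open>After normalisation \<open>u + t * v\<close> lies in \<open>S c\<close>, so its energy
  is at least that of \<open>u\<close>. The function \<open>U\<close> bounds this energy from above
  and touches it at \<open>t = 0\<close>; hence \<open>U\<close> has a minimum there, and its
  derivative vanishes.\<close>

theorem minimizer_weak_solution:
  assumes c: "c > 0" and u: "u \<in> S c" and min: "\<And>v. v \<in> S c \<Longrightarrow> energy a b p q h u
      \<le> energy a b p q h v"
  shows "\<exists>lam. weak_solution a b p q h u lam"
proof -
  have uH: "u \<in> H1" and uc: "nsq lborel u = c" using u by (auto simp: S_eq)
  note su = H1_sqint[OF uH]
  define A where "A = dirichlet u"
  \<comment> \<open>The only possible multiplier: testing the equation with \<open>u\<close> itself
    gives \<open>(a + b * A) * A + lam * c = P u + Q u\<close>.\<close>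
  define lam where "lam = (P u + Q u - (a + b * A) * A) / c"
  have "(a + b * A) * ip lborel (wgrad u) (wgrad v) + lam * ip lborel u v =
     dP u v + dQ u v"
    if v: "v \<in> H1" for v
  proof -
    define X where "X = dP u v"
    define Y where "Y = dQ u v"
    define B where "B = ip lborel (wgrad u) (wgrad v)"
    define J where "J = ip lborel u v"
    define D where "D = dirichlet v"
    define M where "M = nsq lborel v"
    define mass where "mass t = c + 2 * t * J + t\<^sup>2 * M" for t
    \<comment> \<open>\<open>c / mass t\<close> is the squared normalisation factor. It scales the
      Dirichlet integral, and its powers \<open>p / 2\<close> and \<open>q / 2\<close> scale the
      tangents of the power terms.\<close>
    define U where "U t = a / 2 * ((A + 2 * t * B + t\<^sup>2 * D) * (c / mass t)) + b / 4 * ((A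
        + 2 * t * B + t\<^sup>2 * D) * (c / mass t))\<^sup>2
        - (c / mass t) powr (p / 2) * (P u + t * (p * X)) / p - (c / mass t) powr (q / 2) * (Q u + t
            * (q * Y)) / q" for t
    have m0: "mass 0 = c" by (simp add: mass_def)
    have "isCont mass 0" unfolding mass_def by (intro continuous_intros)
    then have "\<forall>\<^sub>F t in at 0. mass t > 0"
      using c m0 by (intro order_tendstoD(1)[where y="mass 0"]) (auto simp: isCont_def)
    then obtain d where d: "d > 0" "\<And>t. \<bar>t\<bar> < d \<Longrightarrow> mass t > 0"
      using c m0 unfolding eventually_at by (auto simp: dist_norm) metis
    have ge: "U 0 \<le> U t" if t: "\<bar>t\<bar> < d" for t
    proof -
      define w where "w x = u x + t * v x" for x
      have wH: "w \<in> H1" unfolding w_def[abs_def] by (rule H1_lin(1)[OF uH v])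
      have wm: "nsq lborel w = mass t"
        using nsq_add[OF su sqint_scaleR[OF H1_sqint[OF v]], of t] nsq_scaleR[of lborel t v]
            ip_scaleR[of lborel t v u]
        by (simp add: w_def[abs_def] mass_def J_def M_def uc ip_commute)
      have wd: "dirichlet w = A + 2 * t * B + t\<^sup>2 * D"
        unfolding w_def[abs_def] H1_lin(3)[OF uH v] A_def B_def D_def by simp
      define s where "s = sqrt (c / mass t)"
      have mt: "mass t > 0" by (rule d(2)[OF t])
      have s: "s > 0" "s\<^sup>2 = c / mass t" using c mt by (auto simp: s_def)
      have sp: "s powr r = (c / mass t) powr (r / 2)" for r
        using abs_powr_eq_sq_powr[of s r] s by simp
      have "(\<lambda>x. s * w x) \<in> S c"
        using H1_scale(1)[OF wH, of s] nsq_scaleR[of lborel s w] s mt by (simp add: S_eq wm)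
      then have "energy a b p q h u \<le> energy a b p q h (\<lambda>x. s * w x)" by (rule min)
      also have "\<dots> = kin ((A + 2 * t * B + t\<^sup>2 * D) * (c / mass t)) - (c / mass t) powr (p / 2) * P
          w / p - (c / mass t) powr (q / 2) * Q w / q"
        unfolding energy_eq PQ_scale[OF s(1)] sp H1_scale(2)[OF wH] wd s(2)
          by (simp add: mult.commute)
      also have "\<dots> \<le> U t"
        unfolding U_def kin_def
      proof (intro diff_mono divide_right_mono mult_left_mono order_refl)
        show "P u + t * (p * X) \<le> P w" "Q u + t * (q * Y) \<le> Q w"
          unfolding w_def X_def Y_def by (rule power_terms_tangent[OF uH v])+
      qed (use p q in auto)
      also have "energy a b p q h u = U 0"
        using c by (simp add: U_def m0 energy_eq kin_def A_def)
      finally show ?thesis .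
    qed
    have dm: "((\<lambda>t. c / mass t) has_real_derivative - (2 * J / c)) (at 0)"
      unfolding mass_def using c
      by (auto intro!: derivative_eq_intros simp: power2_eq_square field_simps)
    have dp: "((\<lambda>t. (c / mass t) powr r) has_real_derivative - (2 * J / c) * r) (at 0)" for r
      using DERIV_powr[OF dm, of "\<lambda>_. r" 0] c by (simp add: m0)
    have DU: "(U has_real_derivative (a / 2 * (2 * B - A * (2 * J / c)) + b / 4 * (2 * A * (2 * B
        - A * (2 * J / c)))
        - (- (2 * J / c) * (p / 2) * P u + p * X) / p - (- (2 * J / c) * (q / 2) * Q u + q * Y) /
            q)) (at 0)"
    proof -
      have dA: "((\<lambda>t. A + 2 * t * B + t\<^sup>2 * D) has_real_derivative 2 * B) (at 0)"
        by (auto intro!: derivative_eq_intros)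
      have dT: "((\<lambda>t. (A + 2 * t * B + t\<^sup>2 * D) * (c / mass t)) has_real_derivative 2 * B - A * (2 *
          J / c)) (at 0)"
        using DERIV_mult[OF dA dm] c by (simp add: m0 mult.commute)
      have d1: "((\<lambda>t. a / 2 * ((A + 2 * t * B + t\<^sup>2 * D) * (c / mass t))) has_real_derivative a / 2
          * (2 * B - A * (2 * J / c))) (at 0)"
        by (rule DERIV_cmult[OF dT])
      have d2: "((\<lambda>t. b / 4 * ((A + 2 * t * B + t\<^sup>2 * D) * (c / mass t))\<^sup>2) has_real_derivative b /
          4 * (2 * A * (2 * B - A * (2 * J / c)))) (at 0)"
        using DERIV_cmult[OF DERIV_power[OF dT, of 2], of "b / 4"] c by (simp add: m0 mult_ac)
      have dl: "((\<lambda>t. P0 + t * P1) has_real_derivative P1) (at 0)" for P0 P1 :: real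
        by (auto intro!: derivative_eq_intros)
      have d3: "((\<lambda>t. (c / mass t) powr (r / 2) * (P0 + t * (r * P1)) / r) has_real_derivative
           (- (2 * J / c) * (r / 2) * P0 + r * P1) / r) (at 0)" for r P0 P1
        using DERIV_cdivide[OF DERIV_mult[OF dp[of "r/2"] dl[of P0 "r * P1"]], of r] c
          by (simp add: m0)
      show ?thesis
        unfolding U_def[abs_def] by (rule DERIV_diff[OF DERIV_diff[OF DERIV_add[OF d1 d2] d3] d3])
    qed
    \<comment> \<open>Since \<open>t\<close> takes both signs the derivative is zero, which gives an
      equation and not only a variational inequality.\<close>
    have "a / 2 * (2 * B - A * (2 * J / c)) + b / 4 * (2 * A * (2 * B - A * (2 * J / c)))
        - (- (2 * J / c) * (p / 2) * P u + p * X) / p - (- (2 * J / c) * (q / 2) * Q u + q * Y) / q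
            = 0"
      by (rule DERIV_local_min[OF DU d(1)]) (use ge in auto)
    moreover have "(- (2 * J / c) * (p / 2) * P u + p * X) / p = X - J / c * P u" using p
      by (simp add: field_simps)
    moreover have "(- (2 * J / c) * (q / 2) * Q u + q * Y) / q = Y - J / c * Q u" using q
      by (simp add: field_simps)
    moreover have "a / 2 * (2 * B - A * (2 * J / c)) + b / 4 * (2 * A * (2 * B - A * (2 * J / c)))
        = (a + b * A) * (B - A * (J / c))"
    proof -
      have "a / 2 * (2 * B - A * (2 * k)) + b / 4 * (2 * A * (2 * B - A * (2 * k)))
          = (a + b * A) * (B - A * k)" for k
        by (simp add: algebra_simps)
      from this[of "J / c"] show ?thesis by (simp only: times_divide_eq_right)
    qed
    ultimately have "(a + b * A) * (B - A * (J / c)) + J / c * P u + J / c * Q u = X + Y"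
      by linarith
    moreover have "lam * J = (P u + Q u - (a + b * A) * A) * (J / c)" by (simp add: lam_def)
    moreover have "(a + b * A) * (B - A * (J / c)) + J / c * P u + J / c * Q u
        = (a + b * A) * B + (P u + Q u - (a + b * A) * A) * (J / c)"
    proof -
      have "(a + b * A) * (B - A * k) + k * P u + k * Q u = (a + b * A) * B + (P u + Q u - (a
          + b * A) * A) * k" for k
        by (simp add: algebra_simps)
      then show ?thesis .
    qed
    ultimately show ?thesis unfolding X_def[symmetric] Y_def[symmetric] B_def[symmetric]
        J_def[symmetric]
      by presburger
  qed
  then have "weak_solution a b p q h u lam"
    by (simp add: weak_solution_def ip_def A_def)
  then show ?thesis ..
qed

section \<open>Existence of a minimizer\<close>

lemma energy_bounded_below:
  assumes c: "c > 0"
  obtains K G where "\<And>u. u \<in> S c \<Longrightarrow> energy a b p q h u \<ge> - K"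
    "\<And>u. u \<in> S c \<Longrightarrow> energy a b p q h u \<le> E \<Longrightarrow> dirichlet u \<le> G"
proof -
  obtain C where C: "C > 0"
    "\<And>(u :: 'a \<Rightarrow> real) l K. u \<in> H1 \<Longrightarrow> nsq lborel u \<le> c \<Longrightarrow> l > 0 \<Longrightarrow> K > 0 \<Longrightarrow>
       P u \<le> l powr (p - 2) * nsq lborel u + K powr (p - 2) * tailsq l u + C * K powr (- (2 + 4 /
           real DIM('a) - p)) * dirichlet u"
    using power_integral_bound[OF c p] by metis
  define H where "H = (LINT x|lborel. \<bar>h x\<bar> powr (2 / (2 - q)))"
  \<comment> \<open>With both levels equal to 1, \<open>P u\<close> is at most
    \<open>2 * c + C * dirichlet u\<close>; \<open>c + H\<close> bounds \<open>Q u\<close> by Young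
    with \<open>e = 1\<close>. The last summand completes the square of
    \<open>b / 4 * A^2 - C / p * A\<close>, so the Kirchhoff term absorbs the linear one and
    \<open>a / 2 * dirichlet u\<close> remains for coercivity.\<close>
  define K where "K = 2 * c / p + (c + H) / q + (C / p)\<^sup>2 / b"
  have low: "energy a b p q h u \<ge> a / 2 * dirichlet u - K" if u: "u \<in> S c" for u
  proof -
    have uH: "u \<in> H1" and uc: "nsq lborel u = c" using u by (auto simp: S_eq)
    define A where "A = dirichlet u"
    have "P u \<le> c + c + C * A"
      using C(2)[OF uH, of 1 1] uc tailsq_integrable(2)[OF H1_sqint[OF uH], of 1]
        by (simp add: A_def)
    then have "P u / p \<le> (2 * c + C * A) / p" using p by (intro divide_right_mono) auto
    moreover have "Q u \<le> c + H"
    proof -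
      have i: "integrable lborel (\<lambda>x. (u x)\<^sup>2)" using H1_sqint[OF uH] by (simp add: sqint_def)
      have "Q u \<le> (LINT x|lborel. (u x)\<^sup>2 + \<bar>h x\<bar> powr (2 / (2 - q)))"
        using young[of 1] i h_int by (intro integral_mono Q_integrable[OF H1_sqint[OF uH]]) auto
      then show ?thesis using i h_int uc by (simp add: nsq_def H_def)
    qed
    then have "Q u / q \<le> (c + H) / q" using q by (intro divide_right_mono) auto
    moreover have "b / 4 * A\<^sup>2 - C / p * A + (C / p)\<^sup>2 / b \<ge> 0"
    proof -
      have "0 \<le> b * (A / 2 - C / p / b)\<^sup>2" using b by simp
      also have "\<dots> = b / 4 * A\<^sup>2 - C / p * A + (C / p)\<^sup>2 / b"
      proof -
        have "b * (A / 2 - x / b)\<^sup>2 = b / 4 * A\<^sup>2 - x * A + x\<^sup>2 / b" for x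
          using b by (simp add: power2_eq_square field_simps)
        then show ?thesis .
      qed
      finally show ?thesis .
    qed
    ultimately show ?thesis unfolding energy_eq kin_def K_def A_def[symmetric]
      by (simp add: add_divide_distrib)
  qed
  show ?thesis
  proof (rule that[of K "2 * (E + K) / a"])
    fix u :: "'a \<Rightarrow> real" assume u: "u \<in> S c"
    have "0 \<le> a / 2 * dirichlet u" using a dirichlet_nonneg[of u] by simp
    then show "energy a b p q h u \<ge> - K" using low[OF u] by linarith
    assume "energy a b p q h u \<le> E"
    then have "a / 2 * dirichlet u \<le> E + K" using low[OF u] by linarith
    then show "dirichlet u \<le> 2 * (E + K) / a" using a by (simp add: field_simps)
  qed
qed

text \<open>The upper half of the Brezis-Lieb lemma: \<open>powr_add_young\<close> with
  \<open>s = w x\<close> and \<open>t = u n x - w x\<close> is a domination whose defect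
  \<open>e * \<bar>u n x - w x\<bar> powr p\<close> is bounded in the mean.\<close>

lemma P_splitting:
  fixes u :: "nat \<Rightarrow> 'a \<Rightarrow> real"
  assumes u: "\<And>n. u n \<in> H1" and v: "\<And>n. (\<lambda>x. u n x - w x) \<in> H1" and w: "w \<in> H1"
    and lim: "AE x in lborel. (\<lambda>n. u n x) \<longlonglongrightarrow> w x" and B: "\<And>n. P (\<lambda>x. u n x - w x) \<le> B" and d: "d > 0"
  shows "\<forall>\<^sub>F n in sequentially. P (u n) \<le> P w + P (\<lambda>x. u n x - w x) + d"
proof -
  have "\<forall>\<^sub>F n in sequentially. (LINT x|lborel. \<bar>u n x\<bar> powr p - \<bar>u n x - w x\<bar> powr p - \<bar>w x\<bar> powr p)
      \<le> d"
  proof (rule eventually_integral_le)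
    show "integrable lborel (\<lambda>x. \<bar>u n x\<bar> powr p - \<bar>u n x - w x\<bar> powr p - \<bar>w x\<bar> powr p)" for n
      using P_integrable[OF u] P_integrable[OF v] P_integrable[OF w] by simp
    show "AE x in lborel. (\<lambda>n. \<bar>u n x\<bar> powr p - \<bar>u n x - w x\<bar> powr p - \<bar>w x\<bar> powr p) \<longlonglongrightarrow> 0"
      using lim
    proof eventually_elim
      case (elim x)
      have "(\<lambda>n. \<bar>u n x\<bar> powr p - \<bar>u n x - w x\<bar> powr p - \<bar>w x\<bar> powr p) \<longlonglongrightarrow> \<bar>w x\<bar> powr p - \<bar>w x
          - w x\<bar> powr p - \<bar>w x\<bar> powr p"
        using p by (intro tendsto_diff tendsto_powr' tendsto_rabs elim tendsto_const) auto
      then show ?case by simp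
    qed
    show "integrable lborel (\<lambda>x. \<bar>u n x - w x\<bar> powr p)" for n by (rule P_integrable[OF v])
    show "\<exists>Z. integrable lborel Z \<and> (\<forall>x. 0 \<le> Z x) \<and>
          (\<forall>n x. \<bar>u n x\<bar> powr p - \<bar>u n x - w x\<bar> powr p - \<bar>w x\<bar> powr p \<le> e * \<bar>u n x - w x\<bar> powr p + Z
              x)" if e: "e > 0" for e
    proof -
      obtain C where C: "C \<ge> 0" "\<And>s t. \<bar>s + t\<bar> powr p \<le> (1 + e) * \<bar>t\<bar> powr p + C * \<bar>s\<bar> powr p"
        using powr_add_young[OF e, of p] p by (metis less_trans zero_less_numeral)
      show ?thesis
      proof (intro exI[of _ "\<lambda>x. C * \<bar>w x\<bar> powr p"] conjI allI)
        show "integrable lborel (\<lambda>x. C * \<bar>w x\<bar> powr p)" using P_integrable[OF w] by simp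
        show "0 \<le> C * \<bar>w x\<bar> powr p" for x using C by simp
        fix n x
        have "\<bar>u n x\<bar> powr p \<le> (1 + e) * \<bar>u n x - w x\<bar> powr p + C * \<bar>w x\<bar> powr p"
          using C(2)[of "w x" "u n x - w x"] by simp
        moreover have "0 \<le> \<bar>w x\<bar> powr p" by simp
        ultimately show "\<bar>u n x\<bar> powr p - \<bar>u n x - w x\<bar> powr p - \<bar>w x\<bar> powr p
            \<le> e * \<bar>u n x - w x\<bar> powr p + C * \<bar>w x\<bar> powr p"
          unfolding distrib_right by linarith
      qed
    qed
  qed (use B d in auto)
  then show ?thesis
  proof eventually_elim
    case (elim n)
    then show ?case using P_integrable[OF u] P_integrable[OF v] P_integrable[OF w] by simp
  qed
qed

text \<open>\<open>young\<close> with arbitrarily small \<open>e\<close> bounds the integrand by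
  \<open>e * (u n x)^2\<close> plus a fixed integrable function of \<open>h\<close>; the remainder
  \<open>u n - w\<close> therefore contributes nothing in the limit.\<close>

lemma Q_upper_limit:
  fixes u :: "nat \<Rightarrow> 'a \<Rightarrow> real"
  assumes u: "\<And>n. sqint lborel (u n)" "\<And>n. nsq lborel (u n) \<le> B" and w: "sqint lborel w"
    and lim: "AE x in lborel. (\<lambda>n. u n x) \<longlonglongrightarrow> w x" and d: "d > 0"
  shows "\<forall>\<^sub>F n in sequentially. Q (u n) \<le> Q w + d"
proof -
  have "\<forall>\<^sub>F n in sequentially. (LINT x|lborel. h x * \<bar>u n x\<bar> powr q - h x * \<bar>w x\<bar> powr q) \<le> d"
  proof (rule eventually_integral_le)
    show "integrable lborel (\<lambda>x. h x * \<bar>u n x\<bar> powr q - h x * \<bar>w x\<bar> powr q)" for n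
      using Q_integrable[OF u(1)] Q_integrable[OF w] by simp
    show "AE x in lborel. (\<lambda>n. h x * \<bar>u n x\<bar> powr q - h x * \<bar>w x\<bar> powr q) \<longlonglongrightarrow> 0"
      using lim
    proof eventually_elim
      case (elim x)
      have "(\<lambda>n. h x * \<bar>u n x\<bar> powr q - h x * \<bar>w x\<bar> powr q) \<longlonglongrightarrow> h x * \<bar>w x\<bar> powr q - h x * \<bar>w x\<bar> powr
          q"
        using q by (intro tendsto_diff tendsto_mult tendsto_powr' tendsto_rabs elim tendsto_const)
            auto
      then show ?case by simp
    qed
    show "integrable lborel (\<lambda>x. (u n x)\<^sup>2)" "(LINT x|lborel. (u n x)\<^sup>2) \<le> B" for n
      using u by (auto simp: sqint_def nsq_def)
    show "\<exists>Z. integrable lborel Z \<and> (\<forall>x. 0 \<le> Z x) \<and>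
          (\<forall>n x. h x * \<bar>u n x\<bar> powr q - h x * \<bar>w x\<bar> powr q \<le> e * (u n x)\<^sup>2 + Z x)" if e: "e > 0" for
              e
    proof (intro exI[of _ "\<lambda>x. e powr (- (q / (2 - q))) * \<bar>h x\<bar> powr (2 / (2 - q))"] conjI allI)
      fix n x
      have "0 \<le> h x * \<bar>w x\<bar> powr q" using h_nonneg[of x] by simp
      then show "h x * \<bar>u n x\<bar> powr q - h x * \<bar>w x\<bar> powr q \<le> e * (u n x)\<^sup>2 + e powr (- (q / (2
          - q))) * \<bar>h x\<bar> powr (2 / (2 - q))"
        using young[OF e, of x "u n x"] by linarith
    qed (use h_int in auto)
  qed (use d in auto)
  then show ?thesis
  proof eventually_elim
    case (elim n)
    then show ?case using Q_integrable[OF u(1)] Q_integrable[OF w] by simp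
  qed
qed

theorem minimizer_exists:
  assumes c: "c > 0"
  obtains w where "w \<in> S c" "\<And>v. v \<in> S c \<Longrightarrow> energy a b p q h w \<le> energy a b p q h v"
proof -
  let ?I = "energy a b p q h"
  define l where "l = (INF v\<in>S c. ?I v)"
  obtain K0 where "\<And>u. u \<in> S c \<Longrightarrow> ?I u \<ge> - K0" using energy_bounded_below[OF c] by metis
  then have bdd: "bdd_below (?I ` S c)" by (intro bdd_belowI[of _ "- K0"]) auto
  have l_le: "l \<le> ?I v" if "v \<in> S c" for v unfolding l_def using bdd that by (rule cINF_lower)
  obtain G where G: "\<And>u. u \<in> S c \<Longrightarrow> ?I u \<le> l + 1 \<Longrightarrow> dirichlet u \<le> G"
    using energy_bounded_below[OF c, of "l + 1"] by metis
  have "\<exists>u\<in>S c. ?I u < l + 1 / real (Suc n)" for n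
  proof -
    have "l < l + 1 / real (Suc n)" by simp
    then show ?thesis unfolding l_def
      by (subst (asm) (1) cINF_less_iff[OF S_nonempty[OF c] bdd]) auto
  qed
  then obtain u0 where u0: "\<And>n. u0 n \<in> S c" "\<And>n. ?I (u0 n) < l + 1 / real (Suc n)" by metis
  have "?I (u0 n) \<le> l + 1" for n
  proof -
    have "1 / real (Suc n) \<le> 1" by simp
    then show ?thesis using u0(2)[of n] by linarith
  qed
  then have uG: "dirichlet (u0 n) \<le> G" for n using G u0(1) by blast
  have u0H: "u0 n \<in> H1" "nsq lborel (u0 n) \<le> c" for n using u0(1)[of n] by (auto simp: S_eq)
  obtain r w where r: "strict_mono r" and w: "w \<in> H1" and ae: "AE x in lborel. (\<lambda>n. u0 (r n) x)
      \<longlonglongrightarrow> w x"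
    and lim1: "(\<lambda>n. ip lborel (u0 (r n)) w) \<longlonglongrightarrow> nsq lborel w"
    and lim2: "\<And>e. e > 0 \<Longrightarrow> \<forall>\<^sub>F n in sequentially. ip lborel (wgrad (u0 (r n))) (wgrad w)
        \<ge> dirichlet w - e"
    by (rule H1_compactness[OF u0H uG]) (rule that, assumption+)
  define u where "u n = u0 (r n)" for n
  have u: "u n \<in> H1" "nsq lborel (u n) = c" "dirichlet (u n) \<le> G" for n
    using u0(1)[of "r n"] uG by (auto simp: u_def S_eq)
  have Iu: "\<forall>\<^sub>F n in sequentially. ?I (u n) < l + e" if "e > 0" for e
  proof -
    have "(\<lambda>n. 1 / real (Suc n)) \<longlonglongrightarrow> 0" by (rule LIMSEQ_Suc[OF lim_const_over_n])
    then have "\<forall>\<^sub>F n in sequentially. 1 / real (Suc n) < e" using that by (rule order_tendstoD(2))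
    then have "\<forall>\<^sub>F n in sequentially. 1 / real (Suc (r n)) < e" by (rule eventually_subseq[OF r])
    then show ?thesis
    proof eventually_elim
      case (elim n)
      then show ?case using u0(2)[of "r n"] by (simp add: u_def)
    qed
  qed
  note sw = H1_sqint[OF w] and su = H1_sqint[OF u(1)]
  define \<alpha> where "\<alpha> = nsq lborel w"
  define A where "A = dirichlet w"
  have A: "A \<ge> 0" and \<alpha>: "\<alpha> \<ge> 0" by (auto simp: A_def \<alpha>_def dirichlet_nonneg nsq_nonneg)
  define v where "v n x = u n x - w x" for n x
  have vH: "v n \<in> H1" for n using H1_lin(1)[OF u(1) w, of n "-1"] by (simp add: v_def[abs_def])
  define B where "B n = dirichlet (v n)" for n
  have B: "B n = dirichlet (u n) - 2 * ip lborel (wgrad (u n)) (wgrad w) + A" for n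
    using H1_lin(3)[OF u(1) w, of n "-1"] by (simp add: v_def[abs_def] B_def A_def)
  define Gv where "Gv = 2 * G + 2 * A"
  have BG: "0 \<le> B n" "B n \<le> Gv" for n
  proof -
    show "0 \<le> B n" by (simp add: B_def dirichlet_nonneg)
    have "0 \<le> dirichlet (u n) + 2 * ip lborel (wgrad (u n)) (wgrad w) + A"
      using H1_lin(3)[OF u(1) w, of n 1] dirichlet_nonneg[of "\<lambda>x. u n x + 1 * w x"]
        by (simp add: A_def)
    then show "B n \<le> Gv" using u(3)[of n] unfolding B Gv_def by linarith
  qed
  have Gv: "Gv \<ge> 0" using BG[of 0] by linarith
  have vm: "nsq lborel (v n) = c - 2 * ip lborel (u n) w + \<alpha>" for n
    using nsq_diff[OF su sw, of n] by (simp add: v_def[abs_def] u(2) \<alpha>_def)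
  have vlim: "(\<lambda>n. nsq lborel (v n)) \<longlonglongrightarrow> c - \<alpha>"
  proof -
    have "(\<lambda>n. c - 2 * ip lborel (u n) w + \<alpha>) \<longlonglongrightarrow> c - 2 * \<alpha> + \<alpha>"
      unfolding u_def \<alpha>_def by (intro tendsto_intros lim1)
    then show ?thesis by (simp add: vm)
  qed
  have \<alpha>c: "\<alpha> \<le> c" using LIMSEQ_le_const[OF vlim, of 0] nsq_nonneg by fastforce
  \<comment> \<open>A mass bound for all \<open>v n\<close> at once; the sharper
    \<open>c - \<alpha>\<close> holds only in the limit.\<close>
  define m where "m = 2 * c + 2 * \<alpha>"
  have m: "m > 0" using c \<alpha> by (simp add: m_def)
  have vle: "nsq lborel (v n) \<le> m" for n
    using nsq_diff_le[OF su sw, of n] by (simp add: v_def[abs_def] u(2) \<alpha>_def m_def)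
  define t where "t = 2 + 4 / real DIM('a) - p"
  have t: "t > 0" using p by (simp add: t_def)
  obtain C where C: "C > 0"
    "\<And>(u :: 'a \<Rightarrow> real) l K. u \<in> H1 \<Longrightarrow> nsq lborel u \<le> m \<Longrightarrow> l > 0 \<Longrightarrow> K > 0 \<Longrightarrow>
       P u \<le> l powr (p - 2) * nsq lborel u + K powr (p - 2) * tailsq l u + C * K powr (- t) *
           dirichlet u"
    using power_integral_bound[OF m p] unfolding t_def by metis
  have Pv: "P (v n) \<le> 2 * K powr (p - 2) * nsq lborel (v n) + (C * Gv) * K powr (- t)" if K: "K > 0"
      for n K
  proof -
    have "K powr (p - 2) * tailsq K (v n) \<le> K powr (p - 2) * nsq lborel (v n)"
      using tailsq_integrable(2)[OF H1_sqint[OF vH]] by (intro mult_left_mono) auto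
    moreover have "C * K powr (- t) * dirichlet (v n) \<le> C * K powr (- t) * Gv"
      using C BG(2)[of n] by (intro mult_left_mono) (auto simp: B_def)
    ultimately show ?thesis using C(2)[OF vH vle K K, of n] by (simp add: mult_ac)
  qed
  define PB where "PB = 2 * m + C * Gv"
  have PB: "P (v n) \<le> PB" for n using Pv[of 1 n] vle[of n] by (simp add: PB_def)
  \<comment> \<open>Bounds every argument at which \<open>kin\<close> is compared below. The factor
    4 leaves room for the rescaling of \<open>v n\<close> by \<open>s n < 2\<close>.\<close>
  define M where "M = A + 4 * Gv + G"
  have G0: "G \<ge> 0" using u(3)[of 0] dirichlet_nonneg[of "u 0"] by linarith
  define L where "L = a + b * M"
  have L: "L > 0" unfolding L_def M_def using a b A Gv G0
    by (intro add_pos_nonneg mult_nonneg_nonneg) auto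
  \<comment> \<open>The energy after splitting, with the \<open>h\<close>-term seen by
    \<open>w\<close> alone. The competitors are compared with \<open>Z n\<close>, which is
    eventually almost at most \<open>l\<close>.\<close>
  define Z where "Z n = kin (A + B n) - (P w + P (v n)) / p - Q w / q" for n
  have star: "\<forall>\<^sub>F n in sequentially. Z n \<le> l + e" if e: "e > 0" for e
  proof -
    \<comment> \<open>The budget: \<open>2 * L * d\<close> for the gradient through the Lipschitz
      bound, and \<open>d\<close> each for the L^p term, the \<open>h\<close>-term and the distance
      of the energy from \<open>l\<close>.\<close>
    define d where "d = e / (2 * L + 3)"
    have d: "d > 0" using e L by (simp add: d_def)
    have "(2 * L + 3) * d = e" using L by (simp add: d_def)
    then have eq: "2 * L * d + 3 * d = e" by (simp only: distrib_right)
    have 1: "\<forall>\<^sub>F n in sequentially. ip lborel (wgrad (u n)) (wgrad w) \<ge> A - d"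
      unfolding u_def A_def by (rule lim2[OF d])
    have 2: "\<forall>\<^sub>F n in sequentially. P (u n) \<le> P w + P (v n) + d"
      unfolding v_def
      by (rule P_splitting[OF u(1) _ w _ _ d, where B=PB]) (use vH ae PB in \<open>auto simp:
          v_def[abs_def] u_def\<close>)
    have 3: "\<forall>\<^sub>F n in sequentially. Q (u n) \<le> Q w + d"
      by (rule Q_upper_limit[OF su _ sw _ d, where B=c]) (use ae u(2) in \<open>auto simp: u_def\<close>)
    show ?thesis using 1 2 3 Iu[OF d]
    proof eventually_elim
      case (elim n)
      have "kin (A + B n) \<le> kin (dirichlet (u n)) + (a + b * M) * (2 * d)"
      proof (rule kin_lipschitz)
        show "A + B n \<le> dirichlet (u n) + 2 * d" using elim(1) unfolding B by linarith
        show "A + B n \<le> M" "dirichlet (u n) \<le> M"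
          using BG[of n] u(3)[of n] A Gv G0 unfolding M_def by linarith+
      qed (use A BG d dirichlet_nonneg in auto)
      moreover have "P (u n) / p \<le> (P w + P (v n)) / p + d"
      proof -
        have "P (u n) / p \<le> (P w + P (v n) + d) / p" using elim(2) p
          by (intro divide_right_mono) auto
        moreover have "d / p \<le> d" using d p by (simp add: divide_le_eq)
        ultimately show ?thesis by (simp add: add_divide_distrib)
      qed
      moreover have "Q (u n) / q \<le> Q w / q + d"
      proof -
        have "Q (u n) / q \<le> (Q w + d) / q" using elim(3) q by (intro divide_right_mono) auto
        moreover have "d / q \<le> d" using d q by (simp add: divide_le_eq)
        ultimately show ?thesis by (simp add: add_divide_distrib)
      qed
      ultimately show ?case using elim(4) eq unfolding Z_def L_def energy_eq by linarith
    qed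
  qed
  have Zw: "?I w \<le> Z n + P (v n) / p" for n
    unfolding Z_def energy_eq A_def[symmetric] using kin_mono[OF A, of "A + B n"] BG(1)[of n]
    by (simp add: add_divide_distrib)
  \<comment> \<open>Dropping the gradient of the remainder, the energy of \<open>w\<close> exceeds
    \<open>Z n\<close> by at most \<open>P (v n) / p\<close>. Small values of \<open>P (v n)\<close>
    for infinitely many \<open>n\<close> suffice, so the negation later gives an eventual lower
    bound.\<close>
  have vanish: "?I w \<le> l" if fr: "\<And>d. d > 0 \<Longrightarrow> \<exists>\<^sub>F n in sequentially. P (v n) < d"
  proof (rule field_le_epsilon)
    fix e :: real assume e: "e > 0"
    have "\<exists>\<^sub>F n in sequentially. P (v n) < e / 2 \<and> Z n \<le> l + e / 2"
      using fr[of "e/2"] star[of "e/2"] e by (intro frequently_eventually_frequently) auto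
    then obtain n where n: "P (v n) < e / 2" "Z n \<le> l + e / 2" by (auto dest: frequently_ex)
    have "P (v n) / p \<le> P (v n)"
      using mult_left_mono[OF _ P_nonneg[of "v n"], of 1 p] p by (simp add: divide_le_eq)
    then show "?I w \<le> l + e" using Zw[of n] n by linarith
  qed
  show ?thesis
  proof (cases "\<alpha> = c")
    case True
    \<comment> \<open>No mass is lost. First \<open>K\<close> is taken large to make the high values
      small uniformly in \<open>n\<close>, then \<open>n\<close> large, as the mass of
      \<open>v n\<close> tends to 0.\<close>
    have "\<exists>\<^sub>F n in sequentially. P (v n) < d" if d: "d > 0" for d
    proof (rule eventually_frequently[OF sequentially_bot])
      have "\<forall>\<^sub>F K in at_top. (C * Gv) * K powr (- t) < d / 2 \<and> K > (0::real)"
        by (intro eventually_conj order_tendstoD(2)[OF tendsto_powr_neg_at_top[OF t]]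
            eventually_gt_at_top) (use d in simp)
      then obtain K where K: "(C * Gv) * K powr (- t) < d / 2" "K > 0"
        using eventually_happens'[OF trivial_limit_at_top_linorder] by blast
      have "(\<lambda>n. 2 * K powr (p - 2) * nsq lborel (v n)) \<longlonglongrightarrow> 2 * K powr (p - 2) * (c - \<alpha>)"
        by (intro tendsto_intros vlim)
      then have "\<forall>\<^sub>F n in sequentially. 2 * K powr (p - 2) * nsq lborel (v n) < d / 2"
        by (rule order_tendstoD(2)) (use True d in simp)
      then show "\<forall>\<^sub>F n in sequentially. P (v n) < d"
      proof eventually_elim
        case (elim n)
        then show ?case using Pv[OF K(2), of n] K(1) by linarith
      qed
    qed
    then have "?I w \<le> l" by (rule vanish)
    then show ?thesis using that[of w] l_le w True by (force simp: S_eq \<alpha>_def)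
  next
    case False
    then have less: "\<alpha> < c" using \<alpha>c by simp
    have False
    proof (cases "\<forall>d>0. \<exists>\<^sub>F n in sequentially. P (v n) < d")
      case True
      then have "?I w \<le> l" by (intro vanish) blast
      \<comment> \<open>\<open>w\<close> has energy at most \<open>l\<close> but mass below
        \<open>c\<close>; adding the missing mass would give a member of \<open>S c\<close> with
        energy below \<open>l\<close>.\<close>
      moreover obtain w' where "w' \<in> S c" "?I w' < ?I w"
        using add_mass_decreases_energy[OF w less[unfolded \<alpha>_def]] by blast
      ultimately show False using l_le[of w'] by linarith
    next
      case False
      then obtain d where d: "d > 0" and Pd: "\<forall>\<^sub>F n in sequentially. P (v n) \<ge> d"
        by (auto simp: not_frequently not_less)
      define \<beta> where "\<beta> = c - \<alpha>"
      have \<beta>: "\<beta> > 0" using less by (simp add: \<beta>_def)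
      \<comment> \<open>The competitor must have mass exactly \<open>c\<close>, while the mass of
        \<open>v n\<close> only tends to the missing mass \<open>\<beta>\<close>.\<close>
      define s where "s n = sqrt (\<beta> / nsq lborel (v n))" for n
      have s1: "s \<longlonglongrightarrow> 1"
      proof -
        have "(\<lambda>n. sqrt (\<beta> / nsq lborel (v n))) \<longlonglongrightarrow> sqrt (\<beta> / \<beta>)"
          using vlim \<beta> unfolding \<beta>_def[symmetric] by (intro tendsto_intros) auto
        then show ?thesis using \<beta> by (simp add: s_def[abs_def])
      qed
      \<comment> \<open>\<open>4 * Gv\<close> and \<open>d / 2\<close> anticipate the rescaling by
        \<open>s n\<close>, which will satisfy \<open>s n < 2\<close> and
        \<open>s n powr p > 1 / 2\<close>.\<close>
      obtain e k where ek: "e > 0" "k > 0"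
        "\<And>u :: 'a \<Rightarrow> real. u \<in> H1 \<Longrightarrow> nsq lborel u \<le> \<beta> \<Longrightarrow> dirichlet u \<le> 4 * Gv \<Longrightarrow> P u \<ge> d / 2
            \<Longrightarrow> \<exists>x. \<bar>bavg e u x\<bar> > k"
        using nonvanishing[OF \<beta> _ _ p, of "4 * Gv" "d / 2"] Gv d
        by (metis half_gt_zero mult_nonneg_nonneg zero_le_numeral)
      obtain \<delta> where \<delta>: "\<delta> > 0"
        "\<And>v :: 'a \<Rightarrow> real. v \<in> H1 \<Longrightarrow> nsq lborel v \<le> \<beta> \<Longrightarrow> \<exists>x. \<bar>bavg e v x\<bar> > k \<Longrightarrow>
           \<exists>z. Q (\<lambda>x. sqrt ((w x)\<^sup>2 + (v (x + z))\<^sup>2)) \<ge> Q w + \<delta>"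
        by (rule translation_gain[OF w \<beta> ek(1,2)]) (rule that, assumption+)
      \<comment> \<open>The cost of the rescaling in the kinetic and the L^p term, uniform in the
        values of \<open>B n\<close> and \<open>P (v n)\<close>; it vanishes because
        \<open>s\<close> tends to 1.\<close>
      define err where "err n = L * (\<bar>(s n)\<^sup>2 - 1\<bar> * Gv) + \<bar>1 - s n powr p\<bar> * PB / p" for n
      have "err \<longlonglongrightarrow> L * (\<bar>1\<^sup>2 - 1\<bar> * Gv) + \<bar>1 - 1 powr p\<bar> * PB / p"
        unfolding err_def[abs_def] using p by (intro tendsto_intros s1) auto
      then have err0: "err \<longlonglongrightarrow> 0" by simp
      \<comment> \<open>\<open>Z n \<le> l + \<eta>\<close> and \<open>err n < \<eta>\<close>
        against the gain \<open>\<delta> / q = 4 * \<eta>\<close> put the energy of the competitor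
        below \<open>l\<close>.\<close>
      define \<eta> where "\<eta> = \<delta> / (4 * q)"
      have \<eta>: "\<eta> > 0" "\<delta> / q = 4 * \<eta>" using \<delta> q by (auto simp: \<eta>_def)
      have sp: "(\<lambda>n. s n powr p) \<longlonglongrightarrow> 1 powr p" by (intro tendsto_intros s1) simp
      have "\<forall>\<^sub>F n in sequentially. P (v n) \<ge> d \<and> s n > 0 \<and> s n < 2 \<and> s n powr p > 1 / 2 \<and> err n < \<eta>
         \<and> Z n \<le> l + \<eta>"
        by (intro eventually_conj Pd star \<eta> order_tendstoD(1)[OF s1] order_tendstoD(2)[OF s1]
            order_tendstoD(1)[OF sp] order_tendstoD(2)[OF err0]) simp_all
      then obtain n where n: "P (v n) \<ge> d" "s n > 0" "s n < 2" "s n powr p > 1 / 2" "err n < \<eta>" "Z n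
          \<le> l + \<eta>"
        using eventually_happens'[OF sequentially_bot] by blast
      \<comment> \<open>Division by zero yields 0, so a zero mass of \<open>v n\<close> would make
        \<open>s n\<close> zero.\<close>
      have vn: "nsq lborel (v n) > 0" using n(2) \<beta> nsq_nonneg[of lborel "v n"]
        by (auto simp: s_def less_le)
      have s2: "(s n)\<^sup>2 = \<beta> / nsq lborel (v n)" using vn \<beta> by (simp add: s_def)
      define v' where "v' x = s n * v n x" for x
      have v'H: "v' \<in> H1" unfolding v'_def[abs_def] by (rule H1_scale(1)[OF vH])
      have v'm: "nsq lborel v' = \<beta>"
        using nsq_scaleR[of lborel "s n" "v n"] vn by (simp add: v'_def[abs_def] s2)
      have v'd: "dirichlet v' = (s n)\<^sup>2 * B n" unfolding v'_def[abs_def] B_def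
        by (rule H1_scale(2)[OF vH])
      have s4: "(s n)\<^sup>2 \<le> 4" using power_mono[of "s n" 2 2] n by simp
      have v'4: "dirichlet v' \<le> 4 * Gv" unfolding v'd using s4 BG[of n] by (intro mult_mono) auto
      have v'P: "P v' = s n powr p * P (v n)" unfolding v'_def by (rule PQ_scale(1)[OF n(2)])
      have "P v' \<ge> d / 2"
      proof -
        have "1 / 2 * d \<le> s n powr p * P (v n)" using n d by (intro mult_mono) auto
        then show ?thesis by (simp add: v'P)
      qed
      then have "\<exists>x. \<bar>bavg e v' x\<bar> > k" using ek(3)[OF v'H _ v'4] v'm by simp
      then obtain z where z: "Q (\<lambda>x. sqrt ((w x)\<^sup>2 + (v' (x + z))\<^sup>2)) \<ge> Q w + \<delta>"
        using \<delta>(2)[OF v'H] v'm by auto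
      define V where "V x = v' (x + z)" for x
      have VH: "V \<in> H1" and Vd: "dirichlet V = dirichlet v'" unfolding V_def[abs_def]
        by (rule H1_shift[OF v'H])+
      have [measurable]: "v' \<in> borel_measurable borel" using H1_sqint[OF v'H]
        by (simp add: sqint_def)
      have VP: "P V = P v'" unfolding V_def by (rule integral_lborel_shift[of
          "\<lambda>x. \<bar>v' x\<bar> powr p"]) measurable
      have Vm: "nsq lborel V = \<beta>" unfolding V_def[abs_def] using nsq_shift[OF H1_sqint[OF v'H]] v'm
        by simp
      define W where "W x = sqrt ((w x)\<^sup>2 + (V x)\<^sup>2)" for x
      have "W \<in> S c" unfolding S_eq W_def[abs_def] using H1_sqrt_sum_sq[OF w VH] Vm
        by (simp add: \<beta>_def \<alpha>_def)
      then have "l \<le> ?I W" by (rule l_le)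
      also have "\<dots> \<le> kin (A + (s n)\<^sup>2 * B n) - (P w + s n powr p * P (v n)) / p - Q W / q"
        unfolding W_def[abs_def] A_def using energy_sqrt_sum_sq[OF w VH]
          by (simp only: Vd v'd VP v'P)
      also have "\<dots> \<le> Z n + err n - \<delta> / q"
      proof -
        have "kin (A + (s n)\<^sup>2 * B n) \<le> kin (A + B n) + (a + b * M) * (\<bar>(s n)\<^sup>2 - 1\<bar> * Gv)"
        proof (rule kin_lipschitz)
          have "((s n)\<^sup>2 - 1) * B n \<le> \<bar>(s n)\<^sup>2 - 1\<bar> * Gv" using BG[of n] by (intro mult_mono) auto
          then show "A + (s n)\<^sup>2 * B n \<le> A + B n + \<bar>(s n)\<^sup>2 - 1\<bar> * Gv"
            by (simp add: left_diff_distrib)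
          show "A + (s n)\<^sup>2 * B n \<le> M" using v'4 G0 by (simp add: v'd M_def)
          show "A + B n \<le> M" using BG[of n] G0 Gv unfolding M_def by linarith
        qed (use A BG Gv in auto)
        moreover have "P (v n) / p - s n powr p * P (v n) / p \<le> \<bar>1 - s n powr p\<bar> * PB / p"
        proof -
          have "(1 - s n powr p) * P (v n) \<le> \<bar>1 - s n powr p\<bar> * PB"
            using PB[of n] P_nonneg[of "v n"] by (intro mult_mono) auto
          then have "(1 - s n powr p) * P (v n) / p \<le> \<bar>1 - s n powr p\<bar> * PB / p" using p
            by (intro divide_right_mono) auto
          then show ?thesis by (simp add: left_diff_distrib diff_divide_distrib)
        qed
        moreover have "(Q w + \<delta>) / q \<le> Q W / q"
          using z q unfolding W_def V_def by (intro divide_right_mono) auto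
        ultimately show ?thesis unfolding Z_def err_def L_def add_divide_distrib by linarith
      qed
      finally show False using n(5,6) \<eta> by linarith
    qed
    then show ?thesis ..
  qed
qed

end

theorem theorem1p1:
  fixes a b p q :: real and h :: "'a::euclidean_space \<Rightarrow> real"
  assumes "DIM('a) \<le> 3"
    and "a > 0" and "b > 0"
    and "1 \<le> q" and "q < 2"
    and "2 < p" and "p < 2 + 4 / real DIM('a)"
    and "\<And>x. h x \<ge> 0"
    and "h \<in> borel_measurable lborel"
    and "integrable lborel (\<lambda>x. \<bar>h x\<bar> powr (2 / (2 - q)))"
    and "emeasure lborel {x. h x > 0} > 0"
  shows "\<forall>c>0. \<exists>u\<in>S c.
            (\<forall>v\<in>S c. energy a b p q h u \<le> energy a b p q h v) \<and>
            energy a b p q h u = (INF v\<in>S c. energy a b p q h v) \<and>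
            (\<exists>lam. weak_solution a b p q h u lam)"
proof (intro allI impI)
  fix c :: real assume c: "c > 0"
  interpret kirchhoff a b p q h by unfold_locales (fact assms)+
  obtain u where u: "u \<in> S c" "\<And>v. v \<in> S c \<Longrightarrow> energy a b p q h u \<le> energy a b p q h v"
    using minimizer_exists[OF c] by blast
  have "(INF v\<in>S c. energy a b p q h v) = energy a b p q h u"
    using u by (intro cInf_eq_minimum) auto
  with u minimizer_weak_solution[OF c u]
  show "\<exists>u\<in>S c. (\<forall>v\<in>S c. energy a b p q h u \<le> energy a b p q h v) \<and>
            energy a b p q h u = (INF v\<in>S c. energy a b p q h v) \<and>
            (\<exists>lam. weak_solution a b p q h u lam)" by (intro bexI[of _ u]) auto
qed

end
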